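(* Let $(M^n,g,X,\lambda)$, $n\geq 3$, be a non-trivial compact oriented almost Ricci soliton, and let $X=\nabla h+Y$ be the Hodge-de Rham decomposition of $X$, where $h:M\to\mathbb{R}$ is a smooth function and $Y$ is a smooth vector field with $\operatorname{div}Y=0$. Then $Y$ is a Killing vector field on $M^n$ provided at least one of the following conditions is satisfied: (1) $X$ is a conformal vector field; (2) $(M^n,g)$ has constant scalar curvature.
   Context: An almost Ricci soliton $(M^n,g,X,\lambda)$ is a Riemannian manifold $(M^n,g)$ of dimension $n$ together with a complete smooth vector field $X$ and a smooth function $\lambda:M\to\mathbb{R}$ such that $Ric+\frac12\mathcal{L}_Xg=\lambda g$, where $Ric$ is the Ricci tensor and $\mathcal{L}_Xg$ is the Lie derivative of the metric. It is called trivial if $X$ is a Killing vector field, and non-trivial otherwise. Compact means compact without boundary. A vector field $X$ is conformal if $\mathcal{L}_Xg=2\rho g$ for some smooth function $\rho$ on $M$. On a compact oriented Riemannian manifold every smooth vector field $X$ can be written as $X=\nabla h+Y$ with $h$ a smooth function and $\operatorname{div}Y=0$ (Hodge-de Rham decomposition). *)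

theory Defs
  imports "HOL-Analysis.Analysis"
begin

text \<open>On an open set \<open>S\<close>, \<open>diff_upto k S f\<close> says that \<open>f\<close> is of class \<open>C\<^sup>k\<close>:
  all iterated directional derivatives of order at most \<open>k\<close> exist and are continuous.\<close>

primrec diff_upto ::
  "nat \<Rightarrow> 'a::real_normed_vector set \<Rightarrow> ('a \<Rightarrow> 'b::real_normed_vector) \<Rightarrow> bool" where
  "diff_upto 0 S f \<longleftrightarrow> continuous_on S f"
| "diff_upto (Suc k) S f \<longleftrightarrow>
     (\<forall>x\<in>S. f differentiable (at x)) \<and>
     (\<forall>v. diff_upto k S (\<lambda>x. frechet_derivative f (at x) v))"

definition smooth_on ::
  "'a::real_normed_vector set \<Rightarrow> ('a \<Rightarrow> 'b::real_normed_vector) \<Rightarrow> bool" where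
  "smooth_on S f \<longleftrightarrow> (\<forall>k. diff_upto k S f)"

text \<open>The points of a manifold are those of an abstract topology \<open>T\<close>, and its dimension is
  \<open>CARD('n)\<close>. Charts map onto open subsets of \<open>\<real>\<^sup>n\<close>, so there is no boundary.\<close>

record ('a, 'n) chart =
  dom :: "'a set"
  coord :: "'a \<Rightarrow> real ^ 'n"

definition chart_on :: "'a topology \<Rightarrow> ('a, 'n::finite) chart \<Rightarrow> bool" where
  "chart_on T c \<longleftrightarrow> openin T (dom c) \<and> open (coord c ` dom c) \<and>
     homeomorphic_map (subtopology T (dom c)) (top_of_set (coord c ` dom c)) (coord c)"

definition in_coords :: "('a, 'n::finite) chart \<Rightarrow> ('a \<Rightarrow> 'b) \<Rightarrow> real ^ 'n \<Rightarrow> 'b" where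
  "in_coords c f = f \<circ> inv_into (dom c) (coord c)"

definition smooth_compatible :: "('a, 'n::finite) chart \<Rightarrow> ('a, 'n) chart \<Rightarrow> bool" where
  "smooth_compatible c d \<longleftrightarrow>
     smooth_on (coord c ` (dom c \<inter> dom d)) (in_coords c (coord d)) \<and>
     smooth_on (coord d ` (dom c \<inter> dom d)) (in_coords d (coord c))"

text \<open>The atlas is not required to be maximal; every smooth atlas determines a smooth structure.\<close>

definition smooth_manifold :: "'a topology \<Rightarrow> ('a, 'n::finite) chart set \<Rightarrow> bool" where
  "smooth_manifold T A \<longleftrightarrow>
     Hausdorff_space T \<and> second_countable T \<and>
     (\<forall>c\<in>A. chart_on T c) \<and> (\<Union>c\<in>A. dom c) = topspace T \<and>
     (\<forall>c\<in>A. \<forall>d\<in>A. smooth_compatible c d)"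

text \<open>The coordinate derivative \<open>\<partial>f/\<partial>x\<^sup>i\<close> at the point \<open>p\<close>, in the chart \<open>c\<close>.\<close>

definition pd ::
  "('a, 'n::finite) chart \<Rightarrow> 'n \<Rightarrow> ('a \<Rightarrow> 'b::real_normed_vector) \<Rightarrow> 'a \<Rightarrow> 'b" where
  "pd c i f p = frechet_derivative (in_coords c f) (at (coord c p)) (axis i 1)"

definition jacobian ::
  "('a, 'n::finite) chart \<Rightarrow> ('a, 'n) chart \<Rightarrow> 'a \<Rightarrow> real ^ 'n ^ 'n" where
  "jacobian c d p = (\<chi> k i. pd c i (\<lambda>q. coord d q $ k) p)"

text \<open>An orientation is given by an atlas \<open>Or\<close> of the same smooth structure whose
  transition maps all have positive Jacobian determinant.\<close>

definition orientation ::
  "'a topology \<Rightarrow> ('a, 'n::finite) chart set \<Rightarrow> ('a, 'n) chart set \<Rightarrow> bool" where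
  "orientation T A Or \<longleftrightarrow>
     (\<forall>c\<in>Or. chart_on T c \<and> (\<forall>d\<in>A. smooth_compatible c d)) \<and>
     (\<Union>c\<in>Or. dom c) = topspace T \<and>
     (\<forall>c\<in>Or. \<forall>d\<in>Or. \<forall>p\<in>dom c \<inter> dom d. det (jacobian c d p) > 0)"

text \<open>A tensor field is represented by its components \<open>t c p\<close> at each point \<open>p\<close> in each
  chart \<open>c\<close> around \<open>p\<close>, subject to the transformation law of its type.\<close>

type_synonym ('a, 'n) vfield = "('a, 'n) chart \<Rightarrow> 'a \<Rightarrow> real ^ 'n"
type_synonym ('a, 'n) tensor2 = "('a, 'n) chart \<Rightarrow> 'a \<Rightarrow> real ^ 'n ^ 'n"

definition smooth_function :: "('a, 'n::finite) chart set \<Rightarrow> ('a \<Rightarrow> real) \<Rightarrow> bool" where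
  "smooth_function A f \<longleftrightarrow> (\<forall>c\<in>A. smooth_on (coord c ` dom c) (in_coords c f))"

definition smooth_vector_field ::
  "('a, 'n::finite) chart set \<Rightarrow> ('a, 'n) vfield \<Rightarrow> bool" where
  "smooth_vector_field A X \<longleftrightarrow>
     (\<forall>c\<in>A. smooth_on (coord c ` dom c) (in_coords c (X c))) \<and>
     (\<forall>c\<in>A. \<forall>d\<in>A. \<forall>p\<in>dom c \<inter> dom d. X d p = jacobian c d p *v X c p)"

definition riemannian_metric ::
  "('a, 'n::finite) chart set \<Rightarrow> ('a, 'n) tensor2 \<Rightarrow> bool" where
  "riemannian_metric A g \<longleftrightarrow>
     (\<forall>c\<in>A. smooth_on (coord c ` dom c) (in_coords c (g c))) \<and>
     (\<forall>c\<in>A. \<forall>p\<in>dom c. transpose (g c p) = g c p \<and> (\<forall>v. v \<noteq> 0 \<longrightarrow> v \<bullet> (g c p *v v) > 0)) \<and>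
     (\<forall>c\<in>A. \<forall>d\<in>A. \<forall>p\<in>dom c \<inter> dom d.
        g c p = transpose (jacobian c d p) ** g d p ** jacobian c d p)"

definition complete_vector_field ::
  "'a topology \<Rightarrow> ('a, 'n::finite) chart set \<Rightarrow> ('a, 'n) vfield \<Rightarrow> bool" where
  "complete_vector_field T A X \<longleftrightarrow>
     (\<forall>p\<in>topspace T. \<exists>\<gamma>::real \<Rightarrow> 'a. continuous_map euclideanreal T \<gamma> \<and> \<gamma> 0 = p \<and>
        (\<forall>t. \<forall>c\<in>A. \<gamma> t \<in> dom c \<longrightarrow>
           ((coord c \<circ> \<gamma>) has_vector_derivative X c (\<gamma> t)) (at t)))"

definition christoffel ::
  "('a, 'n::finite) tensor2 \<Rightarrow> ('a, 'n) chart \<Rightarrow> 'n \<Rightarrow> 'n \<Rightarrow> 'n \<Rightarrow> 'a \<Rightarrow> real" where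
  "christoffel g c k i j p =
     (\<Sum>l\<in>UNIV. matrix_inv (g c p) $ k $ l *
        (pd c i (\<lambda>q. g c q $ j $ l) p + pd c j (\<lambda>q. g c q $ i $ l) p
         - pd c l (\<lambda>q. g c q $ i $ j) p)) / 2"

text \<open>\<open>riemann g c l k i j\<close> is the \<open>\<partial>\<^sub>l\<close>-component of
  \<open>R(\<partial>\<^sub>i, \<partial>\<^sub>j)\<partial>\<^sub>k = \<nabla>\<^sub>i\<nabla>\<^sub>j\<partial>\<^sub>k - \<nabla>\<^sub>j\<nabla>\<^sub>i\<partial>\<^sub>k\<close>, and
  \<open>Ric(Y, Z)\<close> is the trace of \<open>V \<mapsto> R(V, Y)Z\<close>; with these conventions round spheres have
  positive Ricci curvature.\<close>

definition riemann ::
  "('a, 'n::finite) tensor2 \<Rightarrow> ('a, 'n) chart \<Rightarrow> 'n \<Rightarrow> 'n \<Rightarrow> 'n \<Rightarrow> 'n \<Rightarrow> 'a \<Rightarrow> real" where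
  "riemann g c l k i j p =
     pd c i (christoffel g c l j k) p - pd c j (christoffel g c l i k) p
     + (\<Sum>m\<in>UNIV. christoffel g c l i m p * christoffel g c m j k p
                - christoffel g c l j m p * christoffel g c m i k p)"

definition ricci :: "('a, 'n::finite) tensor2 \<Rightarrow> ('a, 'n) tensor2" where
  "ricci g c p = (\<chi> j k. \<Sum>i\<in>UNIV. riemann g c i k i j p)"

definition scalar_curvature ::
  "('a, 'n::finite) tensor2 \<Rightarrow> ('a, 'n) chart \<Rightarrow> 'a \<Rightarrow> real" where
  "scalar_curvature g c p =
     (\<Sum>i\<in>UNIV. \<Sum>j\<in>UNIV. matrix_inv (g c p) $ i $ j * ricci g c p $ i $ j)"

definition lie_derivative_metric ::
  "('a, 'n::finite) vfield \<Rightarrow> ('a, 'n) tensor2 \<Rightarrow> ('a, 'n) tensor2" where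
  "lie_derivative_metric X g c p = (\<chi> i j. \<Sum>k\<in>UNIV.
      X c p $ k * pd c k (\<lambda>q. g c q $ i $ j) p
      + g c p $ k $ j * pd c i (\<lambda>q. X c q $ k) p
      + g c p $ i $ k * pd c j (\<lambda>q. X c q $ k) p)"

definition gradient ::
  "('a, 'n::finite) tensor2 \<Rightarrow> ('a \<Rightarrow> real) \<Rightarrow> ('a, 'n) vfield" where
  "gradient g h c p = (\<chi> i. \<Sum>j\<in>UNIV. matrix_inv (g c p) $ i $ j * pd c j h p)"

text \<open>The divergence is the trace of \<open>\<nabla>Y\<close>.\<close>

definition divergence ::
  "('a, 'n::finite) tensor2 \<Rightarrow> ('a, 'n) vfield \<Rightarrow> ('a, 'n) chart \<Rightarrow> 'a \<Rightarrow> real" where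
  "divergence g Y c p =
     (\<Sum>i\<in>UNIV. pd c i (\<lambda>q. Y c q $ i) p + (\<Sum>j\<in>UNIV. christoffel g c i i j p * Y c p $ j))"

definition killing_field ::
  "('a, 'n::finite) chart set \<Rightarrow> ('a, 'n) tensor2 \<Rightarrow> ('a, 'n) vfield \<Rightarrow> bool" where
  "killing_field A g X \<longleftrightarrow> smooth_vector_field A X \<and>
     (\<forall>c\<in>A. \<forall>p\<in>dom c. lie_derivative_metric X g c p = 0)"

definition conformal_field ::
  "('a, 'n::finite) chart set \<Rightarrow> ('a, 'n) tensor2 \<Rightarrow> ('a, 'n) vfield \<Rightarrow> bool" where
  "conformal_field A g X \<longleftrightarrow> smooth_vector_field A X \<and>
     (\<exists>\<rho>. smooth_function A \<rho> \<and>
        (\<forall>c\<in>A. \<forall>p\<in>dom c. lie_derivative_metric X g c p = (2 * \<rho> p) *\<^sub>R g c p))"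

definition constant_scalar_curvature ::
  "('a, 'n::finite) chart set \<Rightarrow> ('a, 'n) tensor2 \<Rightarrow> bool" where
  "constant_scalar_curvature A g \<longleftrightarrow>
     (\<exists>r. \<forall>c\<in>A. \<forall>p\<in>dom c. scalar_curvature g c p = r)"

definition almost_ricci_soliton ::
  "'a topology \<Rightarrow> ('a, 'n::finite) chart set \<Rightarrow> ('a, 'n) tensor2 \<Rightarrow> ('a, 'n) vfield \<Rightarrow>
     ('a \<Rightarrow> real) \<Rightarrow> bool" where
  "almost_ricci_soliton T A g X lam \<longleftrightarrow>
     smooth_manifold T A \<and> riemannian_metric A g \<and>
     smooth_vector_field A X \<and> complete_vector_field T A X \<and> smooth_function A lam \<and>
     (\<forall>c\<in>A. \<forall>p\<in>dom c.
        ricci g c p + (1/2) *\<^sub>R lie_derivative_metric X g c p = lam p *\<^sub>R g c p)"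

definition trivial_soliton ::
  "('a, 'n::finite) chart set \<Rightarrow> ('a, 'n) tensor2 \<Rightarrow> ('a, 'n) vfield \<Rightarrow> bool" where
  "trivial_soliton A g X \<longleftrightarrow> killing_field A g X"

definition hodge_de_rham_decomposition ::
  "('a, 'n::finite) chart set \<Rightarrow> ('a, 'n) tensor2 \<Rightarrow> ('a, 'n) vfield \<Rightarrow>
     ('a \<Rightarrow> real) \<Rightarrow> ('a, 'n) vfield \<Rightarrow> bool" where
  "hodge_de_rham_decomposition A g X h Y \<longleftrightarrow>
     smooth_function A h \<and> smooth_vector_field A Y \<and>
     (\<forall>c\<in>A. \<forall>p\<in>dom c. divergence g Y c p = 0) \<and>
     (\<forall>c\<in>A. \<forall>p\<in>dom c. X c p = gradient g h c p + Y c p)"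

end

theory Submission
  imports Defs
begin

text \<open>Both cases reduce to an Einstein metric \<open>Ric = \<mu> g\<close> with \<open>\<mu>\<close> locally constant. If \<open>X\<close> is conformal,
  the soliton equation gives \<open>Ric = \<mu> g\<close>, and Schur's lemma applies. If the scalar curvature \<open>R\<close> is
  constant, let \<open>P\<close> be the traceless Ricci tensor; the contracted Bianchi identity and the soliton
  equation give \<open>div (P X) = - |P|\<^sup>2\<close>, so the divergence theorem yields \<open>P = 0\<close>.

  In the Einstein case put \<open>\<rho> = \<lambda> - \<mu>\<close> and \<open>B = L\<^sub>Y g / 2 = \<rho> g - Hess h\<close>. The trace of \<open>B\<close> is \<open>div Y = 0\<close>,
  so \<open>\<Delta>h = n\<rho>\<close>, and the Ricci identity gives \<open>div B = - d f\<close> with \<open>f = (n - 1)\<rho> + \<mu> h\<close>. Hence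
  \<open>div (B Y + f Y) = |B|\<^sup>2\<close>, and the divergence theorem yields \<open>B = 0\<close>. The vector fields involved
  transform correctly because \<open>Ric\<close> is expressed through \<open>g\<close> and \<open>L\<^sub>X g\<close> by the soliton equation; the
  transformation law of the Ricci tensor itself is never needed.\<close>

section \<open>Functions of class \<open>C\<^sup>k\<close>\<close>

text \<open>Curvature identities are computed inside a single chart, as identities between
  matrix-valued functions: \<open>Gam i\<close> is the connection matrix and \<open>Om i j\<close>
  its curvature, so index bookkeeping is confined to a few contractions. Charts are compared only
  where local data must become global: in the transformation laws of the vector fields and in the
  change of variables. No integral over the manifold is defined; each integral is taken over
  Euclidean space, of a function with compact support in one chart. The divergence theorem is
  therefore phrased as "a nonnegative divergence vanishes", which is what a pointwise identity with
  a squared norm asks for. Only one derivative ever falls on a cutoff function, hence C^1 bumps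
  suffice. Both squared norms have one origin: contracting a symmetric tensor with the covariant
  derivative of a field sees only half the Lie derivative of the metric along the field, and this
  half is the tensor itself up to sign and a multiple of \<open>g\<close>. Since the tensor is
  traceless, the multiple contributes nothing.\<close>

lemma diff_upto_cong:
  assumes "open S" "\<And>x. x \<in> S \<Longrightarrow> f x = g x" "diff_upto k S f"
  shows "diff_upto k S g"
  using assms(2,3)
proof (induction k arbitrary: f g)
  case 0
  then show ?case by (simp cong: continuous_on_cong)
next
  case (Suc k)
  have d: "g differentiable (at x)" "frechet_derivative f (at x) = frechet_derivative g (at x)"
    if "x \<in> S" for x
  proof -
    have f: "f differentiable (at x)" using Suc.prems that by auto
    show "g differentiable (at x)"
      using f Suc.prems(1) has_derivative_transform_within_open[OF _ \<open>open S\<close> that]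
      unfolding differentiable_def by blast
    show "frechet_derivative f (at x) = frechet_derivative g (at x)"
      using frechet_derivative_transform_within_open[OF f \<open>open S\<close> that] Suc.prems(1) by blast
  qed
  have "diff_upto k S (\<lambda>x. frechet_derivative g (at x) v)" for v
    by (rule Suc.IH[of "\<lambda>x. frechet_derivative f (at x) v"]) (use Suc.prems d in auto)
  with d show ?case by auto
qed

text \<open>\<open>frechet_derivative\<close> is a choice operator, so the recursive clause is
  awkward to meet directly. Any explicit derivative \<open>F\<close> coincides with it on
  \<open>S\<close>, and openness of \<open>S\<close> lets \<open>diff_upto_cong\<close> carry the
  regularity over.\<close>

lemma diff_upto_SucI:
  assumes "open S" "\<And>x. x \<in> S \<Longrightarrow> (f has_derivative F x) (at x)"
    and "\<And>v. diff_upto k S (\<lambda>x. F x v)"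
  shows "diff_upto (Suc k) S f"
proof -
  have "diff_upto k S (\<lambda>x. frechet_derivative f (at x) v)" for v
    by (rule diff_upto_cong[OF assms(1) _ assms(3)[of v]])
       (use frechet_derivative_at[OF assms(2)] in auto)
  then show ?thesis using assms(2) by (auto simp: differentiable_def)
qed

lemma diff_upto_SucD:
  assumes "diff_upto (Suc k) S f"
  shows "x \<in> S \<Longrightarrow> (f has_derivative frechet_derivative f (at x)) (at x)"
    and "diff_upto k S (\<lambda>x. frechet_derivative f (at x) v)"
  using assms frechet_derivative_works by auto

lemma diff_upto_Suc_imp: "diff_upto (Suc k) S f \<Longrightarrow> diff_upto k S f"
proof (induction k arbitrary: f)
  case 0
  then show ?case
    by (auto intro!: continuous_at_imp_continuous_on differentiable_imp_continuous_within)
next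
  case (Suc k)
  then show ?case by (metis diff_upto.simps(2))
qed

lemma diff_upto_le: "diff_upto m S f \<Longrightarrow> k \<le> m \<Longrightarrow> diff_upto k S f"
  by (induction m) (auto simp: le_Suc_eq simp del: diff_upto.simps dest: diff_upto_Suc_imp)

lemma diff_upto_imp_continuous_on: "diff_upto k S f \<Longrightarrow> continuous_on S f"
  using diff_upto_le[of k S f 0] by simp

lemma diff_upto_subset: "diff_upto k S f \<Longrightarrow> T \<subseteq> S \<Longrightarrow> diff_upto k T f"
  by (induction k arbitrary: f) (auto intro: continuous_on_subset)

lemma diff_upto_Un:
  assumes "open S" "open T" "diff_upto k S f" "diff_upto k T f"
  shows "diff_upto k (S \<union> T) f"
  using assms(3,4) by (induction k arbitrary: f) (use assms in \<open>auto intro: continuous_on_open_Un\<close>)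

lemma diff_upto_const: "open S \<Longrightarrow> diff_upto k S (\<lambda>x. a)"
proof (induction k arbitrary: a)
  case (Suc k)
  show ?case by (rule diff_upto_SucI[where F="\<lambda>x v. 0"]) (use Suc in auto)
qed auto

lemma diff_upto_bounded_linear:
  assumes "open S" "bounded_linear L" "diff_upto k S f"
  shows "diff_upto k S (\<lambda>x. L (f x))"
  using assms(3)
proof (induction k arbitrary: f)
  case 0
  then show ?case using assms(2) by (auto intro: bounded_linear.continuous_on)
next
  case (Suc k)
  show ?case
    by (rule diff_upto_SucI[OF assms(1), where F="\<lambda>x v. L (frechet_derivative f (at x) v)"])
       (use Suc diff_upto_SucD(1)[OF Suc.prems] assms(2) in
         \<open>auto intro: bounded_linear.has_derivative\<close>)
qed

lemma diff_upto_add: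
  assumes "open S" "diff_upto k S f" "diff_upto k S g"
  shows "diff_upto k S (\<lambda>x. f x + g x)"
  using assms(2,3)
proof (induction k arbitrary: f g)
  case (Suc k)
  show ?case
    by (rule diff_upto_SucI[OF assms(1), where F="\<lambda>x v. frechet_derivative f (at x) v + frechet_derivative g (at x) v"])
       (use Suc diff_upto_SucD(1)[OF Suc.prems(1)] diff_upto_SucD(1)[OF Suc.prems(2)] in
         \<open>auto intro!: derivative_intros\<close>)
qed (auto intro: continuous_intros)

lemma diff_upto_sum:
  assumes "open S" "\<And>i. i \<in> I \<Longrightarrow> diff_upto k S (f i)"
  shows "diff_upto k S (\<lambda>x. \<Sum>i\<in>I. f i x)"
  using assms(2)
  by (induction I rule: infinite_finite_induct) (auto intro!: diff_upto_const diff_upto_add assms(1))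

text \<open>The product rule gives a sum of two terms that are again \<open>B\<close> of two
  functions, one of them differentiated; hence the induction keeps \<open>f\<close> and
  \<open>g\<close> arbitrary.\<close>

lemma diff_upto_bounded_bilinear:
  assumes "open S" "bounded_bilinear B" "diff_upto k S f" "diff_upto k S g"
  shows "diff_upto k S (\<lambda>x. B (f x) (g x))"
  using assms(3,4)
proof (induction k arbitrary: f g)
  case 0
  then show ?case by (auto intro: bounded_bilinear.continuous_on[OF assms(2)])
next
  case (Suc k)
  show ?case
  proof (rule diff_upto_SucI[OF assms(1),
      where F="\<lambda>x v. B (f x) (frechet_derivative g (at x) v) + B (frechet_derivative f (at x) v) (g x)"])
    show "((\<lambda>x. B (f x) (g x)) has_derivative
        (\<lambda>v. B (f x) (frechet_derivative g (at x) v) + B (frechet_derivative f (at x) v) (g x))) (at x)"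
      if "x \<in> S" for x
      using bounded_bilinear.FDERIV[OF assms(2) diff_upto_SucD(1)[OF Suc.prems(1) that]
          diff_upto_SucD(1)[OF Suc.prems(2) that]] .
    show "diff_upto k S (\<lambda>x. B (f x) (frechet_derivative g (at x) v) + B (frechet_derivative f (at x) v) (g x))" for v
      by (intro diff_upto_add Suc.IH assms(1) diff_upto_SucD(2)[OF Suc.prems(1)]
          diff_upto_SucD(2)[OF Suc.prems(2)] diff_upto_Suc_imp[OF Suc.prems(1)]
          diff_upto_Suc_imp[OF Suc.prems(2)])
  qed
qed

lemma diff_upto_mult:
  fixes f g :: "'a::real_normed_vector \<Rightarrow> real"
  assumes "open S" "diff_upto k S f" "diff_upto k S g"
  shows "diff_upto k S (\<lambda>x. f x * g x)"
  by (rule diff_upto_bounded_bilinear[OF assms(1) bounded_bilinear_mult assms(2,3)])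

lemma diff_upto_uminus:
  fixes f :: "'a::real_normed_vector \<Rightarrow> 'b::real_normed_vector"
  assumes "open S" "diff_upto k S f" shows "diff_upto k S (\<lambda>x. - f x)"
  using diff_upto_bounded_linear[OF assms(1) bounded_linear_minus[OF bounded_linear_ident] assms(2)] .

lemma diff_upto_diff:
  fixes f g :: "'a::real_normed_vector \<Rightarrow> 'b::real_normed_vector"
  assumes "open S" "diff_upto k S f" "diff_upto k S g"
  shows "diff_upto k S (\<lambda>x. f x - g x)"
  using diff_upto_add[OF assms(1,2) diff_upto_uminus[OF assms(1,3)]] by simp

lemma diff_upto_prod:
  fixes f :: "'i \<Rightarrow> 'a::real_normed_vector \<Rightarrow> real"
  assumes "open S" "\<And>i. i \<in> I \<Longrightarrow> diff_upto k S (f i)"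
  shows "diff_upto k S (\<lambda>x. \<Prod>i\<in>I. f i x)"
  using assms(2)
  by (induction I rule: infinite_finite_induct) (auto intro!: diff_upto_const diff_upto_mult assms(1))

text \<open>The derivative of \<open>1 / f\<close> is a polynomial in \<open>1 / f\<close> and the
  derivative of \<open>f\<close>, so the induction hypothesis is needed for \<open>1 / f\<close>
  itself only and \<open>f\<close> stays fixed.\<close>

lemma diff_upto_inverse:
  fixes f :: "'a::real_normed_vector \<Rightarrow> real"
  assumes "open S" "diff_upto k S f" "\<And>x. x \<in> S \<Longrightarrow> f x \<noteq> 0"
  shows "diff_upto k S (\<lambda>x. inverse (f x))"
  using assms(2)
proof (induction k)
  case 0
  then show ?case using assms by (auto intro!: continuous_intros)
next
  case (Suc k)
  show ?case
  proof (rule diff_upto_SucI[OF assms(1),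
      where F="\<lambda>x v. - (inverse (f x) * frechet_derivative f (at x) v * inverse (f x))"])
    show "((\<lambda>x. inverse (f x)) has_derivative
        (\<lambda>v. - (inverse (f x) * frechet_derivative f (at x) v * inverse (f x)))) (at x)"
      if "x \<in> S" for x
      using Deriv.has_derivative_inverse[OF assms(3)[OF that] diff_upto_SucD(1)[OF Suc.prems that]] .
    show "diff_upto k S (\<lambda>x. - (inverse (f x) * frechet_derivative f (at x) v * inverse (f x)))" for v
      by (intro diff_upto_uminus diff_upto_mult Suc.IH assms(1) diff_upto_SucD(2)[OF Suc.prems]
           diff_upto_Suc_imp[OF Suc.prems])
  qed
qed

lemma diff_upto_divide:
  fixes f g :: "'a::real_normed_vector \<Rightarrow> real"
  assumes "open S" "diff_upto k S f" "diff_upto k S g" "\<And>x. x \<in> S \<Longrightarrow> g x \<noteq> 0"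
  shows "diff_upto k S (\<lambda>x. f x / g x)"
  unfolding divide_inverse by (intro diff_upto_mult diff_upto_inverse assms)

lemma diff_upto_sqrt:
  fixes f :: "'a::real_normed_vector \<Rightarrow> real"
  assumes "open S" "diff_upto k S f" "\<And>x. x \<in> S \<Longrightarrow> f x > 0"
  shows "diff_upto k S (\<lambda>x. sqrt (f x))"
  using assms(2)
proof (induction k)
  case 0
  then show ?case using assms by (auto intro!: continuous_intros)
next
  case (Suc k)
  show ?case
  proof (rule diff_upto_SucI[OF assms(1),
      where F="\<lambda>x v. frechet_derivative f (at x) v * ((1/2) * inverse (sqrt (f x)))"])
    show "((\<lambda>x. sqrt (f x)) has_derivative
        (\<lambda>v. frechet_derivative f (at x) v * ((1/2) * inverse (sqrt (f x))))) (at x)"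
      if "x \<in> S" for x
      using has_derivative_real_sqrt[OF assms(3)[OF that] diff_upto_SucD(1)[OF Suc.prems that]]
      by (simp add: field_simps)
    show "diff_upto k S (\<lambda>x. frechet_derivative f (at x) v * ((1/2) * inverse (sqrt (f x))))" for v
    proof (intro diff_upto_mult diff_upto_const diff_upto_inverse Suc.IH assms(1) diff_upto_SucD(2)[OF Suc.prems]
           diff_upto_Suc_imp[OF Suc.prems])
      show "sqrt (f x) \<noteq> 0" if "x \<in> S" for x using assms(3)[OF that] by simp
    qed
  qed
qed

section \<open>Composition and symmetry of second derivatives\<close>

lemma linear_sum_axis:
  fixes L :: "real ^ 'n \<Rightarrow> 'b::real_normed_vector"
  assumes "linear L"
  shows "L v = (\<Sum>a\<in>UNIV. (v $ a) *\<^sub>R L (axis a 1))"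
proof -
  have "v = (\<Sum>a\<in>UNIV. (v $ a) *\<^sub>R axis a 1)"
    by (simp add: vec_eq_iff axis_def if_distrib cong: if_cong)
  then have "L v = L (\<Sum>a\<in>UNIV. (v $ a) *\<^sub>R axis a 1)" by simp
  also have "\<dots> = (\<Sum>a\<in>UNIV. (v $ a) *\<^sub>R L (axis a 1))"
    using assms by (simp add: linear_sum linear_cmul)
  finally show ?thesis .
qed

lemma diff_upto_vec:
  fixes f :: "'a::real_normed_vector \<Rightarrow> 'b::real_normed_vector ^ 'n"
  assumes "open S" "\<And>i. diff_upto k S (\<lambda>x. f x $ i)"
  shows "diff_upto k S f"
proof -
  have L: "bounded_linear (\<lambda>r::'b. axis i r :: 'b ^ 'n)" for i
  proof (rule bounded_linear_intro[where K=1])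
    show "norm (axis i r :: 'b ^ 'n) \<le> norm r * 1" for r :: 'b
    proof -
      have "norm (axis i r :: 'b ^ 'n) \<le> (\<Sum>j\<in>UNIV. norm ((axis i r :: 'b ^ 'n) $ j))"
        unfolding norm_vec_def by (rule L2_set_le_sum) simp
      also have "\<dots> = (\<Sum>j\<in>UNIV. if j = i then norm r else 0)"
        by (intro sum.cong) (auto simp: axis_def)
      finally show ?thesis by simp
    qed
  qed (auto simp: vec_eq_iff axis_def)
  have "f x = (\<Sum>i\<in>UNIV. axis i (f x $ i))" for x
    by (simp add: vec_eq_iff axis_def if_distrib cong: if_cong)
  then have "f = (\<lambda>x. \<Sum>i\<in>UNIV. axis i (f x $ i))" by auto
  moreover have "diff_upto k S (\<lambda>x. \<Sum>i\<in>UNIV. axis i (f x $ i))"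
    by (intro diff_upto_sum diff_upto_bounded_linear[OF assms(1) L] assms)
  ultimately show ?thesis by simp
qed

text \<open>In the chain rule the derivative of \<open>F\<close> is applied to a direction that
  varies with \<open>x\<close>, while \<open>diff_upto\<close> controls fixed directions only.
  Expanding that direction in the basis \<open>axis a 1\<close> leaves finitely many fixed ones,
  with scalar coefficients.\<close>

lemma diff_upto_compose:
  fixes F :: "real ^ 'n \<Rightarrow> real"
  assumes "open S" "open U" "diff_upto k S T" "T ` S \<subseteq> U" "diff_upto k U F"
  shows "diff_upto k S (\<lambda>x. F (T x))"
  using assms(3,5)
proof (induction k arbitrary: F)
  case 0
  then show ?case using assms(4) by (auto intro: continuous_on_compose2)
next
  case (Suc k)
  let ?DF = "\<lambda>x. frechet_derivative F (at x)" and ?DT = "\<lambda>x. frechet_derivative T (at x)"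
  show ?case
  proof (rule diff_upto_SucI[OF assms(1),
      where F="\<lambda>x v. \<Sum>a\<in>UNIV. (?DT x v $ a) * ?DF (T x) (axis a 1)"])
    show "((\<lambda>x. F (T x)) has_derivative (\<lambda>v. \<Sum>a\<in>UNIV. (?DT x v $ a) * ?DF (T x) (axis a 1))) (at x)"
      if "x \<in> S" for x
    proof -
      have 1: "(T has_derivative ?DT x) (at x)" using diff_upto_SucD(1)[OF Suc.prems(1) that] .
      have 2: "(F has_derivative ?DF (T x)) (at (T x))"
        using diff_upto_SucD(1)[OF Suc.prems(2)] assms(4) that by auto
      have "(\<lambda>v. ?DF (T x) (?DT x v)) = (\<lambda>v. \<Sum>a\<in>UNIV. (?DT x v $ a) * ?DF (T x) (axis a 1))"
        using linear_sum_axis[OF has_derivative_linear[OF 2], of "?DT x _"] by (intro ext) simp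
      with has_derivative_compose[OF 1 2] show ?thesis by simp
    qed
    show "diff_upto k S (\<lambda>x. \<Sum>a\<in>UNIV. (?DT x v $ a) * ?DF (T x) (axis a 1))" for v
      by (intro diff_upto_sum diff_upto_mult Suc.IH diff_upto_bounded_linear[of S "\<lambda>x. x $ _"]
          bounded_linear_vec_nth
          assms(1) diff_upto_SucD(2)[OF Suc.prems(1)] diff_upto_SucD(2)[OF Suc.prems(2)]
          diff_upto_Suc_imp[OF Suc.prems(1)])
  qed
qed

text \<open>Both iterated derivatives are limits of the second difference
  \<open>f(x + hu + hv) - f(x + hu) - f(x + hv) + f(x)\<close> divided by \<open>h\<^sup>2\<close>.\<close>

lemma second_difference_mean_value:
  fixes f :: "'a::real_normed_vector \<Rightarrow> real"
  assumes "h > 0" and S: "\<And>s t. 0 \<le> s \<Longrightarrow> s \<le> h \<Longrightarrow> 0 \<le> t \<Longrightarrow> t \<le> h \<Longrightarrow> x + s *\<^sub>R u + t *\<^sub>R v \<in> S"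
    and f: "diff_upto 2 S f"
  shows "\<exists>s t. 0 < s \<and> s < h \<and> 0 < t \<and> t < h \<and>
    f (x + h *\<^sub>R u + h *\<^sub>R v) - f (x + h *\<^sub>R u) - f (x + h *\<^sub>R v) + f x =
      h * h * frechet_derivative (\<lambda>y. frechet_derivative f (at y) u) (at (x + s *\<^sub>R u + t *\<^sub>R v)) v"
proof -
  have f1: "diff_upto (Suc (Suc 0)) S f" using f by (simp add: numeral_2_eq_2)
  note d1 = diff_upto_SucD(1)[OF f1]
  note d2 = diff_upto_SucD(1)[OF diff_upto_SucD(2)[OF f1]]
  \<comment> \<open>The second difference equals \<open>\<phi> h - \<phi> 0\<close>. The mean value
    theorem is used in direction \<open>u\<close> on \<open>\<phi>\<close>, and then in direction
    \<open>v\<close> on the derivative along \<open>u\<close>.\<close>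
  define \<phi> where "\<phi> s = f (x + s *\<^sub>R u + h *\<^sub>R v) - f (x + s *\<^sub>R u)" for s
  define Df where "Df y = frechet_derivative f (at y)" for y
  have dd: "((\<lambda>s. f (z + s *\<^sub>R w)) has_real_derivative Df (z + s *\<^sub>R w) w) (at s)"
    if "z + s *\<^sub>R w \<in> S" for z w s
  proof -
    have "((\<lambda>s. z + s *\<^sub>R w) has_derivative (\<lambda>s. s *\<^sub>R w)) (at s)"
      by (auto intro!: derivative_eq_intros)
    from has_derivative_compose[OF this d1[OF that]]
    have "((\<lambda>s. f (z + s *\<^sub>R w)) has_derivative (\<lambda>r. Df (z + s *\<^sub>R w) (r *\<^sub>R w))) (at s)"
      unfolding Df_def .
    moreover have "Df (z + s *\<^sub>R w) (r *\<^sub>R w) = Df (z + s *\<^sub>R w) w * r" for r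
      using linear_cmul[OF has_derivative_linear[OF d1[OF that]]] by (simp add: Df_def)
    ultimately show ?thesis by (simp add: has_field_derivative_def)
  qed
  have phi': "(\<phi> has_real_derivative (Df (x + s *\<^sub>R u + h *\<^sub>R v) u - Df (x + s *\<^sub>R u) u)) (at s)"
    if "0 \<le> s" "s \<le> h" for s
  proof -
    have "((\<lambda>s. f (x + h *\<^sub>R v + s *\<^sub>R u)) has_real_derivative Df (x + h *\<^sub>R v + s *\<^sub>R u) u) (at s)"
      by (rule dd) (use S[of s h] that \<open>h > 0\<close> in \<open>auto simp: algebra_simps\<close>)
    moreover have "((\<lambda>s. f (x + s *\<^sub>R u)) has_real_derivative Df (x + s *\<^sub>R u) u) (at s)"
      by (rule dd) (use S[of s 0] that \<open>h > 0\<close> in \<open>auto simp: algebra_simps\<close>)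
    ultimately have "((\<lambda>s. f (x + h *\<^sub>R v + s *\<^sub>R u) - f (x + s *\<^sub>R u)) has_real_derivative
        Df (x + h *\<^sub>R v + s *\<^sub>R u) u - Df (x + s *\<^sub>R u) u) (at s)"
      by (rule DERIV_diff)
    then show ?thesis unfolding \<phi>_def by (simp add: ac_simps)
  qed
  obtain s where s: "0 < s" "s < h"
    "\<phi> h - \<phi> 0 = h * (Df (x + s *\<^sub>R u + h *\<^sub>R v) u - Df (x + s *\<^sub>R u) u)"
    using MVT2[OF \<open>h > 0\<close>, of \<phi> "\<lambda>s. Df (x + s *\<^sub>R u + h *\<^sub>R v) u - Df (x + s *\<^sub>R u) u"] phi' by auto
  define D2 where "D2 y = frechet_derivative (\<lambda>y. frechet_derivative f (at y) u) (at y) v" for y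
  have psi': "((\<lambda>t. Df (x + s *\<^sub>R u + t *\<^sub>R v) u) has_real_derivative D2 (x + s *\<^sub>R u + t *\<^sub>R v)) (at t)"
    if "0 \<le> t" "t \<le> h" for t
  proof -
    have *: "x + s *\<^sub>R u + t *\<^sub>R v \<in> S" using S that s by simp
    have "((\<lambda>t. x + s *\<^sub>R u + t *\<^sub>R v) has_derivative (\<lambda>t. t *\<^sub>R v)) (at t)"
      by (auto intro!: derivative_eq_intros)
    from has_derivative_compose[OF this d2[OF *, of u]]
    show ?thesis
      using linear_cmul[OF has_derivative_linear[OF d2[OF *, of u]], of _ v]
      by (simp add: Df_def D2_def has_field_derivative_def mult_commute_abs mult.commute)
  qed
  obtain t where t: "0 < t" "t < h"
    "Df (x + s *\<^sub>R u + h *\<^sub>R v) u - Df (x + s *\<^sub>R u + 0 *\<^sub>R v) u = h * D2 (x + s *\<^sub>R u + t *\<^sub>R v)"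
    using MVT2[OF \<open>h > 0\<close>, of "\<lambda>t. Df (x + s *\<^sub>R u + t *\<^sub>R v) u" "\<lambda>t. D2 (x + s *\<^sub>R u + t *\<^sub>R v)"] psi'
    by auto
  have "f (x + h *\<^sub>R u + h *\<^sub>R v) - f (x + h *\<^sub>R u) - f (x + h *\<^sub>R v) + f x = \<phi> h - \<phi> 0"
    by (simp add: \<phi>_def)
  also have "\<dots> = h * h * D2 (x + s *\<^sub>R u + t *\<^sub>R v)" using s t by simp
  finally show ?thesis using s t unfolding D2_def by blast
qed

lemma second_derivative_symmetric:
  fixes f :: "'a::real_normed_vector \<Rightarrow> real"
  assumes "open S" "diff_upto 2 S f" "x \<in> S"
  shows "frechet_derivative (\<lambda>y. frechet_derivative f (at y) u) (at x) v =
    frechet_derivative (\<lambda>y. frechet_derivative f (at y) v) (at x) u"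
proof -
  define D2 where "D2 u v y = frechet_derivative (\<lambda>y. frechet_derivative f (at y) u) (at y) v" for u v y
  have f1: "diff_upto (Suc (Suc 0)) S f" using assms by (simp add: numeral_2_eq_2)
  have cont: "continuous_on S (D2 u v)" for u v
    using diff_upto_SucD(2)[OF diff_upto_SucD(2)[OF f1]] by (simp add: D2_def)
  obtain e where e: "e > 0" "ball x e \<subseteq> S" using assms openE by blast
  \<comment> \<open>For steps below \<open>h0\<close> the parallelogram spanned by
    \<open>h u\<close> and \<open>h v\<close> stays in the ball of radius \<open>e\<close>; the
    summand 1 keeps the denominator positive when both directions vanish.\<close>
  define h0 where "h0 = e / (norm u + norm v + 1)"
  have h0: "h0 > 0" using e by (simp add: h0_def add_nonneg_pos)
  have in_ball: "x + s *\<^sub>R u + t *\<^sub>R v \<in> ball x (h * (norm u + norm v + 1))"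
    if "0 \<le> s" "s \<le> h" "0 \<le> t" "t \<le> h" "0 < h" for s t h
  proof -
    have "norm (s *\<^sub>R u + t *\<^sub>R v) \<le> s * norm u + t * norm v"
      using norm_triangle_ineq[of "s *\<^sub>R u" "t *\<^sub>R v"] that by simp
    also have "\<dots> \<le> h * norm u + h * norm v" using that by (intro add_mono mult_right_mono) auto
    also have "\<dots> < h * (norm u + norm v + 1)" using that by (simp add: algebra_simps)
    finally have "norm (s *\<^sub>R u + t *\<^sub>R v) < h * (norm u + norm v + 1)" .
    moreover have "dist x (x + s *\<^sub>R u + t *\<^sub>R v) = norm (s *\<^sub>R u + t *\<^sub>R v)"
      by (metis add.assoc add_diff_cancel_left' dist_norm dist_commute)
    ultimately show ?thesis by simp
  qed
  \<comment> \<open>The two orders of differentiation share one second difference, so their values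
    agree at two possibly different points close to \<open>x\<close>; continuity then takes
    over.\<close>
  have key: "\<exists>y z. y \<in> ball x (h * (norm u + norm v + 1)) \<and> z \<in> ball x (h * (norm u + norm v + 1)) \<and>
      D2 u v y = D2 v u z" if h: "0 < h" "h < h0" for h
  proof -
    have "h * (norm u + norm v + 1) < e"
      using h by (simp add: h0_def pos_less_divide_eq add_nonneg_pos)
    then have S: "x + s *\<^sub>R u + t *\<^sub>R v \<in> S" if "0 \<le> s" "s \<le> h" "0 \<le> t" "t \<le> h" for s t
      using in_ball[OF that h(1)] e by auto
    obtain s t where 1: "0 < s" "s < h" "0 < t" "t < h"
      "f (x + h *\<^sub>R u + h *\<^sub>R v) - f (x + h *\<^sub>R u) - f (x + h *\<^sub>R v) + f x = h * h * D2 u v (x + s *\<^sub>R u + t *\<^sub>R v)"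
      using second_difference_mean_value[OF h(1) S assms(2)] unfolding D2_def by blast
    have S': "x + s *\<^sub>R v + t *\<^sub>R u \<in> S" if "0 \<le> s" "s \<le> h" "0 \<le> t" "t \<le> h" for s t
      using S[OF that(3,4,1,2)] by (simp add: ac_simps)
    obtain s' t' where 2: "0 < s'" "s' < h" "0 < t'" "t' < h"
      "f (x + h *\<^sub>R v + h *\<^sub>R u) - f (x + h *\<^sub>R v) - f (x + h *\<^sub>R u) + f x = h * h * D2 v u (x + s' *\<^sub>R v + t' *\<^sub>R u)"
      using second_difference_mean_value[OF h(1) S' assms(2)] unfolding D2_def by blast
    have "h * h * D2 u v (x + s *\<^sub>R u + t *\<^sub>R v) = h * h * D2 v u (x + s' *\<^sub>R v + t' *\<^sub>R u)"
    proof -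
      have "x + h *\<^sub>R v + h *\<^sub>R u = x + h *\<^sub>R u + h *\<^sub>R v" by (simp add: ac_simps)
      with 2(5) have "f (x + h *\<^sub>R u + h *\<^sub>R v) - f (x + h *\<^sub>R v) - f (x + h *\<^sub>R u) + f x =
          h * h * D2 v u (x + s' *\<^sub>R v + t' *\<^sub>R u)" by simp
      with 1(5) show ?thesis by linarith
    qed
    then have "D2 u v (x + s *\<^sub>R u + t *\<^sub>R v) = D2 v u (x + t' *\<^sub>R u + s' *\<^sub>R v)"
      using h by (simp add: ac_simps)
    with in_ball[of s h t] in_ball[of t' h s'] 1 2 h show ?thesis
      by (metis less_eq_real_def)
  qed
  have "D2 u v x = D2 v u x"
  proof (rule ccontr)
    assume "D2 u v x \<noteq> D2 v u x"
    define \<epsilon> where "\<epsilon> = \<bar>D2 u v x - D2 v u x\<bar> / 2"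
    have eps: "\<epsilon> > 0" using \<open>D2 u v x \<noteq> D2 v u x\<close> by (simp add: \<epsilon>_def)
    have "isCont (D2 u v) x" "isCont (D2 v u) x"
      using cont assms by (auto simp: continuous_on_eq_continuous_at)
    then obtain d1 d2 where d: "d1 > 0" "d2 > 0" "\<And>y. dist y x < d1 \<Longrightarrow> \<bar>D2 u v y - D2 u v x\<bar> < \<epsilon>"
      "\<And>y. dist y x < d2 \<Longrightarrow> \<bar>D2 v u y - D2 v u x\<bar> < \<epsilon>"
      unfolding continuous_at_eps_delta using eps by (metis dist_real_def)
    define h where "h = min (h0 / 2) (min d1 d2 / (norm u + norm v + 1))"
    have pos: "norm u + norm v + 1 > 0" by (simp add: add_nonneg_pos)
    have h: "0 < h" "h < h0" using h0 d pos by (auto simp: h_def)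
    have "h \<le> min d1 d2 / (norm u + norm v + 1)" by (simp add: h_def)
    then have "h * (norm u + norm v + 1) \<le> min d1 d2" using pos by (simp add: pos_le_divide_eq)
    obtain y z where yz: "y \<in> ball x (h * (norm u + norm v + 1))"
        "z \<in> ball x (h * (norm u + norm v + 1))" "D2 u v y = D2 v u z"
      using key[OF h] by blast
    have "dist y x < d1" "dist z x < d2"
      using yz(1,2) \<open>h * (norm u + norm v + 1) \<le> min d1 d2\<close> by (auto simp: dist_commute)
    from d(3)[OF this(1)] d(4)[OF this(2)] yz(3) show False unfolding \<epsilon>_def by argo
  qed
  then show ?thesis by (simp add: D2_def)
qed

section \<open>Partial derivatives in a chart\<close>

lemma bounded_bilinear_matrix_mult: "bounded_bilinear ((**) :: real^'n^'m \<Rightarrow> real^'p^'n \<Rightarrow> real^'p^'m)"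
proof -
  have "bilinear ((**) :: real^'n^'m \<Rightarrow> real^'p^'n \<Rightarrow> real^'p^'m)"
    unfolding bilinear_def
    by (auto intro!: linearI simp: vec_eq_iff matrix_matrix_mult_def sum.distrib algebra_simps
        sum_distrib_left)
  then show ?thesis by (simp add: bilinear_conv_bounded_bilinear)
qed

lemma bounded_bilinear_matrix_vector_mult: "bounded_bilinear ((*v) :: real^'n^'m \<Rightarrow> real^'n \<Rightarrow> real^'m)"
proof -
  have "bilinear ((*v) :: real^'n^'m \<Rightarrow> real^'n \<Rightarrow> real^'m)"
    unfolding bilinear_def
    by (auto intro!: linearI simp: vec_eq_iff matrix_vector_mult_def sum.distrib algebra_simps
        sum_distrib_left)
  then show ?thesis by (simp add: bilinear_conv_bounded_bilinear)
qed

lemma bounded_linear_transpose: "bounded_linear (transpose :: real^'n^'m \<Rightarrow> real^'m^'n)"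
  by (rule linear_conv_bounded_linear[THEN iffD1])
     (auto intro!: linearI simp: vec_eq_iff transpose_def)

interpretation matrix_mult: bounded_bilinear "(**) :: real^'n^'m \<Rightarrow> real^'p^'n \<Rightarrow> real^'p^'m"
  by (rule bounded_bilinear_matrix_mult)

interpretation matrix_vector_mult: bounded_bilinear "(*v) :: real^'n^'m \<Rightarrow> real^'n \<Rightarrow> real^'m"
  by (rule bounded_bilinear_matrix_vector_mult)

text \<open>\<open>W\<close> is an open piece of the chart: in use a whole domain, an overlap of two
  domains, or a domain minus a closed support. Injectivity is asked on all of \<open>dom c\<close>
  because \<open>in_coords\<close> inverts the coordinate map there and not on
  \<open>W\<close>.\<close>

locale chart_patch =
  fixes c :: "('a, 'n::finite) chart" and W :: "'a set"
  assumes inj: "inj_on (coord c) (dom c)" and sub: "W \<subseteq> dom c" and opn: "open (coord c ` W)"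
begin

text \<open>Finite order is tracked besides \<open>sm\<close> because the cutoff functions of the
  divergence theorem are only C^1.\<close>

definition ck :: "nat \<Rightarrow> ('a \<Rightarrow> 'b::real_normed_vector) \<Rightarrow> bool" where
  "ck k f \<longleftrightarrow> diff_upto k (coord c ` W) (in_coords c f)"

definition sm :: "('a \<Rightarrow> 'b::real_normed_vector) \<Rightarrow> bool" where
  "sm f \<longleftrightarrow> smooth_on (coord c ` W) (in_coords c f)"

text \<open>\<open>pd\<close> is total and arbitrary where no derivative exists, so the
  differentiation rules carry this side condition.\<close>

definition df :: "('a \<Rightarrow> 'b::real_normed_vector) \<Rightarrow> 'a \<Rightarrow> bool" where
  "df f p \<longleftrightarrow> in_coords c f differentiable (at (coord c p))"

lemma sm_iff_ck: "sm f \<longleftrightarrow> (\<forall>k. ck k f)"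
  by (simp add: sm_def ck_def smooth_on_def)

lemma in_coords_coord: "p \<in> dom c \<Longrightarrow> in_coords c f (coord c p) = f p"
  using inj by (simp add: in_coords_def)

lemma ck_cong: "(\<And>q. q \<in> W \<Longrightarrow> f q = g q) \<Longrightarrow> ck k f \<Longrightarrow> ck k g"
  unfolding ck_def by (rule diff_upto_cong[OF opn, of "in_coords c f"]) (use sub in \<open>auto simp: in_coords_coord\<close>)

lemma ck_const: "ck k (\<lambda>q. a)"
  using diff_upto_const[OF opn] by (simp add: ck_def in_coords_def o_def)

lemma ck_bounded_linear: "bounded_linear L \<Longrightarrow> ck k f \<Longrightarrow> ck k (\<lambda>q. L (f q))"
  using diff_upto_bounded_linear[OF opn] by (simp add: ck_def in_coords_def o_def)

lemma ck_bounded_bilinear: "bounded_bilinear B \<Longrightarrow> ck k f \<Longrightarrow> ck k h \<Longrightarrow> ck k (\<lambda>q. B (f q) (h q))"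
  using diff_upto_bounded_bilinear[OF opn] by (simp add: ck_def in_coords_def o_def)

lemma ck_add: "ck k f \<Longrightarrow> ck k h \<Longrightarrow> ck k (\<lambda>q. f q + h q)"
  using diff_upto_add[OF opn] by (simp add: ck_def in_coords_def o_def)

lemma ck_diff: "ck k f \<Longrightarrow> ck k h \<Longrightarrow> ck k (\<lambda>q. f q - h q)"
  using diff_upto_diff[OF opn] by (simp add: ck_def in_coords_def o_def)

lemma ck_sum: "(\<And>i. i \<in> I \<Longrightarrow> ck k (f i)) \<Longrightarrow> ck k (\<lambda>q. \<Sum>i\<in>I. f i q)"
  using diff_upto_sum[OF opn, of I k "\<lambda>i. in_coords c (f i)"] by (simp add: ck_def in_coords_def o_def)

lemma ck_prod:
  fixes f :: "'i \<Rightarrow> 'a \<Rightarrow> real"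
  shows "(\<And>i. i \<in> I \<Longrightarrow> ck k (f i)) \<Longrightarrow> ck k (\<lambda>q. \<Prod>i\<in>I. f i q)"
  using diff_upto_prod[OF opn, of I k "\<lambda>i. in_coords c (f i)"] by (simp add: ck_def in_coords_def o_def)

lemma ck_mult:
  fixes f h :: "'a \<Rightarrow> real"
  shows "ck k f \<Longrightarrow> ck k h \<Longrightarrow> ck k (\<lambda>q. f q * h q)"
  using diff_upto_mult[OF opn] by (simp add: ck_def in_coords_def o_def)

lemma ck_divide:
  fixes f h :: "'a \<Rightarrow> real"
  assumes "ck k f" "ck k h" "\<And>q. q \<in> W \<Longrightarrow> h q \<noteq> 0"
  shows "ck k (\<lambda>q. f q / h q)"
proof -
  have "in_coords c h x \<noteq> 0" if "x \<in> coord c ` W" for x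
    using that assms(3) sub in_coords_coord[of _ h] by auto
  then show ?thesis
    using diff_upto_divide[OF opn, of k "in_coords c f" "in_coords c h"] assms(1,2)
    by (simp add: ck_def in_coords_def o_def)
qed

lemma ck_sqrt:
  fixes f :: "'a \<Rightarrow> real"
  assumes "ck k f" "\<And>q. q \<in> W \<Longrightarrow> f q > 0"
  shows "ck k (\<lambda>q. sqrt (f q))"
proof -
  have "in_coords c f x > 0" if "x \<in> coord c ` W" for x
    using that assms(2) sub in_coords_coord[of _ f] by auto
  then show ?thesis
    using diff_upto_sqrt[OF opn, of k "in_coords c f"] assms(1)
    by (simp add: ck_def in_coords_def o_def)
qed

lemma ck_vec:
  fixes f :: "'a \<Rightarrow> 'b::real_normed_vector ^ 'm"
  shows "(\<And>i. ck k (\<lambda>q. f q $ i)) \<Longrightarrow> ck k f"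
  using diff_upto_vec[OF opn, of k "in_coords c f"] by (simp add: ck_def in_coords_def o_def)

lemma ck_nth: "ck k f \<Longrightarrow> ck k (\<lambda>q. f q $ i)"
  by (rule ck_bounded_linear[OF bounded_linear_vec_nth])

lemma ck_pd:
  assumes "ck (Suc k) f" shows "ck k (pd c i f)"
  unfolding ck_def
  by (rule diff_upto_cong[OF opn _ diff_upto_SucD(2)[OF assms[unfolded ck_def], of "axis i 1"]])
     (use sub in \<open>auto simp: in_coords_coord pd_def\<close>)

lemma ck_imp_df: "ck (Suc k) f \<Longrightarrow> p \<in> W \<Longrightarrow> df f p"
  by (simp add: ck_def df_def)

lemma ck_le: "ck m f \<Longrightarrow> k \<le> m \<Longrightarrow> ck k f"
  unfolding ck_def by (rule diff_upto_le)

lemma ck_imp_continuous_on: "ck k f \<Longrightarrow> continuous_on (coord c ` W) (in_coords c f)"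
  unfolding ck_def by (rule diff_upto_imp_continuous_on)

lemma pd_cong:
  assumes "p \<in> W" "\<And>q. q \<in> W \<Longrightarrow> f q = h q" "df f p"
  shows "pd c i f p = pd c i h p"
  unfolding pd_def
  by (subst frechet_derivative_transform_within_open[OF assms(3)[unfolded df_def] opn, of "in_coords c h"])
     (use assms sub in \<open>auto simp: in_coords_coord\<close>)

lemma df_D: "df f p \<Longrightarrow> (in_coords c f has_derivative frechet_derivative (in_coords c f) (at (coord c p))) (at (coord c p))"
  unfolding df_def by (simp add: frechet_derivative_works)

lemma pd_eqI:
  assumes "(in_coords c f has_derivative F) (at (coord c p))"
  shows "pd c i f p = F (axis i 1)"
  unfolding pd_def frechet_derivative_at[OF assms, symmetric] ..

lemma pd_const: "pd c i (\<lambda>q. a) p = 0"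
  by (rule pd_eqI[where F="\<lambda>_. 0"]) (simp add: in_coords_def o_def)

lemma df_const: "df (\<lambda>q. a) p"
  by (simp add: df_def in_coords_def o_def)

lemma
  assumes "bounded_linear L" "df f p"
  shows pd_bounded_linear: "pd c i (\<lambda>q. L (f q)) p = L (pd c i f p)"
    and df_bounded_linear: "df (\<lambda>q. L (f q)) p"
proof -
  have "(in_coords c (\<lambda>q. L (f q)) has_derivative (\<lambda>v. L (frechet_derivative (in_coords c f) (at (coord c p)) v))) (at (coord c p))"
    using bounded_linear.has_derivative[OF assms(1) df_D[OF assms(2)]] by (simp add: in_coords_def o_def)
  then show "pd c i (\<lambda>q. L (f q)) p = L (pd c i f p)" "df (\<lambda>q. L (f q)) p"
    by (auto dest: pd_eqI simp: pd_def df_def differentiable_def)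
qed

lemma
  assumes "bounded_bilinear B" "df f p" "df h p"
  shows pd_bounded_bilinear: "pd c i (\<lambda>q. B (f q) (h q)) p =
      B (in_coords c f (coord c p)) (pd c i h p) + B (pd c i f p) (in_coords c h (coord c p))"
    and df_bounded_bilinear: "df (\<lambda>q. B (f q) (h q)) p"
proof -
  have "(in_coords c (\<lambda>q. B (f q) (h q)) has_derivative
      (\<lambda>v. B (in_coords c f (coord c p)) (frechet_derivative (in_coords c h) (at (coord c p)) v) +
           B (frechet_derivative (in_coords c f) (at (coord c p)) v) (in_coords c h (coord c p)))) (at (coord c p))"
    using bounded_bilinear.FDERIV[OF assms(1) df_D[OF assms(2)] df_D[OF assms(3)]] by (simp add: in_coords_def o_def)
  then show "pd c i (\<lambda>q. B (f q) (h q)) p =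
      B (in_coords c f (coord c p)) (pd c i h p) + B (pd c i f p) (in_coords c h (coord c p))"
    and "df (\<lambda>q. B (f q) (h q)) p"
    by (auto dest: pd_eqI simp: pd_def df_def differentiable_def)
qed

lemma
  assumes "df f p" "df h p"
  shows pd_add: "pd c i (\<lambda>q. f q + h q) p = pd c i f p + pd c i h p"
    and df_add: "df (\<lambda>q. f q + h q) p"
proof -
  have "(in_coords c (\<lambda>q. f q + h q) has_derivative
      (\<lambda>v. frechet_derivative (in_coords c f) (at (coord c p)) v +
           frechet_derivative (in_coords c h) (at (coord c p)) v)) (at (coord c p))"
    using has_derivative_add[OF df_D[OF assms(1)] df_D[OF assms(2)]] by (simp add: in_coords_def o_def)
  then show "pd c i (\<lambda>q. f q + h q) p = pd c i f p + pd c i h p" "df (\<lambda>q. f q + h q) p"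
    by (auto dest: pd_eqI simp: pd_def df_def differentiable_def)
qed

lemma
  assumes "df f p"
  shows pd_uminus: "pd c i (\<lambda>q. - f q) p = - pd c i f p" and df_uminus: "df (\<lambda>q. - f q) p"
  using pd_bounded_linear[OF bounded_linear_minus[OF bounded_linear_ident] assms]
    df_bounded_linear[OF bounded_linear_minus[OF bounded_linear_ident] assms] by auto

lemma
  assumes "df f p" "df h p"
  shows pd_diff: "pd c i (\<lambda>q. f q - h q) p = pd c i f p - pd c i h p"
    and df_diff: "df (\<lambda>q. f q - h q) p"
  using pd_add[OF assms(1) df_uminus[OF assms(2)]] df_add[OF assms(1) df_uminus[OF assms(2)]]
    pd_uminus[OF assms(2)] by auto

lemma
  assumes "\<And>i. i \<in> I \<Longrightarrow> df (f i) p"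
  shows pd_sum: "pd c j (\<lambda>q. \<Sum>i\<in>I. f i q) p = (\<Sum>i\<in>I. pd c j (f i) p)"
    and df_sum: "df (\<lambda>q. \<Sum>i\<in>I. f i q) p"
proof -
  have "(in_coords c (\<lambda>q. \<Sum>i\<in>I. f i q) has_derivative
      (\<lambda>v. \<Sum>i\<in>I. frechet_derivative (in_coords c (f i)) (at (coord c p)) v)) (at (coord c p))"
    using has_derivative_sum[OF df_D[OF assms], of I] by (simp add: in_coords_def o_def)
  then show "pd c j (\<lambda>q. \<Sum>i\<in>I. f i q) p = (\<Sum>i\<in>I. pd c j (f i) p)" "df (\<lambda>q. \<Sum>i\<in>I. f i q) p"
    by (auto dest: pd_eqI simp: pd_def df_def differentiable_def)
qed

lemma pd_mult:
  fixes f h :: "'a \<Rightarrow> real"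
  assumes "p \<in> dom c" "df f p" "df h p"
  shows "pd c i (\<lambda>q. f q * h q) p = f p * pd c i h p + pd c i f p * h p"
  using pd_bounded_bilinear[OF bounded_bilinear_mult assms(2,3)] assms(1) by (simp add: in_coords_coord)

lemma df_mult:
  fixes f h :: "'a \<Rightarrow> real"
  assumes "df f p" "df h p"
  shows "df (\<lambda>q. f q * h q) p"
  using df_bounded_bilinear[OF bounded_bilinear_mult assms] .

lemma pd_matrix_mult:
  fixes f :: "'a \<Rightarrow> real ^ 'm ^ 'l" and h :: "'a \<Rightarrow> real ^ 'k ^ 'm"
  assumes "p \<in> dom c" "df f p" "df h p"
  shows "pd c i (\<lambda>q. f q ** h q) p = f p ** pd c i h p + pd c i f p ** h p"
  using pd_bounded_bilinear[OF bounded_bilinear_matrix_mult assms(2,3)] assms(1) by (simp add: in_coords_coord)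

lemma pd_matrix_vector_mult:
  fixes f :: "'a \<Rightarrow> real ^ 'm ^ 'l" and h :: "'a \<Rightarrow> real ^ 'm"
  assumes "p \<in> dom c" "df f p" "df h p"
  shows "pd c i (\<lambda>q. f q *v h q) p = f p *v pd c i h p + pd c i f p *v h p"
  using pd_bounded_bilinear[OF bounded_bilinear_matrix_vector_mult assms(2,3)] assms(1) by (simp add: in_coords_coord)

lemmas df_matrix_mult = df_bounded_bilinear[OF bounded_bilinear_matrix_mult]
lemmas df_matrix_vector_mult = df_bounded_bilinear[OF bounded_bilinear_matrix_vector_mult]
lemmas pd_transpose = pd_bounded_linear[OF bounded_linear_transpose]
lemmas df_transpose = df_bounded_linear[OF bounded_linear_transpose]
lemmas pd_nth = pd_bounded_linear[OF bounded_linear_vec_nth]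
lemmas df_nth = df_bounded_linear[OF bounded_linear_vec_nth]

lemma pd_commute:
  fixes f :: "'a \<Rightarrow> real"
  assumes "p \<in> W" "ck 2 f"
  shows "pd c i (pd c j f) p = pd c j (pd c i f) p"
proof -
  have pd2: "pd c i (pd c j f) p = frechet_derivative (\<lambda>y. frechet_derivative (in_coords c f) (at y) (axis j 1))
      (at (coord c p)) (axis i 1)" for i j
  proof -
    have "ck (Suc 0) (pd c j f)" using assms(2) by (intro ck_pd) (simp add: numeral_2_eq_2)
    then have d: "in_coords c (pd c j f) differentiable (at (coord c p))"
      using assms(1) ck_imp_df df_def by blast
    show ?thesis unfolding pd_def[of c i "pd c j f"]
      by (subst frechet_derivative_transform_within_open[OF d opn,
            of "\<lambda>y. frechet_derivative (in_coords c f) (at y) (axis j 1)"])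
         (use assms sub in \<open>auto simp: in_coords_coord pd_def\<close>)
  qed
  show ?thesis unfolding pd2
    by (rule second_derivative_symmetric[OF opn]) (use assms in \<open>auto simp: ck_def\<close>)
qed

text \<open>Serves matrix-valued functions such as the inverse metric and the connection matrices;
  inner products with a fixed vector reduce it to the real case.\<close>

lemma pd_commute_euclidean:
  fixes f :: "'a \<Rightarrow> 'b::euclidean_space"
  assumes "p \<in> W" "ck 2 f"
  shows "pd c i (pd c j f) p = pd c j (pd c i f) p"
proof -
  have L: "bounded_linear (\<lambda>x::'b. x \<bullet> b)" for b by (rule bounded_linear_inner_left)
  have d: "df f q" if "q \<in> W" for q
    using assms(2) that by (metis ck_imp_df numeral_2_eq_2)
  have "df (pd c j f) p" for j
    using ck_imp_df[OF ck_pd] assms by (metis numeral_2_eq_2)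
  then have 1: "pd c i (pd c j f) p \<bullet> b = pd c i (\<lambda>q. pd c j f q \<bullet> b) p" for i j b
    using pd_bounded_linear[OF L] by metis
  have 2: "pd c i (\<lambda>q. pd c j f q \<bullet> b) p = pd c i (pd c j (\<lambda>q. f q \<bullet> b)) p" for i j b
  proof (rule pd_cong[symmetric])
    show "df (pd c j (\<lambda>q. f q \<bullet> b)) p"
      using ck_imp_df[OF ck_pd[OF ck_bounded_linear[OF L]]] assms by (metis numeral_2_eq_2)
    show "pd c j (\<lambda>q. f q \<bullet> b) q = pd c j f q \<bullet> b" if "q \<in> W" for q
      using pd_bounded_linear[OF L d[OF that]] .
  qed fact
  show ?thesis
    unfolding euclidean_eq_iff[of "pd c i (pd c j f) p"] 1 2
    using pd_commute[OF assms(1) ck_bounded_linear[OF L assms(2)]] by blast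
qed

lemma sm_imp_df: "sm f \<Longrightarrow> p \<in> W \<Longrightarrow> df f p"
  using ck_imp_df by (auto simp: sm_iff_ck)

lemma sm_const: "sm (\<lambda>q. a)" by (simp add: sm_iff_ck ck_const)
lemma sm_pd: "sm f \<Longrightarrow> sm (pd c i f)" by (simp add: sm_iff_ck ck_pd)
lemma sm_add: "sm f \<Longrightarrow> sm h \<Longrightarrow> sm (\<lambda>q. f q + h q)" by (simp add: sm_iff_ck ck_add)
lemma sm_diff: "sm f \<Longrightarrow> sm h \<Longrightarrow> sm (\<lambda>q. f q - h q)" by (simp add: sm_iff_ck ck_diff)
lemma sm_sum: "(\<And>i. i \<in> I \<Longrightarrow> sm (f i)) \<Longrightarrow> sm (\<lambda>q. \<Sum>i\<in>I. f i q)" by (simp add: sm_iff_ck ck_sum)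
lemma sm_prod:
  fixes f :: "'i \<Rightarrow> 'a \<Rightarrow> real"
  shows "(\<And>i. i \<in> I \<Longrightarrow> sm (f i)) \<Longrightarrow> sm (\<lambda>q. \<Prod>i\<in>I. f i q)"
  by (simp add: sm_iff_ck ck_prod)
lemma sm_mult:
  fixes f h :: "'a \<Rightarrow> real"
  shows "sm f \<Longrightarrow> sm h \<Longrightarrow> sm (\<lambda>q. f q * h q)"
  by (simp add: sm_iff_ck ck_mult)
lemma sm_divide:
  fixes f h :: "'a \<Rightarrow> real"
  shows "sm f \<Longrightarrow> sm h \<Longrightarrow> (\<And>q. q \<in> W \<Longrightarrow> h q \<noteq> 0) \<Longrightarrow> sm (\<lambda>q. f q / h q)"
  by (simp add: sm_iff_ck ck_divide)
lemma sm_sqrt: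
  fixes f :: "'a \<Rightarrow> real"
  shows "sm f \<Longrightarrow> (\<And>q. q \<in> W \<Longrightarrow> f q > 0) \<Longrightarrow> sm (\<lambda>q. sqrt (f q))"
  by (simp add: sm_iff_ck ck_sqrt)
lemma sm_matrix_mult:
  fixes f :: "'a \<Rightarrow> real ^ 'm ^ 'l" and h :: "'a \<Rightarrow> real ^ 'k ^ 'm"
  shows "sm f \<Longrightarrow> sm h \<Longrightarrow> sm (\<lambda>q. f q ** h q)"
  by (simp add: sm_iff_ck ck_bounded_bilinear[OF bounded_bilinear_matrix_mult])
lemma sm_matrix_vector_mult:
  fixes f :: "'a \<Rightarrow> real ^ 'm ^ 'l" and h :: "'a \<Rightarrow> real ^ 'm"
  shows "sm f \<Longrightarrow> sm h \<Longrightarrow> sm (\<lambda>q. f q *v h q)"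
  by (simp add: sm_iff_ck ck_bounded_bilinear[OF bounded_bilinear_matrix_vector_mult])
lemma sm_scaleR:
  fixes f :: "'a \<Rightarrow> real" and h :: "'a \<Rightarrow> 'b::real_normed_vector"
  shows "sm f \<Longrightarrow> sm h \<Longrightarrow> sm (\<lambda>q. f q *\<^sub>R h q)"
  by (simp add: sm_iff_ck ck_bounded_bilinear[OF bounded_bilinear_scaleR])
lemma sm_transpose:
  fixes f :: "'a \<Rightarrow> real ^ 'm ^ 'l"
  shows "sm f \<Longrightarrow> sm (\<lambda>q. transpose (f q))"
  by (simp add: sm_iff_ck ck_bounded_linear[OF bounded_linear_transpose])
lemma sm_vec:
  fixes f :: "'a \<Rightarrow> 'b::real_normed_vector ^ 'm"
  shows "(\<And>i. sm (\<lambda>q. f q $ i)) \<Longrightarrow> sm f"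
  by (simp add: sm_iff_ck ck_vec)
lemma sm_nth: "sm f \<Longrightarrow> sm (\<lambda>q. f q $ i)" by (simp add: sm_iff_ck ck_nth)
lemma sm_cong: "(\<And>q. q \<in> W \<Longrightarrow> f q = g q) \<Longrightarrow> sm f \<Longrightarrow> sm g"
  using ck_cong unfolding sm_iff_ck by blast

end

section \<open>Curvature in a chart\<close>

lemma matrix_inv_inverse:
  fixes M :: "'a::semiring_1 ^ 'n ^ 'n"
  assumes "invertible M"
  shows "M ** matrix_inv M = mat 1" "matrix_inv M ** M = mat 1"
  using someI_ex[OF assms[unfolded invertible_def]] by (auto simp: matrix_inv_def)

lemma matrix_inv_unique:
  fixes M :: "'a::semiring_1 ^ 'n ^ 'n"
  assumes "M ** N = mat 1" "N ** M = mat 1"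
  shows "matrix_inv M = N"
proof -
  have "invertible M" using assms invertible_def by blast
  then have "matrix_inv M = matrix_inv M ** (M ** N)" using assms by simp
  also have "\<dots> = N" by (simp add: matrix_mul_assoc matrix_inv_inverse[OF \<open>invertible M\<close>])
  finally show ?thesis .
qed

lemma positive_definite_invertible:
  fixes M :: "real ^ 'n ^ 'n"
  assumes "\<And>v. v \<noteq> 0 \<Longrightarrow> v \<bullet> (M *v v) > 0"
  shows "invertible M"
proof -
  have "M *v v = 0 \<Longrightarrow> v = 0" for v using assms[of v] by fastforce
  then show ?thesis
    by (metis invertible_left_inverse matrix_left_invertible_ker)
qed

lemma transpose_add: "transpose (M + N :: real ^ 'n ^ 'm) = transpose M + transpose N"
  by (simp add: transpose_def vec_eq_iff)
lemma transpose_diff: "transpose (M - N :: real ^ 'n ^ 'm) = transpose M - transpose N"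
  by (simp add: transpose_def vec_eq_iff)
lemma transpose_minus: "transpose (- M :: real ^ 'n ^ 'm) = - transpose M"
  by (simp add: transpose_def vec_eq_iff)

lemma matrix_mult_nth: "(M ** N) $ i $ j = (\<Sum>k\<in>UNIV. M $ i $ k * N $ k $ j)"
  by (simp add: matrix_matrix_mult_def)

lemma matrix_vector_mult_nth: "(M *v x) $ i = (\<Sum>k\<in>UNIV. M $ i $ k * x $ k)"
  by (simp add: matrix_vector_mult_def)

lemma transpose_nth: "transpose M $ i $ j = M $ j $ i"
  by (simp add: transpose_def)

lemmas matrix_ring = matrix_mult.add_left matrix_mult.add_right matrix_mult.diff_left
  matrix_mult.diff_right matrix_mult.minus_left matrix_mult.minus_right matrix_mul_assoc
  transpose_add transpose_diff transpose_minus matrix_transpose_mul transpose_transpose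

context chart_patch
begin

lemma sm_det:
  fixes M :: "'a \<Rightarrow> real ^ 'm ^ 'm"
  assumes "\<And>i j. sm (\<lambda>q. M q $ i $ j)"
  shows "sm (\<lambda>q. det (M q))"
  unfolding det_def by (intro sm_sum sm_mult sm_prod sm_const assms)

text \<open>Cramer's rule writes the entries of the inverse as quotients of determinants, and
  determinants are polynomials in the entries.\<close>

lemma sm_matrix_inv:
  fixes M :: "'a \<Rightarrow> real ^ 'm ^ 'm"
  assumes "sm M" "\<And>q. q \<in> W \<Longrightarrow> invertible (M q)"
  shows "sm (\<lambda>q. matrix_inv (M q))"
proof (intro sm_vec)
  fix k l
  \<comment> \<open>Column \<open>k\<close> is replaced by the basis vector \<open>axis l 1\<close>,
    which gives the numerator for entry \<open>k\<close>, \<open>l\<close> of the inverse.\<close>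
  let ?N = "\<lambda>q. \<chi> i j. if j = k then axis l 1 $ i else M q $ i $ j"
  have "sm (\<lambda>q. det (?N q) / det (M q))"
  proof (intro sm_divide sm_det)
    show "sm (\<lambda>q. ?N q $ i $ j)" for i j
      by (cases "j = k") (auto intro: sm_const sm_nth[OF sm_nth[OF assms(1)]])
    show "det (M q) \<noteq> 0" if "q \<in> W" for q using assms(2)[OF that] invertible_det_nz by blast
  qed (rule sm_nth[OF sm_nth[OF assms(1)]])
  moreover have "det (?N q) / det (M q) = matrix_inv (M q) $ k $ l" if "q \<in> W" for q
  proof -
    have "M q *v (matrix_inv (M q) *v axis l 1) = axis l 1"
      using matrix_inv_inverse[OF assms(2)[OF that]] by (simp add: matrix_vector_mul_assoc)
    moreover have "det (M q) \<noteq> 0" using assms(2)[OF that] invertible_det_nz by blast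
    ultimately have "matrix_inv (M q) *v axis l 1 =
        (\<chi> k. det (\<chi> i j. if j = k then axis l 1 $ i else M q $ i $ j) / det (M q))"
      using cramer[of "M q" "matrix_inv (M q) *v axis l 1" "axis l 1"] by simp
    moreover have "(matrix_inv (M q) *v axis l 1) $ k = matrix_inv (M q) $ k $ l"
      by (simp add: matrix_vector_mult_def axis_def if_distrib cong: if_cong)
    ultimately show ?thesis by simp
  qed
  ultimately show "sm (\<lambda>q. matrix_inv (M q) $ k $ l)" by (rule sm_cong[rotated])
qed

end

locale metric_chart = chart_patch c "dom c" for c :: "('a, 'n::finite) chart" +
  fixes g :: "('a, 'n) tensor2"
  assumes sm_metric: "sm (g c)"
    and metric_sym: "p \<in> dom c \<Longrightarrow> transpose (g c p) = g c p"
    and metric_pos: "p \<in> dom c \<Longrightarrow> v \<noteq> 0 \<Longrightarrow> v \<bullet> (g c p *v v) > 0"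
begin

abbreviation "G \<equiv> g c"
abbreviation H where "H q \<equiv> matrix_inv (g c q)"

text \<open>The connection matrix in direction \<open>i\<close>: the covariant derivative of a
  component vector is its partial derivative plus this matrix applied to it. Rows carry the upper
  index.\<close>

definition Gam :: "'n \<Rightarrow> 'a \<Rightarrow> real ^ 'n ^ 'n" where
  "Gam i q = (\<chi> l k. christoffel g c l i k q)"

definition Om :: "'n \<Rightarrow> 'n \<Rightarrow> 'a \<Rightarrow> real ^ 'n ^ 'n" where
  "Om i j q = (\<chi> l k. riemann g c l k i j q)"

lemma
  assumes "p \<in> dom c"
  shows GH: "G p ** H p = mat 1" and HG: "H p ** G p = mat 1"
  using matrix_inv_inverse positive_definite_invertible metric_pos[OF assms] by metis+

lemma sm_inverse_metric: "sm H"
  by (intro sm_matrix_inv sm_metric positive_definite_invertible metric_pos)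

lemma inverse_metric_sym: "p \<in> dom c \<Longrightarrow> transpose (H p) = H p"
  by (metis GH HG matrix_inv_unique matrix_transpose_mul metric_sym transpose_mat)

lemma pd_nth_nth: "sm f \<Longrightarrow> p \<in> dom c \<Longrightarrow> pd c i (\<lambda>q. f q $ j $ k) p = pd c i f p $ j $ k"
  by (simp add: pd_nth df_nth sm_imp_df)

lemma pd_sym: "p \<in> dom c \<Longrightarrow> transpose (pd c i G p) = pd c i G p"
  using pd_transpose[OF sm_imp_df[OF sm_metric], of p i]
    pd_cong[of p G "\<lambda>q. transpose (G q)" i] metric_sym sm_imp_df[OF sm_metric] by metis

lemma christoffel_alt:
  assumes "p \<in> dom c"
  shows "christoffel g c k i j p = (H p *v (\<chi> l. (pd c i G p $ j $ l + pd c j G p $ i $ l - pd c l G p $ i $ j) / 2)) $ k"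
  using assms
  by (simp add: christoffel_def pd_nth_nth sm_metric matrix_vector_mult_nth sum_divide_distrib)

lemma christoffel_sym:
  assumes "p \<in> dom c"
  shows "christoffel g c k i j p = christoffel g c k j i p"
proof -
  have "pd c l G p $ i $ j = pd c l G p $ j $ i" for l
    using pd_sym[OF assms] transpose_nth by metis
  then show ?thesis by (simp add: christoffel_alt[OF assms] add.commute)
qed

lemma lower_christoffel:
  assumes "p \<in> dom c"
  shows "(\<Sum>m\<in>UNIV. G p $ j $ m * christoffel g c m i k p) =
    (pd c i G p $ k $ j + pd c k G p $ i $ j - pd c j G p $ i $ k) / 2"
proof -
  let ?X = "\<chi> l. (pd c i G p $ k $ l + pd c k G p $ i $ l - pd c l G p $ i $ k) / 2"
  have "(\<Sum>m\<in>UNIV. G p $ j $ m * christoffel g c m i k p) = (G p *v (H p *v ?X)) $ j"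
    using assms by (simp add: christoffel_alt matrix_vector_mult_nth[of "G p"])
  also have "\<dots> = ?X $ j" using GH[OF assms] by (simp add: matrix_vector_mul_assoc)
  finally show ?thesis by simp
qed

text \<open>Metric compatibility of the Levi-Civita connection: each product is a Christoffel symbol
  of the first kind, and in their sum all but the derivative in direction \<open>i\<close>
  cancels.\<close>

lemma pd_metric:
  assumes "p \<in> dom c"
  shows "pd c i G p = transpose (Gam i p) ** G p + G p ** Gam i p"
proof -
  have s: "G p $ a $ b = G p $ b $ a" "pd c i G p $ a $ b = pd c i G p $ b $ a" for a b i
    using metric_sym[OF assms] pd_sym[OF assms] transpose_nth by metis+
  have 1: "(\<Sum>m\<in>UNIV. Gam i p $ m $ a * G p $ m $ b) =
      (pd c i G p $ a $ b + pd c a G p $ i $ b - pd c b G p $ i $ a) / 2" for a b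
    unfolding lower_christoffel[OF assms, symmetric]
    by (intro sum.cong) (auto simp: Gam_def s(1)[of b])
  have 2: "(\<Sum>m\<in>UNIV. G p $ a $ m * Gam i p $ m $ b) =
      (pd c i G p $ b $ a + pd c b G p $ i $ a - pd c a G p $ i $ b) / 2" for a b
    unfolding lower_christoffel[OF assms, symmetric]
    by (intro sum.cong) (auto simp: Gam_def)
  have "pd c i G p $ a $ b = (transpose (Gam i p) ** G p + G p ** Gam i p) $ a $ b" for a b
    unfolding matrix_mult_nth transpose_nth vector_add_component 1 2 s(2)[of i b a] by argo
  then show ?thesis by (simp add: vec_eq_iff)
qed

text \<open>Obtained by differentiating \<open>H q ** G q = mat 1\<close> and multiplying by
  \<open>H p\<close> from the right; the inverse metric is parallel too.\<close>

lemma pd_inverse_metric: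
  assumes "p \<in> dom c"
  shows "pd c i H p = - (Gam i p ** H p + H p ** transpose (Gam i p))"
proof -
  note d = sm_imp_df[OF sm_metric assms] sm_imp_df[OF sm_inverse_metric assms]
  have "pd c i (\<lambda>q. H q ** G q) p = pd c i (\<lambda>q. mat 1 :: real ^ 'n ^ 'n) p"
    by (rule pd_cong[OF assms]) (auto simp: HG intro: df_matrix_mult d)
  then have "H p ** pd c i G p + pd c i H p ** G p = 0"
    using pd_matrix_mult[OF assms d(2,1)] by (simp add: pd_const)
  then have "(H p ** pd c i G p + pd c i H p ** G p) ** H p = 0" by simp
  then have "pd c i H p ** (G p ** H p) = - (H p ** pd c i G p ** H p)"
    by (simp add: matrix_ring eq_neg_iff_add_eq_0 add.commute)
  also have "\<dots> = - (H p ** transpose (Gam i p) ** (G p ** H p) + (H p ** G p) ** Gam i p ** H p)"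
    by (simp add: pd_metric[OF assms] matrix_ring)
  finally show ?thesis using GH[OF assms] HG[OF assms] by (simp add: add.commute)
qed

lemma sm_christoffel: "sm (christoffel g c k i j)"
proof -
  have "sm (\<lambda>q. \<Sum>l\<in>UNIV. H q $ k $ l *
      ((pd c i (\<lambda>q. g c q $ j $ l) q + pd c j (\<lambda>q. g c q $ i $ l) q - pd c l (\<lambda>q. g c q $ i $ j) q) * (1/2)))"
    by (intro sm_sum sm_mult sm_add sm_diff sm_pd sm_nth sm_metric sm_inverse_metric sm_const)
  then show ?thesis by (rule sm_cong[rotated]) (simp add: christoffel_def sum_divide_distrib)
qed

lemma sm_Gam: "sm (Gam i)"
  by (intro sm_vec) (simp add: Gam_def sm_christoffel)

text \<open>Cartan's structure equation: curvature is the exterior derivative of the connection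
  matrix plus a commutator. The later symmetries of \<open>Om\<close> all start from this
  form.\<close>

lemma Om_eq:
  assumes "p \<in> dom c"
  shows "Om i j p = pd c i (Gam j) p - pd c j (Gam i) p + Gam i p ** Gam j p - Gam j p ** Gam i p"
proof -
  have "pd c i (christoffel g c l j k) p = pd c i (Gam j) p $ l $ k" for i j l k
    using pd_nth_nth[OF sm_Gam assms, of i j l k] by (simp add: Gam_def)
  then show ?thesis
    by (simp add: Om_def vec_eq_iff riemann_def matrix_mult_nth sum_subtractf) (simp add: Gam_def)
qed

lemma sm_Om: "sm (Om i j)"
  by (rule sm_cong[of "\<lambda>p. pd c i (Gam j) p - pd c j (Gam i) p + Gam i p ** Gam j p - Gam j p ** Gam i p"])
     (auto simp: Om_eq intro!: sm_add sm_diff sm_matrix_mult sm_pd sm_Gam)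

lemma Om_antisym: "p \<in> dom c \<Longrightarrow> Om j i p = - Om i j p"
  by (simp add: Om_eq)

lemma sm_imp_ck: "sm f \<Longrightarrow> ck k f" by (simp add: sm_iff_ck)

text \<open>This is the symmetry of the mixed second derivatives of the inverse metric.\<close>

lemma Om_skew:
  assumes p: "p \<in> dom c"
  shows "Om i j p ** H p + H p ** transpose (Om i j p) = 0"
proof -
  note sm_H = sm_inverse_metric
  have dd: "pd c i (pd c j H) p = - (pd c i (Gam j) p ** H p) + Gam j p ** (Gam i p ** H p + H p ** transpose (Gam i p))
      + (Gam i p ** H p + H p ** transpose (Gam i p)) ** transpose (Gam j p) - H p ** transpose (pd c i (Gam j) p)" for i j
  proof -
    have "pd c i (pd c j H) p = pd c i (\<lambda>q. - (Gam j q ** H q + H q ** transpose (Gam j q))) p"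
      by (rule pd_cong[OF p]) (auto simp: pd_inverse_metric intro!: sm_imp_df[OF _ p] sm_pd sm_H)
    also have "\<dots> = - (Gam j p ** pd c i H p + pd c i (Gam j) p ** H p
        + (H p ** transpose (pd c i (Gam j) p) + pd c i H p ** transpose (Gam j p)))"
      using p by (simp add: pd_uminus pd_diff df_uminus df_diff pd_add df_add df_matrix_mult pd_matrix_mult pd_transpose df_transpose
          sm_imp_df[OF _ p] sm_H sm_Gam)
    finally show ?thesis by (simp add: pd_inverse_metric[OF p] matrix_ring algebra_simps)
  qed
  have "pd c i (pd c j H) p = pd c j (pd c i H) p"
    by (rule pd_commute_euclidean[OF p sm_imp_ck[OF sm_H]])
  \<comment> \<open>The products of \<open>Gam i\<close>, \<open>H\<close> and the transpose of
    \<open>Gam j\<close>, with their mirror images, are symmetric in \<open>i\<close> and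
    \<open>j\<close> and cancel; the rest collects into \<open>Om\<close> and its transpose.\<close>
  then show ?thesis unfolding dd Om_eq[OF p]
    by (simp add: matrix_ring algebra_simps)
qed

text \<open>The covariant derivative acts here by commutators with \<open>Gam\<close> alone, because
  the corrections in the two form indices cancel in the cyclic sum for a torsion-free connection.
  After \<open>Om_eq\<close> the second derivatives cancel by symmetry and the triple products by
  the Jacobi identity.\<close>

lemma second_bianchi:
  assumes p: "p \<in> dom c"
  shows "(pd c m (Om i j) p + Gam m p ** Om i j p - Om i j p ** Gam m p)
    + (pd c i (Om j m) p + Gam i p ** Om j m p - Om j m p ** Gam i p)
    + (pd c j (Om m i) p + Gam j p ** Om m i p - Om m i p ** Gam j p) = 0"
proof -
  have dOm: "pd c m (Om i j) p = pd c m (pd c i (Gam j)) p - pd c m (pd c j (Gam i)) p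
      + (Gam i p ** pd c m (Gam j) p + pd c m (Gam i) p ** Gam j p)
      - (Gam j p ** pd c m (Gam i) p + pd c m (Gam j) p ** Gam i p)" for m i j
  proof -
    have "pd c m (Om i j) p = pd c m (\<lambda>q. pd c i (Gam j) q - pd c j (Gam i) q + Gam i q ** Gam j q - Gam j q ** Gam i q) p"
      by (rule pd_cong[OF p]) (auto simp: Om_eq intro!: sm_imp_df[OF _ p] sm_Om)
    also have "\<dots> = pd c m (pd c i (Gam j)) p - pd c m (pd c j (Gam i)) p
      + (Gam i p ** pd c m (Gam j) p + pd c m (Gam i) p ** Gam j p)
      - (Gam j p ** pd c m (Gam i) p + pd c m (Gam j) p ** Gam i p)"
      using p by (simp add: pd_diff pd_add df_add df_diff df_matrix_mult pd_matrix_mult sm_imp_df[OF _ p] sm_pd sm_Gam)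
    finally show ?thesis .
  qed
  have c: "pd c i (pd c j (Gam l)) p = pd c j (pd c i (Gam l)) p" for i j l
    by (rule pd_commute_euclidean[OF p sm_imp_ck[OF sm_Gam]])
  \<comment> \<open>Three chosen instances of \<open>c\<close> bring the second derivatives to a
    common order; the general equation would rewrite forever.\<close>
  show ?thesis
    unfolding dOm Om_eq[OF p] c[of i m] c[of j i] c[of j m]
    by (simp add: matrix_ring algebra_simps)
qed

end

section \<open>Contracted Bianchi and Ricci identities, product rules, Lie derivative of the
  metric\<close>

context metric_chart
begin

lemma Gam_sym: "p \<in> dom c \<Longrightarrow> Gam i p $ k $ j = Gam j p $ k $ i"
  by (simp add: Gam_def christoffel_sym)

lemma ricci_nth: "ricci g c p $ j $ k = (\<Sum>i\<in>UNIV. Om i j p $ i $ k)"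
  by (simp add: ricci_def Om_def)

text \<open>In tensor notation \<open>endo_div E m\<close> is \<open>\<nabla>\<^sub>i E\<^sup>i\<^sub>m\<close>, and \<open>Dv Z k\<close> is \<open>\<nabla>\<^sub>k Z\<close>.\<close>

definition endo_div :: "('a \<Rightarrow> real ^ 'n ^ 'n) \<Rightarrow> 'n \<Rightarrow> 'a \<Rightarrow> real" where
  "endo_div E m p = (\<Sum>i\<in>UNIV. pd c i (\<lambda>q. E q $ i $ m) p
     + (\<Sum>j\<in>UNIV. Gam i p $ i $ j * E p $ j $ m) - (\<Sum>j\<in>UNIV. Gam m p $ i $ j * E p $ j $ i))"

definition Dv :: "('a \<Rightarrow> real ^ 'n) \<Rightarrow> 'n \<Rightarrow> 'a \<Rightarrow> real ^ 'n" where
  "Dv Z k p = pd c k Z p + Gam k p *v Z p"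

lemma sm_Dv: "sm Z \<Longrightarrow> sm (Dv Z k)"
  unfolding Dv_def by (intro sm_add sm_pd sm_matrix_vector_mult sm_Gam)

lemma sm_ricci: "sm (ricci g c)"
  by (intro sm_vec) (auto simp: ricci_nth intro!: sm_sum sm_nth[OF sm_nth] sm_Om)

text \<open>Raising an index with the inverse metric turns \<open>Om i j\<close> into a skew matrix, so that the trace
  of the second Bianchi identity over two index pairs can be computed termwise.\<close>

lemma contracted_second_bianchi:
  assumes p: "p \<in> dom c"
  shows "pd c m (scalar_curvature g c) p = 2 * endo_div (\<lambda>q. H q ** transpose (ricci g c q)) m p"
proof -
  \<comment> \<open>Entry \<open>a\<close>, \<open>b\<close> of \<open>K i j\<close> is the
    curvature with both endomorphism indices up: skew in \<open>a\<close>, \<open>b\<close> by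
    \<open>Om_skew\<close> and in \<open>i\<close>, \<open>j\<close> by
    \<open>Om_antisym\<close>.\<close>
  define K where "K i j q = Om i j q ** H q" for i j q
  have smK: "sm (K i j)" for i j
    unfolding K_def by (intro sm_matrix_mult sm_Om sm_inverse_metric)
  have skew: "transpose (K i j q) = - K i j q" if "q \<in> dom c" for i j q
    using Om_skew[OF that, of i j]
    by (simp add: K_def matrix_transpose_mul inverse_metric_sym[OF that] eq_neg_iff_add_eq_0 add.commute)
  have anti: "K j i q = - K i j q" if "q \<in> dom c" for i j q
    using Om_antisym[OF that, of i j] by (simp add: K_def matrix_ring)
  define dK where "dK l i j = pd c l (K i j) p" for l i j
  have dskew: "transpose (dK l i j) = - dK l i j" for l i j
  proof -
    have "transpose (dK l i j) = pd c l (\<lambda>q. transpose (K i j q)) p"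
      using pd_transpose[OF sm_imp_df[OF smK p]] by (simp add: dK_def)
    also have "\<dots> = pd c l (\<lambda>q. - K i j q) p"
      by (rule pd_cong[OF p]) (auto simp: skew intro!: df_transpose sm_imp_df[OF smK p])
    also have "\<dots> = - dK l i j" by (simp add: pd_uminus sm_imp_df[OF smK p] dK_def)
    finally show ?thesis .
  qed
  have danti: "dK l j i = - dK l i j" for l i j
  proof -
    have "dK l j i = pd c l (\<lambda>q. - K i j q) p"
      unfolding dK_def by (rule pd_cong[OF p]) (auto simp: anti[of _ j i] intro!: sm_imp_df[OF smK p])
    also have "\<dots> = - dK l i j" by (simp add: pd_uminus sm_imp_df[OF smK p] dK_def)
    finally show ?thesis .
  qed
  have sk: "K i j p $ a $ b = - K i j p $ b $ a" "dK l i j $ a $ b = - dK l i j $ b $ a" for i j a b l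
    using skew[OF p, of i j] dskew[of l i j] by (metis transpose_nth vector_uminus_component)+
  have sk2: "K i j p $ a $ b = K j i p $ b $ a" "dK l i j $ a $ b = dK l j i $ b $ a" for i j a b l
    using sk(1)[of i j a b] sk(2)[of l i j a b] by (simp_all add: anti[OF p, of j i] danti[of l j i])
  have dK_eq: "dK m i j = Om i j p ** pd c m H p + pd c m (Om i j) p ** H p" for m i j
    unfolding dK_def K_def[abs_def] by (intro pd_matrix_mult p sm_imp_df sm_Om sm_inverse_metric)
  \<comment> \<open>As the inverse metric is parallel, raising an index commutes with the covariant
    derivative, and the Bianchi identity passes from \<open>Om\<close> to \<open>K\<close>.\<close>
  have cov: "dK m i j + Gam m p ** K i j p + K i j p ** transpose (Gam m p) =
      (pd c m (Om i j) p + Gam m p ** Om i j p - Om i j p ** Gam m p) ** H p" for m i j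
    using p by (simp add: dK_eq K_def pd_inverse_metric matrix_ring algebra_simps)
  have bianchi: "(dK m i j + Gam m p ** K i j p + K i j p ** transpose (Gam m p))
    + (dK i j m + Gam i p ** K j m p + K j m p ** transpose (Gam i p))
    + (dK j m i + Gam j p ** K m i p + K m i p ** transpose (Gam j p)) = 0" for i j
    unfolding cov matrix_mult.add_left[symmetric] second_bianchi[OF p] by simp
  \<comment> \<open>\<open>e\<close> is the Ricci tensor with one index raised, and
    \<open>de\<close> collects its partial derivatives.\<close>
  define e where "e i m = (\<Sum>a\<in>UNIV. K a m p $ a $ i)" for i m
  define de where "de l i m = (\<Sum>a\<in>UNIV. dK l a m $ a $ i)" for l i m
  have E_eq: "(H q ** transpose (ricci g c q)) $ i $ m = (\<Sum>a\<in>UNIV. K a m q $ a $ i)"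
    if "q \<in> dom c" for q i m
  proof -
    have "(H q ** transpose (ricci g c q)) $ i $ m = (\<Sum>k\<in>UNIV. \<Sum>a\<in>UNIV. Om a m q $ a $ k * H q $ i $ k)"
      by (simp add: matrix_mult_nth transpose_nth ricci_nth sum_distrib_left mult.commute)
    also have "\<dots> = (\<Sum>a\<in>UNIV. \<Sum>k\<in>UNIV. Om a m q $ a $ k * H q $ i $ k)" by (rule sum.swap)
    also have "\<dots> = (\<Sum>a\<in>UNIV. \<Sum>k\<in>UNIV. Om a m q $ a $ k * H q $ k $ i)"
      by (intro sum.cong refl) (metis inverse_metric_sym[OF that] transpose_nth)
    finally show ?thesis by (simp add: K_def matrix_mult_nth)
  qed
  have S_eq: "scalar_curvature g c q = (\<Sum>i\<in>UNIV. \<Sum>j\<in>UNIV. K i j q $ i $ j)" if "q \<in> dom c" for q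
  proof -
    have "scalar_curvature g c q = (\<Sum>j\<in>UNIV. (H q ** transpose (ricci g c q)) $ j $ j)"
      by (simp add: scalar_curvature_def matrix_mult_nth transpose_nth)
    also have "\<dots> = (\<Sum>j\<in>UNIV. \<Sum>i\<in>UNIV. K i j q $ i $ j)"
      by (simp add: E_eq[OF that])
    also have "\<dots> = (\<Sum>i\<in>UNIV. \<Sum>j\<in>UNIV. K i j q $ i $ j)" by (rule sum.swap)
    finally show ?thesis .
  qed
  have dfK: "df (\<lambda>q. K i j q $ a $ b) p" for i j a b
    by (intro df_nth sm_imp_df[OF _ p] smK)
  have dE: "pd c l (\<lambda>q. (H q ** transpose (ricci g c q)) $ i $ m) p = de l i m" for l i m
  proof -
    have "pd c l (\<lambda>q. (H q ** transpose (ricci g c q)) $ i $ m) p = pd c l (\<lambda>q. \<Sum>a\<in>UNIV. K a m q $ a $ i) p"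
      by (rule pd_cong[OF p, symmetric]) (auto simp: E_eq intro!: df_sum dfK)
    also have "\<dots> = de l i m"
      by (simp add: pd_sum dfK pd_nth_nth[OF smK p] de_def dK_def)
    finally show ?thesis .
  qed
  have dS: "pd c m (scalar_curvature g c) p = (\<Sum>i\<in>UNIV. \<Sum>j\<in>UNIV. dK m i j $ i $ j)"
  proof -
    have "pd c m (scalar_curvature g c) p = pd c m (\<lambda>q. \<Sum>i\<in>UNIV. \<Sum>j\<in>UNIV. K i j q $ i $ j) p"
      by (rule pd_cong[OF p, symmetric]) (auto simp: S_eq intro!: df_sum dfK)
    also have "\<dots> = (\<Sum>i\<in>UNIV. \<Sum>j\<in>UNIV. dK m i j $ i $ j)"
      by (simp add: pd_sum dfK df_sum pd_nth_nth[OF smK p] dK_def)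
    finally show ?thesis .
  qed
  have div_eq: "endo_div (\<lambda>q. H q ** transpose (ricci g c q)) m p = (\<Sum>i\<in>UNIV. de i i m)
      + (\<Sum>i\<in>UNIV. \<Sum>j\<in>UNIV. Gam i p $ i $ j * e j m) - (\<Sum>i\<in>UNIV. \<Sum>j\<in>UNIV. Gam m p $ i $ j * e j i)"
    unfolding endo_div_def dE E_eq[OF p] e_def[symmetric] by (simp add: sum.distrib sum_subtractf)
  \<comment> \<open>\<open>s2\<close> to \<open>s9\<close> evaluate the terms of the Bianchi sum
    contracted over row \<open>i\<close> and column \<open>j\<close>. The derivative in direction
    \<open>m\<close> is \<open>dS\<close>; each of the other two cyclic terms yields derivative and
    connection parts of minus the divergence of Ricci. In \<open>s6\<close> and \<open>s8\<close> a
    symmetric pair of lower indices of \<open>Gam\<close> meets a skew pair of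
    \<open>K\<close>.\<close>
  have s2: "(\<Sum>i\<in>UNIV. \<Sum>j\<in>UNIV. \<Sum>q\<in>UNIV. Gam m p $ i $ q * K i j p $ q $ j) =
      (\<Sum>i\<in>UNIV. \<Sum>j\<in>UNIV. Gam m p $ i $ j * e j i)"
  proof (rule sum.cong[OF refl])
    fix i
    have "(\<Sum>j\<in>UNIV. \<Sum>q\<in>UNIV. Gam m p $ i $ q * K i j p $ q $ j) =
        (\<Sum>q\<in>UNIV. \<Sum>j\<in>UNIV. Gam m p $ i $ q * K j i p $ j $ q)"
      by (subst sum.swap) (simp add: sk2(1)[of i])
    then show "(\<Sum>j\<in>UNIV. \<Sum>q\<in>UNIV. Gam m p $ i $ q * K i j p $ q $ j) = (\<Sum>j\<in>UNIV. Gam m p $ i $ j * e j i)"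
      by (simp add: e_def sum_distrib_left)
  qed
  have s3: "(\<Sum>i\<in>UNIV. \<Sum>j\<in>UNIV. \<Sum>q\<in>UNIV. K i j p $ i $ q * Gam m p $ j $ q) =
      (\<Sum>i\<in>UNIV. \<Sum>j\<in>UNIV. Gam m p $ i $ j * e j i)"
  proof -
    have "(\<Sum>i\<in>UNIV. \<Sum>q\<in>UNIV. K i j p $ i $ q * Gam m p $ j $ q) = (\<Sum>q\<in>UNIV. Gam m p $ j $ q * e q j)" for j
      by (subst sum.swap) (simp add: e_def sum_distrib_left mult.commute)
    then show ?thesis by (subst sum.swap) simp
  qed
  have s4: "(\<Sum>i\<in>UNIV. \<Sum>j\<in>UNIV. dK i j m $ i $ j) = - (\<Sum>i\<in>UNIV. de i i m)"
    unfolding de_def sum_negf[symmetric] by (intro sum.cong refl sk(2))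
  have s5: "(\<Sum>i\<in>UNIV. \<Sum>j\<in>UNIV. \<Sum>q\<in>UNIV. Gam i p $ i $ q * K j m p $ q $ j) =
      - (\<Sum>i\<in>UNIV. \<Sum>j\<in>UNIV. Gam i p $ i $ j * e j m)"
  proof -
    have "(\<Sum>j\<in>UNIV. \<Sum>q\<in>UNIV. Gam i p $ i $ q * K j m p $ q $ j) = - (\<Sum>j\<in>UNIV. Gam i p $ i $ j * e j m)" for i
      by (subst sum.swap, simp only: e_def sum_distrib_left sum_negf[symmetric], intro sum.cong refl)
         (metis sk(1) mult_minus_right)
    then show ?thesis by (simp add: sum_negf)
  qed
  have s6: "(\<Sum>i\<in>UNIV. \<Sum>j\<in>UNIV. \<Sum>q\<in>UNIV. K j m p $ i $ q * Gam i p $ j $ q) = 0"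
  proof -
    have "(\<Sum>i\<in>UNIV. \<Sum>q\<in>UNIV. K j m p $ i $ q * Gam i p $ j $ q) = 0" for j
    proof -
      have "(\<Sum>i\<in>UNIV. \<Sum>q\<in>UNIV. K j m p $ i $ q * Gam i p $ j $ q) =
          (\<Sum>q\<in>UNIV. \<Sum>i\<in>UNIV. K j m p $ i $ q * Gam i p $ j $ q)" by (rule sum.swap)
      also have "\<dots> = - (\<Sum>q\<in>UNIV. \<Sum>i\<in>UNIV. K j m p $ q $ i * Gam q p $ j $ i)"
        unfolding sum_negf[symmetric]
        by (intro sum.cong refl) (metis Gam_sym[OF p] sk(1) mult_minus_left)
      finally show ?thesis by simp
    qed
    then show ?thesis by (subst sum.swap) simp
  qed
  have s7: "(\<Sum>i\<in>UNIV. \<Sum>j\<in>UNIV. dK j m i $ i $ j) = - (\<Sum>i\<in>UNIV. de i i m)"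
    by (subst sum.swap, simp only: de_def sum_negf[symmetric], intro sum.cong refl)
       (metis danti vector_uminus_component)
  have s8: "(\<Sum>i\<in>UNIV. \<Sum>j\<in>UNIV. \<Sum>q\<in>UNIV. Gam j p $ i $ q * K m i p $ q $ j) = 0"
  proof -
    have "(\<Sum>j\<in>UNIV. \<Sum>q\<in>UNIV. Gam j p $ i $ q * K m i p $ q $ j) = 0" for i
    proof -
      have "(\<Sum>j\<in>UNIV. \<Sum>q\<in>UNIV. Gam j p $ i $ q * K m i p $ q $ j) =
          (\<Sum>q\<in>UNIV. \<Sum>j\<in>UNIV. Gam j p $ i $ q * K m i p $ q $ j)" by (rule sum.swap)
      also have "\<dots> = - (\<Sum>q\<in>UNIV. \<Sum>j\<in>UNIV. Gam q p $ i $ j * K m i p $ j $ q)"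
        unfolding sum_negf[symmetric]
        by (intro sum.cong refl) (metis Gam_sym[OF p] sk(1) mult_minus_right)
      finally show ?thesis by simp
    qed
    then show ?thesis by simp
  qed
  have s9: "(\<Sum>i\<in>UNIV. \<Sum>j\<in>UNIV. \<Sum>q\<in>UNIV. K m i p $ i $ q * Gam j p $ j $ q) =
      - (\<Sum>i\<in>UNIV. \<Sum>j\<in>UNIV. Gam i p $ i $ j * e j m)"
  proof -
    have 1: "K m i p $ i $ q * Gam j p $ j $ q = - (Gam j p $ j $ q * K i m p $ i $ q)" for i j q
      by (simp add: anti[OF p, of i m])
    have "(\<Sum>i\<in>UNIV. \<Sum>j\<in>UNIV. \<Sum>q\<in>UNIV. K m i p $ i $ q * Gam j p $ j $ q) =
        (\<Sum>j\<in>UNIV. \<Sum>i\<in>UNIV. \<Sum>q\<in>UNIV. K m i p $ i $ q * Gam j p $ j $ q)" by (rule sum.swap)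
    also have "\<dots> = (\<Sum>j\<in>UNIV. \<Sum>q\<in>UNIV. \<Sum>i\<in>UNIV. K m i p $ i $ q * Gam j p $ j $ q)"
      by (intro sum.cong refl sum.swap)
    also have "\<dots> = - (\<Sum>j\<in>UNIV. \<Sum>q\<in>UNIV. Gam j p $ j $ q * e q m)"
      unfolding 1 e_def sum_distrib_left sum_negf ..
    finally show ?thesis .
  qed
  have "(\<Sum>i\<in>UNIV. \<Sum>j\<in>UNIV. ((dK m i j + Gam m p ** K i j p + K i j p ** transpose (Gam m p))
    + (dK i j m + Gam i p ** K j m p + K j m p ** transpose (Gam i p))
    + (dK j m i + Gam j p ** K m i p + K m i p ** transpose (Gam j p))) $ i $ j) = 0"
    unfolding bianchi by simp
  then show ?thesis
    unfolding dS div_eq vector_add_component matrix_mult_nth transpose_nth sum.distrib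
      s2 s3 s4 s5 s6 s7 s8 s9 by argo
qed

text \<open>\<open>Om i k\<close> is the commutator of the operators "partial derivative plus
  connection matrix". The Christoffel correction for the index of \<open>Dv Z\<close> is symmetric
  in \<open>i\<close> and \<open>k\<close>, so leaving it out of both terms does not change the
  difference.\<close>

lemma Dv_commute:
  assumes p: "p \<in> dom c" and Z: "sm Z"
  shows "pd c i (Dv Z k) p + Gam i p *v Dv Z k p - (pd c k (Dv Z i) p + Gam k p *v Dv Z i p) = Om i k p *v Z p"
proof -
  have d: "pd c i (Dv Z k) p = pd c i (pd c k Z) p + (Gam k p *v pd c i Z p + pd c i (Gam k) p *v Z p)" for i k
    unfolding Dv_def[abs_def]
    using p Z by (simp add: pd_add df_matrix_vector_mult pd_matrix_vector_mult sm_imp_df[OF _ p] sm_pd sm_Gam)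
  have "pd c i (pd c k Z) p = pd c k (pd c i Z) p"
    by (rule pd_commute_euclidean[OF p sm_imp_ck[OF Z]])
  then show ?thesis
    unfolding d Om_eq[OF p] Dv_def
    by (simp add: matrix_vector_mult.add_left matrix_vector_mult.add_right matrix_vector_mult.diff_left
        matrix_vector_mul_assoc[symmetric] algebra_simps)
qed

text \<open>The trace of \<open>Dv_commute\<close>. For a gradient field this is the Bochner
  formula: the divergence of the Hessian is the differential of the Laplacian plus Ricci applied to
  the gradient.\<close>

lemma ricci_identity:
  assumes p: "p \<in> dom c" and Z: "sm Z"
  shows "endo_div (\<lambda>q. \<chi> i k. Dv Z k q $ i) k p =
    pd c k (\<lambda>q. \<Sum>i\<in>UNIV. Dv Z i q $ i) p + (ricci g c p *v Z p) $ k"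
proof -
  have pdD: "pd c i (\<lambda>q. Dv Z k q $ j) p = pd c i (Dv Z k) p $ j" for i j k
    by (simp add: pd_nth sm_imp_df[OF _ p] sm_Dv Z)
  have "pd c i (Dv Z k) p $ i + (\<Sum>j\<in>UNIV. Gam i p $ i $ j * Dv Z k p $ j)
      - (\<Sum>j\<in>UNIV. Gam k p $ i $ j * Dv Z i p $ j) = pd c k (Dv Z i) p $ i + (\<Sum>l\<in>UNIV. Om i k p $ i $ l * Z p $ l)" for i
    using arg_cong[OF Dv_commute[OF p Z, of i k], of "\<lambda>v. v $ i"]
    by (simp add: matrix_vector_mult_nth algebra_simps)
  then have "endo_div (\<lambda>q. \<chi> i k. Dv Z k q $ i) k p =
      (\<Sum>i\<in>UNIV. pd c k (Dv Z i) p $ i + (\<Sum>l\<in>UNIV. Om i k p $ i $ l * Z p $ l))"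
    by (simp add: endo_div_def pdD)
  also have "\<dots> = (\<Sum>i\<in>UNIV. pd c k (Dv Z i) p $ i) + (\<Sum>l\<in>UNIV. \<Sum>i\<in>UNIV. Om i k p $ i $ l * Z p $ l)"
    by (simp add: sum.distrib) (rule sum.swap)
  also have "(\<Sum>l\<in>UNIV. \<Sum>i\<in>UNIV. Om i k p $ i $ l * Z p $ l) = (ricci g c p *v Z p) $ k"
    by (simp add: matrix_vector_mult_nth ricci_nth sum_distrib_right)
  also have "(\<Sum>i\<in>UNIV. pd c k (Dv Z i) p $ i) = pd c k (\<lambda>q. \<Sum>i\<in>UNIV. Dv Z i q $ i) p"
    by (subst pd_sum) (auto simp: pdD intro!: df_nth[OF sm_imp_df[OF sm_Dv[OF Z] p]])
  finally show ?thesis .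
qed

lemma divergence_eq_Dv:
  assumes "p \<in> dom c" "sm (Y c)"
  shows "divergence g Y c p = (\<Sum>i\<in>UNIV. Dv (Y c) i p $ i)"
  using assms by (simp add: divergence_def Dv_def matrix_vector_mult_nth pd_nth sm_imp_df Gam_def)

text \<open>Product rule for the divergence of \<open>P Z\<close>. The connection terms at the
  contracted index enter through \<open>endo_div\<close> and through \<open>Dv\<close> with opposite
  signs, and the lower symmetry of \<open>Gam\<close> matches them.\<close>

lemma trace_Dv_endo:
  assumes p: "p \<in> dom c" and P: "sm P" and Z: "sm Z"
  shows "(\<Sum>i\<in>UNIV. Dv (\<lambda>q. P q *v Z q) i p $ i) =
    (\<Sum>k\<in>UNIV. endo_div P k p * Z p $ k) + (\<Sum>i\<in>UNIV. \<Sum>k\<in>UNIV. P p $ i $ k * Dv Z i p $ k)"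
proof -
  have pdP: "pd c i (\<lambda>q. P q $ i $ k) p = pd c i P p $ i $ k" for i k
    by (rule pd_nth_nth[OF P p])
  have L: "(\<Sum>i\<in>UNIV. Dv (\<lambda>q. P q *v Z q) i p $ i) =
     (\<Sum>i\<in>UNIV. \<Sum>k\<in>UNIV. P p $ i $ k * pd c i Z p $ k) + (\<Sum>i\<in>UNIV. \<Sum>k\<in>UNIV. pd c i P p $ i $ k * Z p $ k)
     + (\<Sum>i\<in>UNIV. \<Sum>j\<in>UNIV. Gam i p $ i $ j * (\<Sum>k\<in>UNIV. P p $ j $ k * Z p $ k))"
    using p by (simp add: Dv_def pd_matrix_vector_mult sm_imp_df P Z matrix_vector_mult_nth sum.distrib)
  have e: "(\<Sum>k\<in>UNIV. endo_div P k p * Z p $ k) =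
     (\<Sum>k\<in>UNIV. \<Sum>i\<in>UNIV. pd c i P p $ i $ k * Z p $ k)
     + (\<Sum>k\<in>UNIV. \<Sum>i\<in>UNIV. \<Sum>j\<in>UNIV. Gam i p $ i $ j * P p $ j $ k * Z p $ k)
     - (\<Sum>k\<in>UNIV. \<Sum>i\<in>UNIV. \<Sum>j\<in>UNIV. Gam k p $ i $ j * P p $ j $ i * Z p $ k)"
    by (simp add: endo_div_def pdP sum_distrib_right sum.distrib sum_subtractf left_diff_distrib distrib_right)
  have D: "(\<Sum>i\<in>UNIV. \<Sum>k\<in>UNIV. P p $ i $ k * Dv Z i p $ k) =
     (\<Sum>i\<in>UNIV. \<Sum>k\<in>UNIV. P p $ i $ k * pd c i Z p $ k)
     + (\<Sum>i\<in>UNIV. \<Sum>k\<in>UNIV. \<Sum>j\<in>UNIV. P p $ i $ k * (Gam i p $ k $ j * Z p $ j))"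
    by (simp add: Dv_def matrix_vector_mult_nth distrib_left sum.distrib sum_distrib_left)
  have 1: "(\<Sum>k\<in>UNIV. \<Sum>i\<in>UNIV. pd c i P p $ i $ k * Z p $ k) = (\<Sum>i\<in>UNIV. \<Sum>k\<in>UNIV. pd c i P p $ i $ k * Z p $ k)"
    by (rule sum.swap)
  have 2: "(\<Sum>k\<in>UNIV. \<Sum>i\<in>UNIV. \<Sum>j\<in>UNIV. Gam i p $ i $ j * P p $ j $ k * Z p $ k) =
     (\<Sum>i\<in>UNIV. \<Sum>j\<in>UNIV. Gam i p $ i $ j * (\<Sum>k\<in>UNIV. P p $ j $ k * Z p $ k))"
  proof -
    have "(\<Sum>k\<in>UNIV. \<Sum>i\<in>UNIV. \<Sum>j\<in>UNIV. Gam i p $ i $ j * P p $ j $ k * Z p $ k) =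
      (\<Sum>i\<in>UNIV. \<Sum>k\<in>UNIV. \<Sum>j\<in>UNIV. Gam i p $ i $ j * P p $ j $ k * Z p $ k)" by (rule sum.swap)
    also have "\<dots> = (\<Sum>i\<in>UNIV. \<Sum>j\<in>UNIV. \<Sum>k\<in>UNIV. Gam i p $ i $ j * P p $ j $ k * Z p $ k)"
      by (intro sum.cong refl sum.swap)
    finally show ?thesis by (simp add: sum_distrib_left mult.assoc)
  qed
  have 3: "(\<Sum>k\<in>UNIV. \<Sum>i\<in>UNIV. \<Sum>j\<in>UNIV. Gam k p $ i $ j * P p $ j $ i * Z p $ k) =
     (\<Sum>i\<in>UNIV. \<Sum>k\<in>UNIV. \<Sum>j\<in>UNIV. P p $ i $ k * (Gam i p $ k $ j * Z p $ j))"
  proof -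
    have "(\<Sum>k\<in>UNIV. \<Sum>i\<in>UNIV. \<Sum>j\<in>UNIV. Gam k p $ i $ j * P p $ j $ i * Z p $ k) =
       (\<Sum>i\<in>UNIV. \<Sum>k\<in>UNIV. \<Sum>j\<in>UNIV. Gam k p $ i $ j * P p $ j $ i * Z p $ k)" by (rule sum.swap)
    also have "\<dots> = (\<Sum>i\<in>UNIV. \<Sum>j\<in>UNIV. \<Sum>k\<in>UNIV. Gam k p $ i $ j * P p $ j $ i * Z p $ k)"
      by (intro sum.cong refl sum.swap)
    also have "\<dots> = (\<Sum>j\<in>UNIV. \<Sum>i\<in>UNIV. \<Sum>k\<in>UNIV. Gam k p $ i $ j * P p $ j $ i * Z p $ k)" by (rule sum.swap)
    also have "\<dots> = (\<Sum>j\<in>UNIV. \<Sum>i\<in>UNIV. \<Sum>k\<in>UNIV. P p $ j $ i * (Gam j p $ i $ k * Z p $ k))"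
      by (intro sum.cong refl) (simp add: Gam_sym[OF p] mult_ac)
    finally show ?thesis .
  qed
  show ?thesis unfolding L e D 1 2 3 by simp
qed

lemma trace_Dv_scaleR:
  assumes p: "p \<in> dom c" and f: "sm f" and Z: "sm Z"
  shows "(\<Sum>i\<in>UNIV. Dv (\<lambda>q. f q *\<^sub>R Z q) i p $ i) =
    (\<Sum>i\<in>UNIV. pd c i f p * Z p $ i) + f p * (\<Sum>i\<in>UNIV. Dv Z i p $ i)"
proof -
  have "pd c i (\<lambda>q. f q *\<^sub>R Z q) p = f p *\<^sub>R pd c i Z p + pd c i f p *\<^sub>R Z p" for i
    using pd_bounded_bilinear[OF bounded_bilinear_scaleR, of f p Z i] p f Z
    by (simp add: sm_imp_df in_coords_coord)
  then have "Dv (\<lambda>q. f q *\<^sub>R Z q) i p = f p *\<^sub>R Dv Z i p + pd c i f p *\<^sub>R Z p" for i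
    by (simp add: Dv_def matrix_vector_mult.scaleR_right algebra_simps)
  then show ?thesis by (simp add: sum.distrib sum_distrib_left)
qed

lemma Dv_add:
  assumes "p \<in> dom c" "sm Y" "sm Z"
  shows "Dv (\<lambda>q. Y q + Z q) i p = Dv Y i p + Dv Z i p"
  using assms by (simp add: Dv_def pd_add sm_imp_df matrix_vector_mult.add_right)

lemma endo_div_diff:
  assumes "p \<in> dom c" "sm P" "sm Q"
  shows "endo_div (\<lambda>q. P q - Q q) m p = endo_div P m p - endo_div Q m p"
  using assms
  by (simp add: endo_div_def pd_diff df_nth sm_imp_df sum.distrib sum_subtractf algebra_simps)

text \<open>The identity endomorphism is parallel: the two connection terms of
  \<open>endo_div\<close> cancel by the lower symmetry of \<open>Gam\<close>, and only the
  differential of \<open>f\<close> remains.\<close>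

lemma endo_div_scalar:
  assumes "p \<in> dom c" "sm f"
  shows "endo_div (\<lambda>q. f q *\<^sub>R mat 1) m p = pd c m f p"
proof -
  have 1: "pd c i (\<lambda>q. (f q *\<^sub>R mat 1 :: real ^ 'n ^ 'n) $ i $ m) p = (if i = m then pd c m f p else 0)" for i
    by (cases "i = m") (auto simp: mat_def pd_const)
  have 2: "(\<Sum>j\<in>UNIV. Gam i p $ i $ j * (f p *\<^sub>R mat 1 :: real ^ 'n ^ 'n) $ j $ m) = f p * Gam i p $ i $ m" for i
    by (simp add: mat_def if_distrib cong: if_cong)
  have 3: "(\<Sum>j\<in>UNIV. Gam m p $ i $ j * (f p *\<^sub>R mat 1 :: real ^ 'n ^ 'n) $ j $ i) = f p * Gam m p $ i $ i" for i
    by (simp add: mat_def if_distrib cong: if_cong)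
  show ?thesis unfolding endo_div_def 1 2 3
    by (simp add: sum.distrib sum_subtractf Gam_sym[OF assms(1), of m])
qed

lemma endo_div_cong:
  assumes "p \<in> dom c" "sm P" "\<And>q. q \<in> dom c \<Longrightarrow> P q = Q q"
  shows "endo_div P m p = endo_div Q m p"
proof -
  have "pd c i (\<lambda>q. P q $ i $ m) p = pd c i (\<lambda>q. Q q $ i $ m) p" for i
    by (rule pd_cong[OF assms(1)]) (auto simp: assms intro!: df_nth sm_imp_df)
  then show ?thesis using assms(3)[OF assms(1)] by (simp add: endo_div_def)
qed

text \<open>Replacing the derivative of the metric by \<open>pd_metric\<close> supplies exactly the
  connection terms that turn partial derivatives of \<open>X\<close> into covariant ones; the lower
  symmetry of \<open>Gam\<close> puts their indices into the right slots.\<close>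

lemma lie_derivative_metric_eq:
  assumes p: "p \<in> dom c" and X: "sm (X c)"
  shows "lie_derivative_metric X g c p $ i $ j = (G p *v Dv (X c) i p) $ j + (G p *v Dv (X c) j p) $ i"
proof -
  have s: "G p $ a $ b = G p $ b $ a" for a b
    using metric_sym[OF p] transpose_nth by metis
  have 1: "X c p $ k * pd c k (\<lambda>q. G q $ i $ j) p =
      (\<Sum>m\<in>UNIV. G p $ j $ m * (Gam i p $ m $ k * X c p $ k)) + (\<Sum>m\<in>UNIV. G p $ i $ m * (Gam j p $ m $ k * X c p $ k))" for k
    unfolding pd_nth_nth[OF sm_metric p] pd_metric[OF p] vector_add_component matrix_mult_nth transpose_nth
      distrib_left sum_distrib_left
    by (intro arg_cong2[of _ _ _ _ "(+)"] sum.cong refl) (simp_all add: Gam_sym[OF p, of k] s[of _ j] mult_ac)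
  have "lie_derivative_metric X g c p $ i $ j =
     (\<Sum>k\<in>UNIV. \<Sum>m\<in>UNIV. G p $ j $ m * (Gam i p $ m $ k * X c p $ k))
     + (\<Sum>k\<in>UNIV. \<Sum>m\<in>UNIV. G p $ i $ m * (Gam j p $ m $ k * X c p $ k))
     + (\<Sum>k\<in>UNIV. G p $ j $ k * pd c i (X c) p $ k) + (\<Sum>k\<in>UNIV. G p $ i $ k * pd c j (X c) p $ k)"
    unfolding lie_derivative_metric_def
    by (simp add: 1 pd_nth sm_imp_df[OF X p] sum.distrib s[of _ j])
  moreover have "(\<Sum>k\<in>UNIV. \<Sum>m\<in>UNIV. G p $ j $ m * (Gam i p $ m $ k * X c p $ k)) = (\<Sum>m\<in>UNIV. G p $ j $ m * (Gam i p *v X c p) $ m)" for i j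
    by (subst sum.swap) (simp add: matrix_vector_mult_nth sum_distrib_left)
  ultimately show ?thesis
    by (simp add: Dv_def matrix_vector_mult_nth[of "G p"] distrib_left sum.distrib)
qed

lemma sm_gradient:
  assumes "sm h" shows "sm (gradient g h c)"
proof -
  have "sm (\<lambda>q. H q *v (\<chi> j. pd c j h q))"
    by (intro sm_matrix_vector_mult sm_inverse_metric sm_vec) (simp add: sm_pd assms)
  then show ?thesis
    by (rule sm_cong[rotated]) (simp add: gradient_def matrix_vector_mult_def)
qed

lemma lower_gradient: "p \<in> dom c \<Longrightarrow> G p *v gradient g h c p = (\<chi> j. pd c j h p)"
proof -
  assume p: "p \<in> dom c"
  have "gradient g h c p = H p *v (\<chi> j. pd c j h p)"
    by (simp add: gradient_def matrix_vector_mult_def vec_eq_iff)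
  then show ?thesis using GH[OF p] by (simp add: matrix_vector_mul_assoc)
qed

text \<open>Lowering the index gives the second partial derivatives of \<open>h\<close> minus
  \<open>Gam\<close> contracted with the differential of \<open>h\<close>, and both parts are
  symmetric.\<close>

lemma hessian_sym:
  assumes p: "p \<in> dom c" and h: "sm h"
  shows "(G p *v Dv (gradient g h c) i p) $ j = (G p *v Dv (gradient g h c) j p) $ i"
proof -
  let ?Z = "gradient g h c"
  have "(G p *v Dv ?Z i p) $ j = pd c i (pd c j h) p - (\<Sum>m\<in>UNIV. Gam i p $ m $ j * pd c m h p)" for i j
  proof -
    have "pd c i (\<lambda>q. G q *v ?Z q) p = pd c i (\<lambda>q. \<chi> j. pd c j h q) p"
      by (rule pd_cong[OF p])
         (auto simp: lower_gradient intro!: sm_imp_df[OF _ p] sm_matrix_vector_mult sm_metric sm_gradient h)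
    then have "pd c i (\<lambda>q. G q *v ?Z q) p $ j = pd c i (pd c j h) p"
      using pd_nth[of "\<lambda>q. \<chi> j. pd c j h q" p i j]
      by (simp add: sm_imp_df[OF _ p] sm_vec[of "\<lambda>q. \<chi> j. pd c j h q"] sm_pd h)
    moreover have "pd c i (\<lambda>q. G q *v ?Z q) p = G p *v pd c i ?Z p + pd c i G p *v ?Z p"
      using p by (intro pd_matrix_vector_mult sm_imp_df sm_metric sm_gradient h)
    moreover have "pd c i G p *v ?Z p = transpose (Gam i p) *v (\<chi> j. pd c j h p) + G p *v (Gam i p *v ?Z p)"
      unfolding pd_metric[OF p] lower_gradient[OF p, symmetric]
      by (simp add: matrix_vector_mult.add_left matrix_vector_mul_assoc)
    moreover have "(transpose (Gam i p) *v (\<chi> j. pd c j h p)) $ j = (\<Sum>m\<in>UNIV. Gam i p $ m $ j * pd c m h p)"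
      unfolding matrix_vector_mult_nth transpose_nth by simp
    ultimately show ?thesis by (simp add: Dv_def matrix_vector_mult.add_right)
  qed
  moreover have "pd c i (pd c j h) p = pd c j (pd c i h) p"
    by (rule pd_commute[OF p sm_imp_ck[OF h]])
  ultimately show ?thesis by (simp add: Gam_sym[OF p, of i _ j])
qed

end

section \<open>Pointwise identities for almost Ricci solitons\<close>

text \<open>Symmetric elimination, one index at a time, in the manner of Cholesky. The set
  \<open>I\<close> contains the indices of all nonzero rows and loses the pivot at each step, so no
  order on the index type enters.\<close>

lemma psd_factorization:
  fixes M :: "real ^ 'n ^ 'n"
  assumes "finite I" "transpose M = M" "\<And>x. x \<bullet> (M *v x) \<ge> 0" "\<And>i j. M $ i $ j \<noteq> 0 \<Longrightarrow> i \<in> I"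
  shows "\<exists>V :: real ^ 'n ^ 'n. M = V ** transpose V"
proof -
  have "\<exists>v :: 'n \<Rightarrow> real ^ 'n. \<forall>i j. M $ i $ j = (\<Sum>a\<in>I. v a $ i * v a $ j)"
    using assms
  proof (induction I arbitrary: M rule: finite_induct)
    case empty
    then show ?case by force
  next
    case (insert a I)
    let ?e = "axis a 1 :: real ^ 'n"
    have sym: "M $ i $ j = M $ j $ i" for i j
      using insert.prems(1) transpose_nth by metis
    have e1: "(M *v ?e) $ i = M $ a $ i" for i
      by (simp add: matrix_vector_mult_nth axis_def if_distrib sym[of i a] cong: if_cong)
    have e2: "?e \<bullet> (M *v x) = (M *v x) $ a" for x by (simp add: inner_axis')
    have e3: "x \<bullet> (M *v ?e) = (M *v x) $ a" for x
      by (simp only: inner_vec_def e1) (simp add: matrix_vector_mult_nth mult.commute)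
    have expand: "(x - t *\<^sub>R ?e) \<bullet> (M *v (x - t *\<^sub>R ?e)) =
        x \<bullet> (M *v x) - 2 * t * (M *v x) $ a + t\<^sup>2 * M $ a $ a" for x t
      by (simp add: matrix_vector_mult.diff_right matrix_vector_mult.scaleR_right inner_diff_left inner_diff_right
          e2 e3 e1 power2_eq_square algebra_simps)
    show ?case
    proof (cases "M $ a $ a = 0")
      case True
      have zero: "M $ a $ i = 0" for i
      proof (rule ccontr)
        assume nz: "M $ a $ i \<noteq> 0"
        define x where "x = (axis i 1 :: real ^ 'n)"
        have x: "(M *v x) $ a = M $ a $ i"
          by (simp add: x_def matrix_vector_mult_nth axis_def if_distrib cong: if_cong)
        have "0 \<le> x \<bullet> (M *v x) - 2 * t * M $ a $ i" for t
          using insert.prems(2)[of "x - t *\<^sub>R ?e"] unfolding expand x True by simp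
        \<comment> \<open>With a zero diagonal entry the form is affine in \<open>t\<close>; this
          \<open>t\<close> gives it the value -1.\<close>
        from this[of "(x \<bullet> (M *v x) + 1) / (2 * M $ a $ i)"] nz show False by simp
      qed
      have "\<exists>v :: 'n \<Rightarrow> real ^ 'n. \<forall>i j. M $ i $ j = (\<Sum>b\<in>I. v b $ i * v b $ j)"
        using insert.prems zero by (intro insert.IH) (metis insertE)+
      then obtain v :: "'n \<Rightarrow> real ^ 'n" where "\<forall>i j. M $ i $ j = (\<Sum>b\<in>I. v b $ i * v b $ j)" by blast
      then have "\<forall>i j. M $ i $ j = (\<Sum>b\<in>insert a I. (v(a := 0)) b $ i * (v(a := 0)) b $ j)"
        using insert.hyps by (auto intro!: sum.cong)
      then show ?thesis by blast
    next
      case False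
      have pos: "M $ a $ a > 0"
        using insert.prems(2)[of ?e] False by (simp add: e2 e1)
      \<comment> \<open>\<open>w\<close> is the pivot row, scaled so that the products
        \<open>w $ i * w $ j\<close> reproduce row and column \<open>a\<close> of \<open>M\<close>;
        \<open>N\<close> below is the Schur complement.\<close>
      define w where "w = (\<chi> i. M $ a $ i / sqrt (M $ a $ a))"
      have ww: "w $ i * w $ j = M $ a $ i * M $ a $ j / M $ a $ a" for i j
        using pos by (simp add: w_def)
      define N :: "real ^ 'n ^ 'n" where "N = (\<chi> i j. M $ i $ j - w $ i * w $ j)"
      have "\<exists>v :: 'n \<Rightarrow> real ^ 'n. \<forall>i j. N $ i $ j = (\<Sum>b\<in>I. v b $ i * v b $ j)"
      proof (rule insert.IH)
        show "transpose N = N" by (simp add: vec_eq_iff transpose_nth N_def sym mult.commute)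
        show "i \<in> I" if "N $ i $ j \<noteq> 0" for i j
        proof -
          have "i \<noteq> a" using that pos by (auto simp: N_def ww)
          moreover have "M $ i $ j \<noteq> 0 \<or> M $ i $ a \<noteq> 0" using that by (auto simp: N_def ww sym[of i a])
          ultimately show ?thesis using insert.prems(3) by blast
        qed
        show "x \<bullet> (N *v x) \<ge> 0" for x
        proof -
          have Nx: "(N *v x) $ i = (M *v x) $ i - w $ i * (w \<bullet> x)" for i
            by (simp add: N_def matrix_vector_mult_nth inner_vec_def left_diff_distrib sum_subtractf sum_distrib_left mult.assoc)
          have "x \<bullet> (N *v x) = x \<bullet> (M *v x) - (w \<bullet> x)\<^sup>2"
            unfolding inner_vec_def[of x] Nx
            by (simp add: right_diff_distrib sum_subtractf inner_vec_def[of w] power2_eq_square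
               sum_distrib_left sum_distrib_right mult_ac)
          moreover have "w \<bullet> x = (M *v x) $ a / sqrt (M $ a $ a)"
            by (simp add: w_def inner_vec_def matrix_vector_mult_nth sum_divide_distrib)
          then have "(w \<bullet> x)\<^sup>2 = ((M *v x) $ a)\<^sup>2 / M $ a $ a" using pos by (simp add: power_divide)
          \<comment> \<open>The multiple of \<open>?e\<close> subtracted here minimizes the
            quadratic \<open>expand\<close> in \<open>t\<close>, and the minimum is the value of the
            form of \<open>N\<close> at \<open>x\<close>.\<close>
          moreover have "x \<bullet> (M *v x) - ((M *v x) $ a)\<^sup>2 / M $ a $ a \<ge> 0"
            using insert.prems(2)[of "x - ((M *v x) $ a / M $ a $ a) *\<^sub>R ?e"] pos unfolding expand
            by (simp add: power2_eq_square field_simps)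
          ultimately show ?thesis by simp
        qed
      qed
      then obtain v :: "'n \<Rightarrow> real ^ 'n" where v: "\<forall>i j. N $ i $ j = (\<Sum>b\<in>I. v b $ i * v b $ j)" by blast
      have "M $ i $ j = (\<Sum>b\<in>insert a I. (v(a := w)) b $ i * (v(a := w)) b $ j)" for i j
      proof -
        have "(\<Sum>b\<in>I. (v(a := w)) b $ i * (v(a := w)) b $ j) = (\<Sum>b\<in>I. v b $ i * v b $ j)"
          using insert.hyps by (intro sum.cong) auto
        then show ?thesis using insert.hyps v[rule_format, of i j] by (simp add: N_def)
      qed
      then show ?thesis by blast
    qed
  qed
  then obtain v :: "'n \<Rightarrow> real ^ 'n" where v: "\<forall>i j. M $ i $ j = (\<Sum>a\<in>I. v a $ i * v a $ j)" by blast
  define V :: "real ^ 'n ^ 'n" where "V = (\<chi> i a. if a \<in> I then v a $ i else 0)"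
  have "(V ** transpose V) $ i $ j = M $ i $ j" for i j
  proof -
    have "(V ** transpose V) $ i $ j = (\<Sum>a\<in>UNIV. if a \<in> I then v a $ i * v a $ j else 0)"
      by (simp add: matrix_mult_nth transpose_nth V_def) (intro sum.cong, auto)
    then show ?thesis using v by (simp add: sum.If_cases)
  qed
  then show ?thesis by (metis vec_eq_iff)
qed

lemma trace_square_symmetric:
  fixes S :: "real ^ 'n ^ 'n"
  assumes "transpose S = S"
  shows "trace (S ** S) = (\<Sum>i\<in>UNIV. \<Sum>j\<in>UNIV. (S $ i $ j)\<^sup>2)"
proof -
  have "S $ i $ j = S $ j $ i" for i j using assms transpose_nth by metis
  then show ?thesis by (simp add: trace_def matrix_mult_nth power2_eq_square)
qed

text \<open>The squared norm of a symmetric form \<open>P\<close> with respect to the inner product whose inverse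
  matrix is \<open>M\<close>.\<close>

lemma
  fixes M P :: "real ^ 'n ^ 'n"
  assumes M: "transpose M = M" "\<And>x. x \<noteq> 0 \<Longrightarrow> x \<bullet> (M *v x) > 0" and P: "transpose P = P"
  shows trace_form_nonneg: "trace ((M ** P) ** (M ** P)) \<ge> 0"
    and trace_form_eq_0: "trace ((M ** P) ** (M ** P)) = 0 \<Longrightarrow> P = 0"
proof -
  have "x \<bullet> (M *v x) \<ge> 0" for x using M(2)[of x] by (cases "x = 0") auto
  then obtain V :: "real ^ 'n ^ 'n" where V: "M = V ** transpose V"
    using psd_factorization[of UNIV M] M(1) by auto
  \<comment> \<open>The columns of \<open>V\<close> are orthonormal for the inner product with
    inverse matrix \<open>M\<close>, and \<open>S\<close> is the form in that basis; cyclicity of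
    the trace turns the squared norm into the sum of the squared entries of
    \<open>S\<close>.\<close>
  define S where "S = transpose V ** P ** V"
  have S: "transpose S = S" by (simp add: S_def matrix_transpose_mul P matrix_mul_assoc)
  have "trace ((M ** P) ** (M ** P)) = trace (V ** (transpose V ** P ** M ** P))"
    by (simp add: V matrix_mul_assoc)
  also have "\<dots> = trace ((transpose V ** P ** M ** P) ** V)" by (rule trace_mul_sym)
  also have "\<dots> = trace (S ** S)" by (simp add: S_def V matrix_mul_assoc)
  finally have eq: "trace ((M ** P) ** (M ** P)) = (\<Sum>i\<in>UNIV. \<Sum>j\<in>UNIV. (S $ i $ j)\<^sup>2)"
    using trace_square_symmetric[OF S] by simp
  show "trace ((M ** P) ** (M ** P)) \<ge> 0" unfolding eq by (intro sum_nonneg) auto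
  assume "trace ((M ** P) ** (M ** P)) = 0"
  then have "(\<Sum>j\<in>UNIV. (S $ i $ j)\<^sup>2) = 0" for i
    unfolding eq by (subst (asm) sum_nonneg_eq_0_iff) (auto intro: sum_nonneg)
  then have "S $ i $ j = 0" for i j
    by (subst (asm) sum_nonneg_eq_0_iff) auto
  then have "S = 0" by (simp add: vec_eq_iff)
  \<comment> \<open>\<open>S = 0\<close> is carried back to \<open>P\<close> through
    \<open>M ** P ** M\<close>, so that invertibility of \<open>M\<close> alone finishes the
    argument.\<close>
  have "M ** P ** M = V ** S ** transpose V" by (simp add: V S_def matrix_mul_assoc)
  then have z: "M ** P ** M = 0" by (simp add: \<open>S = 0\<close>)
  have inv: "invertible M" using M(2) by (rule positive_definite_invertible)
  have "P = matrix_inv M ** M ** P ** (M ** matrix_inv M)" using matrix_inv_inverse[OF inv] by simp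
  also have "\<dots> = matrix_inv M ** (M ** P ** M) ** matrix_inv M" by (simp add: matrix_mul_assoc)
  finally show "P = 0" by (simp add: z)
qed

lemma trace_transpose: "trace (transpose M) = trace (M :: real ^ 'n ^ 'n)"
  by (simp add: trace_def transpose_nth)

lemma trace_scaleR: "trace (r *\<^sub>R M) = r * trace (M :: real ^ 'n ^ 'n)"
  by (simp add: trace_def sum_distrib_left)

lemma trace_mat_1: "trace (mat 1 :: real ^ 'n ^ 'n) = real CARD('n)"
  by (simp add: trace_def mat_def)

section \<open>Traces, Schur's lemma and the two divergence identities\<close>

context metric_chart
begin

lemma inverse_metric_pos:
  assumes "p \<in> dom c" "x \<noteq> 0"
  shows "x \<bullet> (H p *v x) > 0"
proof -
  have x: "x = G p *v (H p *v x)" using GH[OF assms(1)] by (simp add: matrix_vector_mul_assoc)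
  then have "H p *v x \<noteq> 0" using assms(2) by fastforce
  then have "(H p *v x) \<bullet> (G p *v (H p *v x)) > 0" using metric_pos[OF assms(1)] by blast
  then show ?thesis using x by (simp add: inner_commute)
qed

lemma lie_matrix:
  assumes "p \<in> dom c" "sm (X c)"
  shows "lie_derivative_metric X g c p =
    G p ** (\<chi> i k. Dv (X c) k p $ i) + transpose (G p ** (\<chi> i k. Dv (X c) k p $ i))"
  by (simp add: vec_eq_iff lie_derivative_metric_eq[where X=X, OF assms, unfolded matrix_vector_mult_nth]
      matrix_mult_nth transpose_nth)

lemma lie_sym:
  assumes "p \<in> dom c" "sm (X c)"
  shows "transpose (lie_derivative_metric X g c p) = lie_derivative_metric X g c p"
  by (simp add: lie_matrix[where X=X, OF assms] transpose_add add.commute)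

text \<open>Contraction with a symmetric tensor sees only the symmetric part of the covariant
  derivative of \<open>X\<close>, and that part is half the Lie derivative of the metric.\<close>

lemma contract_Dv_lie:
  assumes p: "p \<in> dom c" and X: "sm (X c)" and S: "transpose S = S"
  shows "(\<Sum>i\<in>UNIV. \<Sum>k\<in>UNIV. (H p ** S) $ i $ k * Dv (X c) i p $ k) =
    trace ((H p ** S) ** (H p ** ((1/2) *\<^sub>R lie_derivative_metric X g c p)))"
proof -
  define D where "D = (\<chi> i k. Dv (X c) k p $ i)"
  define M where "M = H p ** S ** H p"
  have M: "transpose M = M" by (simp add: M_def matrix_transpose_mul inverse_metric_sym[OF p] S matrix_mul_assoc)
  have "(\<Sum>i\<in>UNIV. \<Sum>k\<in>UNIV. (H p ** S) $ i $ k * Dv (X c) i p $ k) = trace ((H p ** S) ** D)"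
    by (simp add: D_def trace_def matrix_mult_nth[of "H p ** S"])
  also have "(H p ** S) ** D = (H p ** S) ** (H p ** G p) ** D" by (simp add: HG[OF p])
  also have "\<dots> = M ** (G p ** D)" by (simp add: M_def matrix_mul_assoc)
  finally have 1: "(\<Sum>i\<in>UNIV. \<Sum>k\<in>UNIV. (H p ** S) $ i $ k * Dv (X c) i p $ k) = trace (M ** (G p ** D))" .
  have "trace (M ** transpose (G p ** D)) = trace (transpose ((G p ** D) ** M))"
    by (simp add: matrix_transpose_mul M)
  also have "\<dots> = trace (M ** (G p ** D))" by (simp only: trace_transpose) (rule trace_mul_sym)
  finally have "trace (M ** lie_derivative_metric X g c p) = 2 * trace (M ** (G p ** D))"
    unfolding lie_matrix[where X=X, OF p X] D_def[symmetric] by (simp add: matrix_mult.add_right trace_add)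
  then show ?thesis unfolding 1
    by (simp add: M_def matrix_mult.scaleR_right trace_scaleR matrix_mul_assoc)
qed

lemma trace_lie:
  assumes p: "p \<in> dom c" and X: "sm (X c)"
  shows "trace (H p ** ((1/2) *\<^sub>R lie_derivative_metric X g c p)) = divergence g X c p"
proof -
  define D where "D = (\<chi> i k. Dv (X c) k p $ i)"
  have "trace (H p ** transpose (G p ** D)) = trace (transpose ((G p ** D) ** H p))"
    by (simp add: matrix_transpose_mul inverse_metric_sym[OF p])
  also have "\<dots> = trace (H p ** (G p ** D))" by (simp only: trace_transpose) (rule trace_mul_sym)
  also have "\<dots> = trace D" by (simp add: matrix_mul_assoc HG[OF p])
  finally have t: "trace (H p ** transpose (G p ** D)) = trace D" .
  have "trace (H p ** lie_derivative_metric X g c p) = 2 * trace D"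
    unfolding lie_matrix[where X=X, OF p X] D_def[symmetric]
    by (simp add: matrix_mult.add_right trace_add t) (simp add: matrix_mul_assoc HG[OF p])
  moreover have "trace D = divergence g X c p"
    by (simp add: D_def trace_def divergence_eq_Dv[where Y=X, OF p X])
  ultimately show ?thesis by (simp add: matrix_mult.scaleR_right trace_scaleR)
qed

lemma Dv_cong:
  assumes "p \<in> dom c" "sm Y" "\<And>q. q \<in> dom c \<Longrightarrow> Y q = Z q"
  shows "Dv Y i p = Dv Z i p"
proof -
  have "pd c i Y p = pd c i Z p"
    by (rule pd_cong[OF assms(1)]) (use assms sm_imp_df in auto)
  then show ?thesis using assms(1,3) by (simp add: Dv_def)
qed

lemma lie_derivative_metric_add:
  assumes "p \<in> dom c" "sm (X c)" "sm (Y c)" "sm (Z c)" "\<And>q. q \<in> dom c \<Longrightarrow> X c q = Y c q + Z c q"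
  shows "lie_derivative_metric X g c p = lie_derivative_metric Y g c p + lie_derivative_metric Z g c p"
proof -
  have "Dv (X c) i p = Dv (Y c) i p + Dv (Z c) i p" for i
    using Dv_cong[OF assms(1,2), of "\<lambda>q. Y c q + Z c q"] assms Dv_add by simp
  then have "lie_derivative_metric X g c p $ i $ j = (lie_derivative_metric Y g c p + lie_derivative_metric Z g c p) $ i $ j" for i j
    by (simp add: matrix_vector_mult.add_right
        lie_derivative_metric_eq[where X=X, OF assms(1,2)]
        lie_derivative_metric_eq[where X=Y, OF assms(1,3)] lie_derivative_metric_eq[where X=Z, OF assms(1,4)])
  then show ?thesis by (simp only: vec_eq_iff) blast
qed

lemma scalar_curvature_trace:
  assumes "p \<in> dom c"
  shows "scalar_curvature g c p = trace (H p ** transpose (ricci g c p))"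
  by (simp add: scalar_curvature_def trace_def matrix_mult_nth transpose_nth)

text \<open>For such a metric the scalar curvature is n times \<open>mu\<close>, and the divergence
  of Ricci is the differential of \<open>mu\<close>. The contracted Bianchi identity then reads n
  d(mu) = 2 d(mu), and n differs from 2.\<close>

lemma schur:
  assumes p: "p \<in> dom c" and n: "CARD('n) \<ge> 3" and mu: "sm mu"
    and ein: "\<And>q. q \<in> dom c \<Longrightarrow> ricci g c q = mu q *\<^sub>R G q"
  shows "pd c m mu p = 0"
proof -
  have R: "H q ** transpose (ricci g c q) = mu q *\<^sub>R mat 1" if "q \<in> dom c" for q
  proof -
    have "transpose (ricci g c q) = mu q *\<^sub>R G q"
      by (simp add: ein[OF that] vec_eq_iff transpose_nth) (metis metric_sym[OF that] transpose_nth)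
    then show ?thesis by (simp add: matrix_mult.scaleR_right HG[OF that])
  qed
  have "pd c m (scalar_curvature g c) p = pd c m (\<lambda>q. mu q * real CARD('n)) p"
    by (rule pd_cong[OF p, symmetric])
       (auto simp: scalar_curvature_trace R trace_scaleR trace_mat_1 intro!: df_mult df_const sm_imp_df[OF mu p])
  also have "\<dots> = real CARD('n) * pd c m mu p"
    by (simp add: pd_mult[OF p sm_imp_df[OF mu p] df_const] pd_const)
  finally have 1: "pd c m (scalar_curvature g c) p = real CARD('n) * pd c m mu p" .
  have "endo_div (\<lambda>q. H q ** transpose (ricci g c q)) m p = endo_div (\<lambda>q. mu q *\<^sub>R mat 1) m p"
    by (rule endo_div_cong[OF p]) (auto simp: R intro!: sm_matrix_mult sm_inverse_metric sm_transpose sm_ricci)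
  then have "real CARD('n) * pd c m mu p = 2 * pd c m mu p"
    using contracted_second_bianchi[OF p, of m] 1 endo_div_scalar[OF p mu] by simp
  then show ?thesis using n by simp
qed

text \<open>Constant scalar curvature makes the divergence of \<open>P\<close> vanish, so only the
  contraction of \<open>P\<close> with the covariant derivative of \<open>X\<close> is left. The
  soliton equation turns half the Lie derivative into a multiple of the metric minus the traceless
  Ricci tensor; \<open>k\<close> is the constant that makes \<open>P\<close> traceless, so the
  multiple drops out.\<close>

lemma divergence_traceless_ricci:
  assumes p: "p \<in> dom c" and X: "sm (X c)"
    and sol: "\<And>q. q \<in> dom c \<Longrightarrow> ricci g c q + (1/2) *\<^sub>R lie_derivative_metric X g c q = lam q *\<^sub>R G q"
    and r: "\<And>q. q \<in> dom c \<Longrightarrow> scalar_curvature g c q = r"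
  defines "k \<equiv> r / real CARD('n)"
  defines "P \<equiv> \<lambda>q. H q ** (ricci g c q - k *\<^sub>R G q)"
  shows "(\<Sum>i\<in>UNIV. Dv (\<lambda>q. P q *v X c q) i p $ i) = - trace (P p ** P p)"
    and "transpose (ricci g c p - k *\<^sub>R G p) = ricci g c p - k *\<^sub>R G p"
proof -
  \<comment> \<open>The symmetry of Ricci is read off the soliton equation, whose other terms are
    symmetric.\<close>
  have ricsym: "transpose (ricci g c q) = ricci g c q" if "q \<in> dom c" for q
  proof -
    have "ricci g c q = lam q *\<^sub>R G q - (1/2) *\<^sub>R lie_derivative_metric X g c q"
      using sol[OF that] by (simp add: eq_diff_eq)
    then show ?thesis
      using metric_sym[OF that] lie_sym[where X=X, OF that X] by (simp add: transpose_diff transpose_scalar)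
  qed
  show S: "transpose (ricci g c p - k *\<^sub>R G p) = ricci g c p - k *\<^sub>R G p"
    using metric_sym[OF p] ricsym[OF p] by (simp add: transpose_diff transpose_scalar)
  have smP: "sm P" unfolding P_def
    by (intro sm_matrix_mult sm_diff sm_scaleR sm_const sm_metric sm_inverse_metric sm_ricci)
  have smR: "sm (\<lambda>q. H q ** transpose (ricci g c q))"
    by (intro sm_matrix_mult sm_inverse_metric sm_transpose sm_ricci)
  have smk: "sm (\<lambda>q. k *\<^sub>R mat 1 :: real ^ 'n ^ 'n)" by (rule sm_const)
  have P_eq: "P q = H q ** transpose (ricci g c q) - k *\<^sub>R mat 1" if "q \<in> dom c" for q
    by (simp add: P_def matrix_mult.diff_right matrix_mult.scaleR_right HG[OF that] ricsym[OF that])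
  have div0: "endo_div P m p = 0" for m
  proof -
    have "endo_div P m p = endo_div (\<lambda>q. H q ** transpose (ricci g c q) - k *\<^sub>R mat 1) m p"
      by (rule endo_div_cong[OF p smP P_eq])
    also have "\<dots> = endo_div (\<lambda>q. H q ** transpose (ricci g c q)) m p - endo_div (\<lambda>q. k *\<^sub>R mat 1) m p"
      by (rule endo_div_diff[OF p smR smk])
    also have "endo_div (\<lambda>q. k *\<^sub>R mat 1) m p = 0"
      using endo_div_scalar[OF p sm_const, of k m] by (simp add: pd_const)
    also have "2 * endo_div (\<lambda>q. H q ** transpose (ricci g c q)) m p = 0"
    proof -
      have "pd c m (\<lambda>q. r) p = pd c m (scalar_curvature g c) p"
        by (rule pd_cong[OF p]) (auto simp: r intro: df_const)
      then show ?thesis using contracted_second_bianchi[OF p, of m] by (simp add: pd_const)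
    qed
    then have "endo_div (\<lambda>q. H q ** transpose (ricci g c q)) m p = 0" by simp
    finally show ?thesis by simp
  qed
  have trP: "trace (P p) = 0"
    using p by (simp add: P_eq trace_sub scalar_curvature_trace[symmetric] r trace_scaleR trace_mat_1 k_def)
  have L: "(1/2) *\<^sub>R lie_derivative_metric X g c p = (lam p - k) *\<^sub>R G p - (ricci g c p - k *\<^sub>R G p)"
    using sol[OF p] by (simp add: algebra_simps eq_diff_eq)
  have "(\<Sum>i\<in>UNIV. Dv (\<lambda>q. P q *v X c q) i p $ i) = (\<Sum>i\<in>UNIV. \<Sum>k\<in>UNIV. P p $ i $ k * Dv (X c) i p $ k)"
    using trace_Dv_endo[OF p smP X] by (simp add: div0)
  also have "\<dots> = trace (P p ** (H p ** ((1/2) *\<^sub>R lie_derivative_metric X g c p)))"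
    using contract_Dv_lie[where X=X, OF p X S] by (simp add: P_def)
  also have "H p ** ((1/2) *\<^sub>R lie_derivative_metric X g c p) = (lam p - k) *\<^sub>R mat 1 - P p"
    unfolding L by (simp add: P_def matrix_mult.diff_right[of "H p" "(lam p - k) *\<^sub>R G p"]
        matrix_mult.scaleR_right HG[OF p])
  also have "trace (P p ** ((lam p - k) *\<^sub>R mat 1 - P p)) = - trace (P p ** P p)"
    by (simp add: matrix_mult.diff_right matrix_mult.scaleR_right trace_sub trace_scaleR trP)
  finally show "(\<Sum>i\<in>UNIV. Dv (\<lambda>q. P q *v X c q) i p $ i) = - trace (P p ** P p)" .
qed

text \<open>The coefficient \<open>f\<close> is a potential of \<open>- endo_div Q\<close>, so the term \<open>f Y\<close> cancels \<open>endo_div Q\<close>.\<close>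

lemma divergence_einstein_soliton:
  fixes h lam mu :: "'a \<Rightarrow> real"
  assumes p: "p \<in> dom c" and X: "sm (X c)" and Y: "sm (Y c)" and h: "sm h" and lam: "sm lam" and mu: "sm mu"
    and sol: "\<And>q. q \<in> dom c \<Longrightarrow> ricci g c q + (1/2) *\<^sub>R lie_derivative_metric X g c q = lam q *\<^sub>R G q"
    and ein: "\<And>q. q \<in> dom c \<Longrightarrow> ricci g c q = mu q *\<^sub>R G q"
    and dmu: "\<And>m. pd c m mu p = 0"
    and dec: "\<And>q. q \<in> dom c \<Longrightarrow> X c q = gradient g h c q + Y c q"
    and divY: "\<And>q. q \<in> dom c \<Longrightarrow> divergence g Y c q = 0"
  defines "Q \<equiv> \<lambda>q. H q ** ((1/2) *\<^sub>R lie_derivative_metric Y g c q)"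
  defines "f \<equiv> \<lambda>q. real (CARD('n) - 1) * (lam q - mu q) + mu q * h q"
  shows "(\<Sum>i\<in>UNIV. Dv (\<lambda>q. Q q *v Y c q + f q *\<^sub>R Y c q) i p $ i) = trace (Q p ** Q p)"
proof -
  let ?Z = "gradient g h"
  define rho where "rho q = lam q - mu q" for q
  define D where "D q = (\<chi> i k. Dv (?Z c) k q $ i)" for q
  have smZ: "sm (?Z c)" by (rule sm_gradient[OF h])
  have smrho: "sm rho" unfolding rho_def by (intro sm_diff lam mu)
  have smf: "sm f" unfolding f_def by (intro sm_add sm_mult sm_diff sm_const lam mu h)
  have smD: "sm D" unfolding D_def by (intro sm_vec) (auto intro!: sm_nth sm_Dv smZ)
  \<comment> \<open>The Lie derivative along the gradient part is twice the Hessian because the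
    Hessian is symmetric; \<open>D\<close> is the Hessian with one index raised.\<close>
  have Q_eq: "Q q = rho q *\<^sub>R mat 1 - D q" if q: "q \<in> dom c" for q
  proof -
    have "lie_derivative_metric X g c q = lie_derivative_metric ?Z g c q + lie_derivative_metric Y g c q"
      by (rule lie_derivative_metric_add[where X=X and Y="?Z" and Z=Y, OF q X smZ Y dec])
    moreover have "lie_derivative_metric ?Z g c q = 2 *\<^sub>R (G q ** D q)"
    proof -
      have "transpose (G q ** D q) = G q ** D q"
        using hessian_sym[OF q h] by (simp add: vec_eq_iff transpose_nth matrix_mult_nth D_def matrix_vector_mult_nth)
      then show ?thesis using lie_matrix[where X="?Z", OF q smZ] by (simp add: D_def scaleR_2)
    qed
    ultimately have e: "(1/2) *\<^sub>R lie_derivative_metric Y g c q = rho q *\<^sub>R G q - G q ** D q"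
      using sol[OF q] ein[OF q] by (simp add: rho_def algebra_simps)
    show ?thesis unfolding Q_def e
      by (simp add: matrix_mult.diff_right matrix_mult.scaleR_right HG[OF q] matrix_mul_assoc)
  qed
  have smQ: "sm Q"
    by (rule sm_cong[of "\<lambda>q. rho q *\<^sub>R mat 1 - D q"]) (auto simp: Q_eq intro!: sm_diff sm_scaleR smrho sm_const smD)
  have trD: "(\<Sum>i\<in>UNIV. Dv (?Z c) i q $ i) = real CARD('n) * rho q" if q: "q \<in> dom c" for q
  proof -
    have "trace (Q q) = 0" using trace_lie[where X=Y, OF q Y] divY[OF q] by (simp add: Q_def)
    then have "trace (D q) = real CARD('n) * rho q"
      by (simp add: Q_eq[OF q] trace_sub trace_scaleR trace_mat_1 mult.commute)
    then show ?thesis by (simp add: D_def trace_def)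
  qed
  have divQ: "endo_div Q k p = - pd c k f p" for k
  proof -
    have "endo_div Q k p = endo_div (\<lambda>q. rho q *\<^sub>R mat 1 - D q) k p"
      by (rule endo_div_cong[OF p smQ Q_eq])
    also have "\<dots> = pd c k rho p - endo_div D k p"
      by (subst endo_div_diff[OF p _ smD]) (auto simp: endo_div_scalar[OF p smrho] intro!: sm_scaleR smrho sm_const)
    also have "endo_div D k p = pd c k (\<lambda>q. \<Sum>i\<in>UNIV. Dv (?Z c) i q $ i) p + (ricci g c p *v ?Z c p) $ k"
      unfolding D_def by (rule ricci_identity[OF p smZ])
    also have "pd c k (\<lambda>q. \<Sum>i\<in>UNIV. Dv (?Z c) i q $ i) p = pd c k (\<lambda>q. real CARD('n) * rho q) p"
      by (rule pd_cong[OF p]) (auto simp: trD intro!: df_sum df_nth[OF sm_imp_df[OF sm_Dv[OF smZ] p]])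
    also have "\<dots> = real CARD('n) * pd c k rho p"
      by (simp add: pd_mult[OF p df_const sm_imp_df[OF smrho p]] pd_const)
    also have "(ricci g c p *v ?Z c p) $ k = mu p * pd c k h p"
      using lower_gradient[OF p, of h] by (simp add: ein[OF p] matrix_vector_mult.scaleR_left)
    finally have 1: "endo_div Q k p = pd c k rho p - (real CARD('n) * pd c k rho p + mu p * pd c k h p)" .
    have "pd c k f p = real (CARD('n) - 1) * pd c k rho p + mu p * pd c k h p"
      unfolding f_def rho_def[symmetric]
      using p by (simp add: pd_add pd_mult df_mult df_const sm_imp_df smrho mu h pd_const dmu)
    \<comment> \<open>Natural subtraction under \<open>real\<close>: an index type is nonempty, so
      nothing is truncated.\<close>
    moreover have "real (CARD('n) - 1) = real CARD('n) - 1" by (simp add: of_nat_diff)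
    ultimately show ?thesis using 1 by (simp add: algebra_simps)
  qed
  have S: "transpose ((1/2) *\<^sub>R lie_derivative_metric Y g c p) = (1/2) *\<^sub>R lie_derivative_metric Y g c p"
    using lie_sym[where X=Y, OF p Y] by (simp add: transpose_scalar)
  have "(\<Sum>i\<in>UNIV. Dv (\<lambda>q. Q q *v Y c q + f q *\<^sub>R Y c q) i p $ i) =
      (\<Sum>i\<in>UNIV. Dv (\<lambda>q. Q q *v Y c q) i p $ i) + (\<Sum>i\<in>UNIV. Dv (\<lambda>q. f q *\<^sub>R Y c q) i p $ i)"
    by (subst Dv_add[OF p]) (auto simp: sum.distrib intro!: sm_matrix_vector_mult sm_scaleR smQ smf Y)
  also have "(\<Sum>i\<in>UNIV. Dv (\<lambda>q. f q *\<^sub>R Y c q) i p $ i) = (\<Sum>i\<in>UNIV. pd c i f p * Y c p $ i)"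
    using trace_Dv_scaleR[OF p smf Y] divY[OF p] divergence_eq_Dv[where Y=Y, OF p Y] by simp
  also have "(\<Sum>i\<in>UNIV. Dv (\<lambda>q. Q q *v Y c q) i p $ i) =
      - (\<Sum>i\<in>UNIV. pd c i f p * Y c p $ i) + trace (Q p ** Q p)"
  proof -
    have "(\<Sum>i\<in>UNIV. \<Sum>k\<in>UNIV. Q p $ i $ k * Dv (Y c) i p $ k) = trace (Q p ** Q p)"
      unfolding Q_def by (rule contract_Dv_lie[where X=Y, OF p Y S])
    then show ?thesis using trace_Dv_endo[OF p smQ Y] by (simp add: divQ sum_negf)
  qed
  finally show ?thesis by simp
qed

end

section \<open>Integration on \<open>\<real>\<^sup>n\<close>\<close>

text \<open>Extending \<open>F\<close> and \<open>K\<close> by zero replaces integrals over sets by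
  integrals over the whole space with respect to \<open>lborel\<close>, the form in which cut-off
  functions are integrated later.\<close>

lemma change_of_variables_wellorder:
  fixes T :: "real ^ 'm::{finite,wellorder} \<Rightarrow> real ^ 'm::_" and F K :: "real ^ 'm::_ \<Rightarrow> real"
  assumes S: "open S" and T: "\<And>x. x \<in> S \<Longrightarrow> (T has_derivative T' x) (at x)" and inj: "inj_on T S"
    and F: "integrable lborel F" "\<And>y. y \<notin> T ` S \<Longrightarrow> F y = 0"
    and K: "K \<in> borel_measurable borel" "\<And>x. x \<in> S \<Longrightarrow> K x = \<bar>det (matrix (T' x))\<bar> * F (T x)"
      "\<And>x. x \<notin> S \<Longrightarrow> K x = 0"
  shows "integral\<^sup>L lborel K = integral\<^sup>L lborel F"
proof -
  have Fm: "F \<in> borel_measurable borel" using F(1) by auto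
  have Find: "(\<lambda>x. indicator (T ` S) x *\<^sub>R F x) = F"
  proof
    show "indicator (T ` S) x *\<^sub>R F x = F x" for x
      using F(2)[of x] by (cases "x \<in> T ` S") (auto simp: indicator_def)
  qed
  have FI: "F absolutely_integrable_on (T ` S)"
    unfolding set_integrable_def Find using F(1) Fm by (simp add: integrable_completion)
  \<comment> \<open>Values in \<open>real ^ 1\<close> fit the vector-valued form of the change of
    variables formula; component 1 leads back to the reals.\<close>
  define f where "f x = F x *\<^sub>R (1 :: real ^ 1)" for x
  define G where "G x = \<bar>det (matrix (T' x))\<bar> * F (T x)" for x
  have "f absolutely_integrable_on (T ` S)"
    using absolutely_integrable_linear[OF FI bounded_linear_scaleR_left[of "1 :: real ^ 1"]]
    by (simp add: f_def[abs_def] o_def)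
  then have gI: "(\<lambda>x. \<bar>det (matrix (T' x))\<bar> *\<^sub>R f (T x)) absolutely_integrable_on S"
      "integral S (\<lambda>x. \<bar>det (matrix (T' x))\<bar> *\<^sub>R f (T x)) = integral (T ` S) f"
    using has_absolute_integral_change_of_variables[of S T T' f "integral (T ` S) f"] S T inj
    by (auto intro: has_derivative_at_withinI)
  have GI: "G absolutely_integrable_on S"
    using absolutely_integrable_linear[OF gI(1) bounded_linear_vec_nth[of 1]]
    by (simp add: o_def f_def G_def[abs_def])
  have "integral S G = integral S (\<lambda>x. \<bar>det (matrix (T' x))\<bar> *\<^sub>R f (T x)) $ 1"
    using integral_component_eq_cart[of "\<lambda>x. \<bar>det (matrix (T' x))\<bar> *\<^sub>R f (T x)" S 1]
      set_lebesgue_integral_eq_integral(1)[OF gI(1)] by (simp add: f_def G_def[abs_def])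
  also have "\<dots> = integral (T ` S) F"
    unfolding gI(2)
    using integral_component_eq_cart[of f "T ` S" 1]
      set_lebesgue_integral_eq_integral(1)[OF \<open>f absolutely_integrable_on (T ` S)\<close>] by (simp add: f_def)
  finally have eq: "integral S G = integral (T ` S) F" .
  have Kind: "(\<lambda>x. indicator S x *\<^sub>R G x) = K"
  proof
    show "indicator S x *\<^sub>R G x = K x" for x
      using K(2,3)[of x] by (cases "x \<in> S") (auto simp: indicator_def G_def)
  qed
  have "integral\<^sup>L lborel K = integral\<^sup>L lebesgue K" using K(1) by (simp add: integral_completion)
  also have "\<dots> = integral S G"
    using set_lebesgue_integral_eq_integral(2)[OF GI] unfolding set_lebesgue_integral_def Kind .
  also have "\<dots> = integral\<^sup>L lebesgue F"
    using set_lebesgue_integral_eq_integral(2)[OF FI] unfolding eq set_lebesgue_integral_def Find by simp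
  also have "\<dots> = integral\<^sup>L lborel F" using Fm by (simp add: integral_completion)
  finally show ?thesis .
qed

text \<open>The library has the change of variables formula only for well-ordered index types, so it is
  transported along a copy of the index type that carries an arbitrary well-order.\<close>

typedef 'n ordered_copy = "UNIV :: 'n set"
  morphisms of_copy to_copy by simp

lemma bij_of_copy: "bij of_copy"
  by (rule bij_betw_byWitness[where f'=to_copy]) (auto simp: of_copy_inverse to_copy_inverse)

instance ordered_copy :: (finite) finite
  by standard (simp add: bij_betw_finite[OF bij_of_copy])

instantiation ordered_copy :: (finite) linorder
begin

definition copy_rank :: "'a ordered_copy \<Rightarrow> nat" where
  "copy_rank = (SOME f. inj f)"

definition less_eq_ordered_copy :: "'a ordered_copy \<Rightarrow> 'a ordered_copy \<Rightarrow> bool" where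
  "less_eq_ordered_copy x y \<longleftrightarrow> copy_rank x \<le> copy_rank y"

definition less_ordered_copy :: "'a ordered_copy \<Rightarrow> 'a ordered_copy \<Rightarrow> bool" where
  "less_ordered_copy x y \<longleftrightarrow> copy_rank x < copy_rank y"

lemma inj_copy_rank: "inj (copy_rank :: 'a ordered_copy \<Rightarrow> nat)"
proof -
  have "\<exists>f :: 'a ordered_copy \<Rightarrow> nat. inj f"
    using finite_imp_inj_to_nat_seg[of "UNIV :: 'a ordered_copy set"] by auto
  then show ?thesis unfolding copy_rank_def by (rule someI_ex)
qed

instance
proof
  fix x y z :: "'a ordered_copy"
  show "x \<le> y \<Longrightarrow> y \<le> x \<Longrightarrow> x = y"
    unfolding less_eq_ordered_copy_def using inj_copy_rank by (meson injD le_antisym)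
qed (auto simp: less_eq_ordered_copy_def less_ordered_copy_def)

end

instance ordered_copy :: (finite) wellorder
proof
  fix P :: "'a ordered_copy \<Rightarrow> bool" and a
  assume step: "\<And>x. (\<And>y. y < x \<Longrightarrow> P y) \<Longrightarrow> P x"
  show "P a"
  proof (induction a rule: measure_induct_rule[of copy_rank])
    case (less x)
    show ?case by (rule step) (simp add: less less_ordered_copy_def)
  qed
qed

section \<open>Lebesgue measure and determinants under a relabelling of coordinates\<close>

definition vec_to_copy :: "real ^ 'n \<Rightarrow> real ^ 'n ordered_copy" where
  "vec_to_copy x = (\<chi> i. x $ of_copy i)"

definition vec_of_copy :: "real ^ 'n ordered_copy \<Rightarrow> real ^ 'n" where
  "vec_of_copy x = (\<chi> i. x $ to_copy i)"

lemma vec_copy_inverse [simp]: "vec_of_copy (vec_to_copy x) = x" "vec_to_copy (vec_of_copy y) = y"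
  by (simp_all add: vec_of_copy_def vec_to_copy_def to_copy_inverse of_copy_inverse)

lemma bounded_linear_vec_of_copy: "bounded_linear (vec_of_copy :: real ^ 'n::finite ordered_copy \<Rightarrow> real ^ 'n)"
  by (rule linear_conv_bounded_linear[THEN iffD1]) (auto intro!: linearI simp: vec_of_copy_def vec_eq_iff)

lemma bounded_linear_vec_to_copy: "bounded_linear (vec_to_copy :: real ^ 'n::finite \<Rightarrow> real ^ 'n ordered_copy)"
  by (rule linear_conv_bounded_linear[THEN iffD1]) (auto intro!: linearI simp: vec_to_copy_def vec_eq_iff)

lemma measurable_vec_of_copy [measurable]: "(vec_of_copy :: real ^ 'n::finite ordered_copy \<Rightarrow> real ^ 'n) \<in> borel \<rightarrow>\<^sub>M borel"
  by (rule borel_measurable_continuous_onI[OF linear_continuous_on[OF bounded_linear_vec_of_copy]])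

lemma prod_Basis_cart: "(\<Prod>b\<in>Basis. f b) = (\<Prod>i\<in>UNIV. f (axis i (1::real) :: real ^ 'n))"
proof -
  have "(Basis :: (real ^ 'n) set) = range (\<lambda>i. axis i 1)" by (auto simp: Basis_vec_def)
  then show ?thesis
    using prod.reindex[of "\<lambda>i. axis i (1::real) :: real ^ 'n" UNIV f] by (simp add: inj_def axis_eq_axis)
qed

text \<open>Lebesgue measure is determined by its values on boxes, and relabelling the coordinates
  maps boxes to boxes with the same side lengths.\<close>

lemma lborel_distr_vec_of_copy:
  "distr lborel borel (vec_of_copy :: real ^ 'n::finite ordered_copy \<Rightarrow> real ^ 'n) = lborel"
proof (rule lborel_eqI[symmetric])
  fix l u :: "real ^ 'n"
  assume le: "\<And>b. b \<in> Basis \<Longrightarrow> l \<bullet> b \<le> u \<bullet> b"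
  have le': "l $ i \<le> u $ i" for i using le[of "axis i 1"] by (simp add: inner_axis axis_in_Basis_iff)
  have "vec_of_copy -` box l u = box (vec_to_copy l) (vec_to_copy u)"
  proof (intro set_eqI)
    fix x
    have "x \<in> box (vec_to_copy l) (vec_to_copy u) \<longleftrightarrow> (\<forall>i. l $ of_copy i < x $ i \<and> x $ i < u $ of_copy i)"
      by (simp add: mem_box_cart vec_to_copy_def)
    also have "\<dots> \<longleftrightarrow> (\<forall>i. l $ i < x $ to_copy i \<and> x $ to_copy i < u $ i)"
      by (metis of_copy_inverse to_copy_inverse UNIV_I)
    finally show "x \<in> vec_of_copy -` box l u \<longleftrightarrow> x \<in> box (vec_to_copy l) (vec_to_copy u)"
      by (simp add: mem_box_cart vec_of_copy_def)
  qed
  then have "emeasure (distr lborel borel vec_of_copy) (box l u) = emeasure lborel (box (vec_to_copy l) (vec_to_copy u))"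
    by (subst emeasure_distr) auto
  also have "\<dots> = (\<Prod>b\<in>Basis. (vec_to_copy u - vec_to_copy l) \<bullet> b)"
    by (rule emeasure_lborel_box) (auto simp: Basis_vec_def inner_axis vec_to_copy_def le')
  also have "(\<Prod>b\<in>Basis. (vec_to_copy u - vec_to_copy l) \<bullet> b) = (\<Prod>i\<in>UNIV. u $ of_copy i - l $ of_copy i)"
    by (simp add: prod_Basis_cart inner_axis vec_to_copy_def)
  also have "\<dots> = (\<Prod>i\<in>UNIV. u $ i - l $ i)"
    using prod.reindex_bij_betw[OF bij_of_copy, of "\<lambda>i. u $ i - l $ i"] by simp
  also have "\<dots> = (\<Prod>b\<in>Basis. (u - l) \<bullet> b)"
    by (simp add: prod_Basis_cart inner_axis)
  finally show "emeasure (distr lborel borel vec_of_copy) (box l u) = (\<Prod>b\<in>Basis. (u - l) \<bullet> b)" .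
qed simp

text \<open>Induction over transpositions: conjugation respects composition and turns a
  transposition into the transposition of the two preimages.\<close>

lemma sign_conjugate:
  fixes f :: "'m::finite \<Rightarrow> 'n::finite"
  assumes f: "bij f" and p: "p permutes (UNIV :: 'n set)"
  shows "sign (inv f \<circ> p \<circ> f) = sign p"
  using p finite_class.finite_UNIV
proof (induction p rule: permutes_induct)
  case id
  have "inv f \<circ> id \<circ> f = id" using f by (simp add: bij_is_inj)
  then show ?case by simp
next
  case (swap a b p)
  have bij_p: "bij p" using swap.hyps permutes_bij by blast
  have q: "(inv f \<circ> p \<circ> f) permutes UNIV"
    using f bij_p by (intro bij_imp_permutes) (auto intro!: bij_comp bij_imp_bij_inv)
  have "inv f \<circ> (Transposition.transpose a b \<circ> p) \<circ> f =
      Transposition.transpose (inv f a) (inv f b) \<circ> (inv f \<circ> p \<circ> f)"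
    using f by (auto simp: fun_eq_iff Transposition.transpose_def bij_is_surj surj_f_inv_f)
      (metis bij_inv_eq_iff)+
  moreover have "inv f a \<noteq> inv f b" using f swap.hyps by (metis bij_inv_eq_iff)
  moreover have "sign (Transposition.transpose a b \<circ> p) = sign (Transposition.transpose a b) * sign p"
    using permutes_imp_permutation[OF finite_class.finite_UNIV \<open>p permutes UNIV\<close>]
    by (intro sign_compose permutation_swap_id)
  moreover have "sign (Transposition.transpose (inv f a) (inv f b) \<circ> (inv f \<circ> p \<circ> f)) =
      sign (Transposition.transpose (inv f a) (inv f b)) * sign (inv f \<circ> p \<circ> f)"
    using permutes_imp_permutation[OF finite_class.finite_UNIV q]
    by (intro sign_compose permutation_swap_id)
  ultimately show ?case
    using \<open>a \<noteq> b\<close> by (simp only: sign_swap_id swap.IH if_False)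
qed

text \<open>Conjugation by \<open>f\<close> is a bijection between the permutations of the two index
  types, so it matches the Leibniz sums term by term, with equal signs.\<close>

lemma det_reindex:
  fixes M :: "'a::comm_ring_1 ^ 'n::finite ^ 'n" and f :: "'m::finite \<Rightarrow> 'n"
  assumes f: "bij f"
  shows "det (\<chi> i j. M $ f i $ f j) = det M"
proof -
  have bij: "bij_betw (\<lambda>p. inv f \<circ> p \<circ> f) {p. p permutes (UNIV :: 'n set)} {p. p permutes (UNIV :: 'm set)}"
  proof (rule bij_betw_byWitness[where f'="\<lambda>p. f \<circ> p \<circ> inv f"])
    have 1: "inv f (f x) = x" "f (inv f y) = y" for x y using f by (simp_all add: bij_is_inj bij_is_surj surj_f_inv_f)
    show "\<forall>p\<in>{p. p permutes UNIV}. f \<circ> (inv f \<circ> p \<circ> f) \<circ> inv f = p"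
      "\<forall>p\<in>{p. p permutes UNIV}. inv f \<circ> (f \<circ> p \<circ> inv f) \<circ> f = p"
      by (auto simp: fun_eq_iff 1)
    show "(\<lambda>p. inv f \<circ> p \<circ> f) ` {p. p permutes UNIV} \<subseteq> {p. p permutes UNIV}"
      "(\<lambda>p. f \<circ> p \<circ> inv f) ` {p. p permutes UNIV} \<subseteq> {p. p permutes UNIV}"
      using f by (auto intro!: bij_imp_permutes bij_comp bij_imp_bij_inv dest: permutes_bij)
  qed
  have "det (\<chi> i j. M $ f i $ f j) =
      (\<Sum>p\<in>{p. p permutes (UNIV :: 'm set)}. of_int (sign p) * (\<Prod>i\<in>UNIV. M $ f i $ f (p i)))"
    by (simp add: det_def)
  also have "\<dots> = (\<Sum>p\<in>{p. p permutes (UNIV :: 'n set)}. of_int (sign (inv f \<circ> p \<circ> f)) *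
      (\<Prod>i\<in>UNIV. M $ f i $ f ((inv f \<circ> p \<circ> f) i)))"
    using sum.reindex_bij_betw[OF bij, symmetric] .
  also have "\<dots> = (\<Sum>p\<in>{p. p permutes (UNIV :: 'n set)}. of_int (sign p) * (\<Prod>i\<in>UNIV. M $ i $ p i))"
  proof (rule sum.cong[OF refl])
    fix p assume "p \<in> {p. p permutes (UNIV :: 'n set)}"
    moreover have "(\<Prod>i\<in>UNIV. M $ f i $ f ((inv f \<circ> p \<circ> f) i)) = (\<Prod>i\<in>UNIV. M $ f i $ p (f i))"
      using f by (simp add: bij_is_surj surj_f_inv_f)
    moreover have "\<dots> = (\<Prod>i\<in>UNIV. M $ i $ p i)"
      using prod.reindex_bij_betw[OF f, of "\<lambda>i. M $ i $ p i"] .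
    ultimately show "of_int (sign (inv f \<circ> p \<circ> f)) * (\<Prod>i\<in>UNIV. M $ f i $ f ((inv f \<circ> p \<circ> f) i)) =
        of_int (sign p) * (\<Prod>i\<in>UNIV. M $ i $ p i)"
      by (simp add: sign_conjugate[OF f])
  qed
  finally show ?thesis by (simp add: det_def)
qed

lemma change_of_variables:
  fixes T :: "real ^ 'n \<Rightarrow> real ^ 'n" and F K :: "real ^ 'n \<Rightarrow> real"
  assumes S: "open S" and T: "\<And>x. x \<in> S \<Longrightarrow> (T has_derivative T' x) (at x)" and inj: "inj_on T S"
    and F: "integrable lborel F" "\<And>y. y \<notin> T ` S \<Longrightarrow> F y = 0"
    and K: "K \<in> borel_measurable borel" "\<And>x. x \<in> S \<Longrightarrow> K x = \<bar>det (matrix (T' x))\<bar> * F (T x)"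
      "\<And>x. x \<notin> S \<Longrightarrow> K x = 0"
  shows "integral\<^sup>L lborel K = integral\<^sup>L lborel F"
proof -
  let ?\<psi> = "vec_of_copy :: real ^ 'n ordered_copy \<Rightarrow> real ^ 'n" and ?\<phi> = "vec_to_copy :: real ^ 'n \<Rightarrow> real ^ 'n ordered_copy"
  have [measurable]: "F \<in> borel_measurable borel" using F(1) by auto
  note [measurable] = K(1)
  have "integral\<^sup>L lborel (\<lambda>x. K (?\<psi> x)) = integral\<^sup>L lborel (\<lambda>x. F (?\<psi> x))"
  proof (rule change_of_variables_wellorder[where S = "?\<psi> -` S" and T = "\<lambda>x. ?\<phi> (T (?\<psi> x))"
        and T' = "\<lambda>x v. ?\<phi> (T' (?\<psi> x) (?\<psi> v))"])
    show "open (?\<psi> -` S)"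
      using S by (intro open_vimage linear_continuous_on bounded_linear_vec_of_copy)
    show "((\<lambda>x. ?\<phi> (T (?\<psi> x))) has_derivative (\<lambda>v. ?\<phi> (T' (?\<psi> x) (?\<psi> v)))) (at x)"
      if "x \<in> ?\<psi> -` S" for x
    proof -
      have "(?\<psi> has_derivative ?\<psi>) (at x)"
        by (rule bounded_linear_imp_has_derivative[OF bounded_linear_vec_of_copy])
      then have "((\<lambda>x. T (?\<psi> x)) has_derivative (\<lambda>v. T' (?\<psi> x) (?\<psi> v))) (at x)"
        using T[of "?\<psi> x"] that by (auto intro: has_derivative_compose)
      then show ?thesis by (rule bounded_linear.has_derivative[OF bounded_linear_vec_to_copy])
    qed
    show "inj_on (\<lambda>x. ?\<phi> (T (?\<psi> x))) (?\<psi> -` S)"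
      using inj by (intro inj_onI) (metis inj_onD vec_copy_inverse vimageE)
    show "integrable lborel (\<lambda>x. F (?\<psi> x))"
      using F(1) integrable_distr_eq[of ?\<psi> lborel borel F] by (simp add: lborel_distr_vec_of_copy)
    show "F (?\<psi> y) = 0" if "y \<notin> (\<lambda>x. ?\<phi> (T (?\<psi> x))) ` (?\<psi> -` S)" for y
    proof (rule F(2))
      show "?\<psi> y \<notin> T ` S"
      proof
        assume "?\<psi> y \<in> T ` S"
        then obtain x where x: "x \<in> S" "?\<psi> y = T x" by blast
        have "y = ?\<phi> (T (?\<psi> (?\<phi> x)))"
          using arg_cong[OF x(2), of ?\<phi>] by simp
        moreover have "?\<phi> x \<in> ?\<psi> -` S" using x(1) by simp
        ultimately show False using that by blast
      qed
    qed
    show "K (?\<psi> x) = \<bar>det (matrix (\<lambda>v. ?\<phi> (T' (?\<psi> x) (?\<psi> v))))\<bar> * F (?\<psi> (?\<phi> (T (?\<psi> x))))"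
      if "x \<in> ?\<psi> -` S" for x
    proof -
      have "?\<psi> (axis j 1) = axis (of_copy j) 1" for j
        by (auto simp: vec_of_copy_def axis_def vec_eq_iff to_copy_inverse of_copy_inverse)
      then have "matrix (\<lambda>v. ?\<phi> (T' (?\<psi> x) (?\<psi> v))) = (\<chi> i j. matrix (T' (?\<psi> x)) $ of_copy i $ of_copy j)"
        by (simp add: matrix_def vec_to_copy_def)
      then show ?thesis using K(2) that by (simp add: det_reindex[OF bij_of_copy])
    qed
    show "(\<lambda>x. K (?\<psi> x)) \<in> borel_measurable borel" by measurable
    show "K (?\<psi> x) = 0" if "x \<notin> ?\<psi> -` S" for x using K(3) that by simp
  qed
  then show ?thesis
    using integral_distr[of ?\<psi> lborel borel F] integral_distr[of ?\<psi> lborel borel K]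
    by (simp add: lborel_distr_vec_of_copy)
qed

section \<open>Integrals of compactly supported functions\<close>

lemma integrable_continuous_compact_support:
  fixes F :: "'a::euclidean_space \<Rightarrow> real"
  assumes "continuous_on UNIV F" "compact K" "\<And>x. x \<notin> K \<Longrightarrow> F x = 0"
  shows "integrable lborel F"
proof -
  have "integrable lborel (\<lambda>x. indicator K x *\<^sub>R F x)"
    using assms by (intro borel_integrable_compact continuous_on_subset[OF assms(1)]) auto
  moreover have "(\<lambda>x. indicator K x *\<^sub>R F x) = F"
  proof
    show "indicator K x *\<^sub>R F x = F x" for x
      using assms(3)[of x] by (cases "x \<in> K") (auto simp: indicator_def)
  qed
  ultimately show ?thesis by simp
qed

text \<open>By translation invariance the difference quotients of \<open>F\<close> have integral zero.\<close>

lemma integral_derivative_compact_support: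
  fixes F :: "'a::euclidean_space \<Rightarrow> real"
  assumes F: "\<And>x. (F has_derivative D x) (at x)" and cont: "continuous_on UNIV (\<lambda>x. D x v)"
    and K: "compact K" "\<And>x. x \<notin> K \<Longrightarrow> F x = 0"
  shows "integral\<^sup>L lborel (\<lambda>x. D x v) = 0"
proof -
  have contF: "continuous_on UNIV F"
    using F by (auto intro!: continuous_at_imp_continuous_on has_derivative_continuous)
  have Fint: "integrable lborel F" by (rule integrable_continuous_compact_support[OF contF K])
  define h where "h n = 1 / real (Suc n)" for n
  have h: "0 < h n" "h n \<le> 1" for n by (auto simp: h_def)
  define q where "q n x = (F (h n *\<^sub>R v + x) - F x) / h n" for n x
  \<comment> \<open>\<open>K'\<close> holds every \<open>x\<close> such that \<open>x + t v\<close>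
    lies in \<open>K\<close> for some \<open>t\<close> between 0 and 1; since
    \<open>h n \<le> 1\<close>, all difference quotients vanish outside it.\<close>
  define K' where "K' = (\<lambda>(t, x). x - t *\<^sub>R v) ` ({0..1} \<times> K)"
  have K': "compact K'" unfolding K'_def
    by (intro compact_continuous_image compact_Times K(1)) (auto intro!: continuous_intros simp: case_prod_unfold)
  have outside: "F (t *\<^sub>R v + x) = 0" if "x \<notin> K'" "0 \<le> t" "t \<le> 1" for x t
  proof (rule K(2), rule notI)
    assume "t *\<^sub>R v + x \<in> K"
    then have "(t *\<^sub>R v + x) - t *\<^sub>R v \<in> K'" unfolding K'_def using that(2,3) by force
    then show False using that(1) by simp
  qed
  have line: "((\<lambda>t. F (t *\<^sub>R v + x)) has_real_derivative D (t *\<^sub>R v + x) v) (at t)" for t x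
  proof -
    have "((\<lambda>t. t *\<^sub>R v + x) has_derivative (\<lambda>t. t *\<^sub>R v)) (at t)"
      by (auto intro!: derivative_eq_intros)
    from has_derivative_compose[OF this F]
    have "((\<lambda>t. F (t *\<^sub>R v + x)) has_derivative (\<lambda>s. D (t *\<^sub>R v + x) (s *\<^sub>R v))) (at t)" .
    moreover have "D (t *\<^sub>R v + x) (s *\<^sub>R v) = D (t *\<^sub>R v + x) v * s" for s
      using linear_cmul[OF has_derivative_linear[OF F]] by simp
    ultimately show ?thesis by (simp add: has_field_derivative_def)
  qed
  \<comment> \<open>For a start in \<open>K'\<close> the mean value theorem evaluates the derivative
    at a point of \<open>K2\<close>; a bound on this compact set is uniform in \<open>n\<close> and
    provides the dominating function.\<close>
  define K2 where "K2 = (\<lambda>(t, x). t *\<^sub>R v + x) ` ({0..1} \<times> K')"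
  have "compact K2" unfolding K2_def
    by (intro compact_continuous_image compact_Times K') (auto intro!: continuous_intros simp: case_prod_unfold)
  then have "bounded ((\<lambda>x. D x v) ` K2)"
    by (intro compact_imp_bounded compact_continuous_image continuous_on_subset[OF cont]) auto
  then obtain M where M: "\<And>x. x \<in> K2 \<Longrightarrow> \<bar>D x v\<bar> \<le> M" unfolding bounded_iff by auto
  have bound: "norm (q n x) \<le> indicator K' x * M" for n x
  proof (cases "x \<in> K'")
    case False
    then show ?thesis using outside[of x "h n"] outside[of x 0] h[of n] by (simp add: q_def)
  next
    case True
    obtain t where t: "0 < t" "t < h n" "F (h n *\<^sub>R v + x) - F (0 *\<^sub>R v + x) = (h n - 0) * D (t *\<^sub>R v + x) v"
      using MVT2[OF h(1)[of n], of "\<lambda>t. F (t *\<^sub>R v + x)" "\<lambda>t. D (t *\<^sub>R v + x) v"] line by blast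
    have "t *\<^sub>R v + x \<in> K2" unfolding K2_def using t h(2)[of n] True by force
    moreover have "q n x = D (t *\<^sub>R v + x) v" using t h[of n] by (simp add: q_def)
    ultimately show ?thesis using M True by simp
  qed
  have lim: "(\<lambda>n. q n x) \<longlonglongrightarrow> D x v" for x
  proof -
    have "h \<longlonglongrightarrow> 0" unfolding h_def using LIMSEQ_inverse_real_of_nat by (simp add: inverse_eq_divide)
    then have "filterlim h (at 0) sequentially"
      using less_imp_neq[OF h(1)] by (auto simp: filterlim_at intro!: always_eventually)
    moreover have "((\<lambda>t. (F (t *\<^sub>R v + x) - F x) / t) \<longlongrightarrow> D x v) (at 0)"
      using line[of x 0] unfolding DERIV_def by simp
    ultimately show ?thesis unfolding q_def by (rule filterlim_compose[rotated])
  qed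
  have meas: "F \<in> borel_measurable borel" using contF by (rule borel_measurable_continuous_onI)
  have zero: "integral\<^sup>L lborel (q n) = 0" for n
  proof -
    have tr: "integrable lborel (\<lambda>x. F (h n *\<^sub>R v + x))"
      "integral\<^sup>L lborel (\<lambda>x. F (h n *\<^sub>R v + x)) = integral\<^sup>L lborel F"
      using integrable_distr_eq[of "(+) (h n *\<^sub>R v)" lborel borel F]
        integral_distr[of "(+) (h n *\<^sub>R v)" lborel borel F] Fint meas by (auto simp: lborel_distr_plus)
    then show ?thesis using Fint by (simp add: q_def[abs_def])
  qed
  have "(\<lambda>n. integral\<^sup>L lborel (q n)) \<longlonglongrightarrow> integral\<^sup>L lborel (\<lambda>x. D x v)"
  proof (rule integral_dominated_convergence[where w="\<lambda>x. indicator K' x * M"])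
    show "integrable lborel (\<lambda>x. indicator K' x * M)"
      using borel_integrable_compact[OF K', of "\<lambda>_. M"] by simp
    show "(\<lambda>x. D x v) \<in> borel_measurable lborel"
      using borel_measurable_continuous_onI[OF cont] by simp
    show "q n \<in> borel_measurable lborel" for n
      unfolding q_def[abs_def] using meas by measurable
  qed (use lim bound in auto)
  then show ?thesis unfolding zero by (simp add: LIMSEQ_const_iff)
qed

text \<open>Nonnegativity squeezes the integral over a box around \<open>x\<close> to zero, which
  leads to the statement for compact boxes.\<close>

lemma continuous_nonneg_integral_0_imp_0:
  fixes F :: "'a::euclidean_space \<Rightarrow> real"
  assumes cont: "continuous_on UNIV F" and int: "integrable lborel F" and nonneg: "\<And>x. F x \<ge> 0"
    and zero: "integral\<^sup>L lborel F = 0"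
  shows "F x = 0"
proof -
  have "(F has_integral 0) UNIV"
    using has_integral_integral_lborel[OF int] zero by simp
  then have "(F has_integral 0) (cbox (x - One) (x + One))"
    using has_integral_subset_le[of "cbox (x - One) (x + One)" UNIV F] nonneg
      integrable_on_subcbox[of F UNIV "x - One" "x + One"]
    by (metis (no_types, lifting) antisym has_integral_integrable has_integral_nonneg integrable_integral subset_UNIV)
  moreover have "x \<in> box (x - One) (x + One)" by (auto simp: mem_box inner_diff_left inner_add_left)
  ultimately show ?thesis
    using has_integral_0_cbox_imp_0[of "x - One" "x + One" F x] continuous_on_subset[OF cont] nonneg
    by (metis box_subset_cbox empty_iff subset_UNIV subsetD)
qed

section \<open>Volume density and change of chart\<close>

text \<open>A permutation other than the identity moves at least two indices, so in its Leibniz term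
  at the unit matrix a zero factor survives the differentiation of any single factor.\<close>

lemma has_derivative_det_mat_1:
  "(det has_derivative trace) (at (mat 1 :: real ^ 'n ^ 'n))"
proof -
  let ?P = "{p. p permutes (UNIV :: 'n set)}"
  let ?I = "mat 1 :: real ^ 'n ^ 'n"
  have D: "(det has_derivative (\<lambda>N. \<Sum>p\<in>?P. of_int (sign p) *
      (\<Sum>i\<in>UNIV. N $ i $ p i * (\<Prod>j\<in>UNIV - {i}. ?I $ j $ p j)))) (at ?I)"
    unfolding det_def[abs_def]
  proof (intro has_derivative_sum has_derivative_mult_right has_derivative_prod)
    show "((\<lambda>M. M $ i $ j) has_derivative (\<lambda>N. N $ i $ j)) (at ?I)" for i j
      by (intro bounded_linear_imp_has_derivative bounded_linear_compose[OF bounded_linear_vec_nth bounded_linear_vec_nth])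
  qed
  have "(\<Sum>i\<in>UNIV. N $ i $ p i * (\<Prod>j\<in>UNIV - {i}. ?I $ j $ p j)) = (if p = id then trace N else 0)"
    if p: "p permutes UNIV" for p and N :: "real ^ 'n ^ 'n"
  proof (cases "p = id")
    case True
    then show ?thesis by (simp add: trace_def mat_def)
  next
    case False
    have "(\<Prod>j\<in>UNIV - {i}. ?I $ j $ p j) = 0" for i
    proof -
      obtain a where a: "p a \<noteq> a" using False by (auto simp: fun_eq_iff)
      have pa: "p (p a) \<noteq> p a" using a permutes_inj[OF p] by (auto dest: injD)
      \<comment> \<open>An index moved by \<open>p\<close> and different from \<open>i\<close>: both
        \<open>a\<close> and \<open>p a\<close> are moved, and they are distinct.\<close>
      define j where "j = (if a = i then p a else a)"
      have "j \<noteq> i" "p j \<noteq> j" using a pa by (auto simp: j_def)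
      then have "?I $ j $ p j = 0" by (simp add: mat_def)
      then show ?thesis using \<open>j \<noteq> i\<close> by (intro prod_zero) auto
    qed
    then show ?thesis by (simp only: False mult_zero_right sum.neutral_const if_False)
  qed
  then have "(\<Sum>p\<in>?P. of_int (sign p) * (\<Sum>i\<in>UNIV. N $ i $ p i * (\<Prod>j\<in>UNIV - {i}. ?I $ j $ p j))) =
      (\<Sum>p\<in>?P. if p = id then trace N else 0)" for N :: "real ^ 'n ^ 'n"
    by (intro sum.cong) (auto simp: sign_id)
  also have "\<dots> N = trace N" for N
    by (simp add: permutes_id)
  finally show ?thesis using D by simp
qed

text \<open>Jacobi's formula, transported from the unit matrix by multiplicativity of the
  determinant.\<close>

lemma has_derivative_det:
  fixes M :: "real ^ 'n ^ 'n"
  assumes "invertible M"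
  shows "(det has_derivative (\<lambda>N. det M * trace (matrix_inv M ** N))) (at M)"
proof -
  note inv = matrix_inv_inverse[OF assms]
  have "((\<lambda>N. matrix_inv M ** N) has_derivative (\<lambda>N. matrix_inv M ** N)) (at M)"
    by (intro bounded_linear_imp_has_derivative matrix_mult.bounded_linear_right)
  moreover have "(det has_derivative trace) (at (matrix_inv M ** M))"
    unfolding inv by (rule has_derivative_det_mat_1)
  ultimately have "((\<lambda>N. det (matrix_inv M ** N)) has_derivative (\<lambda>N. trace (matrix_inv M ** N))) (at M)"
    by (rule has_derivative_compose)
  then have "((\<lambda>N. det M * det (matrix_inv M ** N)) has_derivative (\<lambda>N. det M * trace (matrix_inv M ** N))) (at M)"
    by (rule has_derivative_mult_right)
  moreover have "det M * det (matrix_inv M ** N) = det N" for N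
    using det_mul[of M "matrix_inv M ** N"] by (simp add: matrix_mul_assoc inv)
  ultimately show ?thesis by simp
qed

section \<open>The Riemannian volume density in a chart\<close>

context metric_chart
begin

definition dens :: "'a \<Rightarrow> real" where
  "dens q = sqrt (det (g c q))"

lemma det_metric_pos:
  assumes "p \<in> dom c"
  shows "det (G p) > 0"
proof -
  have "x \<bullet> (G p *v x) \<ge> 0" for x using metric_pos[OF assms, of x] by (cases "x = 0") auto
  then obtain V :: "real ^ 'n ^ 'n" where V: "G p = V ** transpose V"
    using psd_factorization[of UNIV "G p"] metric_sym[OF assms] by auto
  have "det (G p) = det V * det V" by (simp add: V det_mul det_transpose)
  moreover have "det (G p) \<noteq> 0"
    using positive_definite_invertible[OF metric_pos[OF assms]] by (simp add: invertible_det_nz)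
  ultimately show ?thesis by (simp add: zero_less_mult_iff) (metis linorder_neqE_linordered_idom)
qed

lemma dens_pos: "p \<in> dom c \<Longrightarrow> dens p > 0"
  by (simp add: dens_def det_metric_pos)

lemma sm_dens: "sm dens"
  unfolding dens_def
  by (intro sm_sqrt sm_det sm_nth[OF sm_nth[OF sm_metric]] det_metric_pos)

text \<open>Jacobi's formula and metric compatibility differentiate the determinant of the metric;
  applying the product rule to \<open>dens q * dens q\<close> then avoids differentiating the
  root.\<close>

lemma pd_dens:
  assumes p: "p \<in> dom c"
  shows "pd c i dens p = dens p * trace (Gam i p)"
proof -
  have inv: "invertible (G p)" by (rule positive_definite_invertible[OF metric_pos[OF p]])
  have inc: "in_coords c G (coord c p) = G p" by (rule in_coords_coord[OF p])
  have "(in_coords c (\<lambda>q. det (G q)) has_derivative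
      (\<lambda>v. det (G p) * trace (H p ** frechet_derivative (in_coords c G) (at (coord c p)) v))) (at (coord c p))"
    using has_derivative_compose[OF df_D[OF sm_imp_df[OF sm_metric p]], of det
        "\<lambda>N. det (G p) * trace (H p ** N)"] has_derivative_det[OF inv] inc
    by (simp add: in_coords_def o_def)
  from pd_eqI[OF this] have ddet: "pd c i (\<lambda>q. det (G q)) p = det (G p) * trace (H p ** pd c i G p)"
    by (simp add: pd_def)
  have t1: "trace (H p ** (transpose (Gam i p) ** G p)) = trace (Gam i p)"
  proof -
    have "trace (H p ** (transpose (Gam i p) ** G p)) = trace ((transpose (Gam i p) ** G p) ** H p)"
      by (rule trace_mul_sym)
    also have "\<dots> = trace (transpose (Gam i p) ** (G p ** H p))" by (simp only: matrix_mul_assoc)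
    finally show ?thesis by (simp add: GH[OF p] trace_transpose)
  qed
  have t2: "trace (H p ** (G p ** Gam i p)) = trace (Gam i p)"
    by (simp add: matrix_mul_assoc HG[OF p])
  have d2: "pd c i (\<lambda>q. det (G q)) p = 2 * det (G p) * trace (Gam i p)"
    by (simp add: ddet pd_metric[OF p] matrix_mult.add_right trace_add t1 t2)
  have "pd c i (\<lambda>q. dens q * dens q) p = pd c i (\<lambda>q. det (G q)) p"
    by (rule pd_cong[OF p _ df_mult[OF sm_imp_df[OF sm_dens p] sm_imp_df[OF sm_dens p]]])
       (simp add: dens_def less_imp_le[OF det_metric_pos])
  then have "2 * dens p * pd c i dens p = 2 * det (G p) * trace (Gam i p)"
    unfolding d2 using pd_mult[OF p sm_imp_df[OF sm_dens p] sm_imp_df[OF sm_dens p]] by simp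
  also have "det (G p) = dens p * dens p" using det_metric_pos[OF p] by (simp add: dens_def)
  finally show ?thesis using dens_pos[OF p] by simp
qed

text \<open>The classical formula for the divergence through the density, with a cutoff
  \<open>f\<close> inserted: the expression to be integrated becomes a sum of plain coordinate
  derivatives.\<close>

lemma dens_divergence:
  assumes p: "p \<in> dom c" and V: "sm (V c)" and f: "df f p"
  shows "(\<Sum>i\<in>UNIV. pd c i (\<lambda>q. f q * (dens q * V c q $ i)) p) =
    f p * divergence g V c p * dens p + dens p * (\<Sum>i\<in>UNIV. V c p $ i * pd c i f p)"
proof -
  have dV: "df (\<lambda>q. V c q $ i) p" for i by (rule df_nth[OF sm_imp_df[OF V p]])
  have dd: "df dens p" by (rule sm_imp_df[OF sm_dens p])
  have "pd c i (\<lambda>q. f q * (dens q * V c q $ i)) p =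
      f p * dens p * (pd c i (V c) p $ i + trace (Gam i p) * V c p $ i) + dens p * (V c p $ i * pd c i f p)" for i
    using pd_nth[OF sm_imp_df[OF V p], of i i]
    by (simp add: pd_mult[OF p] f dV dd df_mult pd_dens[OF p] algebra_simps)
  then have "(\<Sum>i\<in>UNIV. pd c i (\<lambda>q. f q * (dens q * V c q $ i)) p) =
      f p * dens p * ((\<Sum>i\<in>UNIV. pd c i (V c) p $ i) + (\<Sum>i\<in>UNIV. trace (Gam i p) * V c p $ i))
      + dens p * (\<Sum>i\<in>UNIV. V c p $ i * pd c i f p)"
    by (simp add: sum.distrib sum_distrib_left distrib_left)
  moreover have "(\<Sum>i\<in>UNIV. trace (Gam i p) * V c p $ i) = (\<Sum>i\<in>UNIV. \<Sum>j\<in>UNIV. Gam i p $ i $ j * V c p $ j)"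
    by (subst sum.swap) (simp add: trace_def sum_distrib_right Gam_sym[OF p])
  ultimately show ?thesis
    by (simp add: divergence_eq_Dv[where Y=V, OF p V] Dv_def sum.distrib matrix_vector_mult_nth)
qed

end

lemma lie_derivative_metric_matrix:
  fixes X :: "('a, 'n::finite) vfield"
  assumes "chart_patch c W" "chart_patch.df c (X c) p" "chart_patch.df c (g c) p"
  defines "DX \<equiv> \<chi> k i. pd c i (X c) p $ k"
  shows "lie_derivative_metric X g c p =
    (\<Sum>k\<in>UNIV. X c p $ k *\<^sub>R pd c k (g c) p) + transpose DX ** g c p + g c p ** DX"
proof -
  interpret chart_patch c W by fact
  have "pd c k (\<lambda>q. g c q $ i $ j) p = pd c k (g c) p $ i $ j" for i j k
    using assms(3) by (simp add: pd_nth df_nth)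
  moreover have "pd c i (\<lambda>q. X c q $ k) p = pd c i (X c) p $ k" for i k
    using assms(2) by (simp add: pd_nth)
  ultimately show ?thesis
    by (simp add: vec_eq_iff lie_derivative_metric_def matrix_mult_nth transpose_nth DX_def sum.distrib mult.commute)
qed

text \<open>Two charts on a common open set. The coordinates of \<open>d\<close> are smooth
  functions in the chart \<open>c\<close>, so regularity and derivatives are pulled back from
  \<open>d\<close> to \<open>c\<close>.\<close>

locale chart_pair = C: chart_patch c W + D: chart_patch d W
  for c d :: "('a, 'n::finite) chart" and W :: "'a set" +
  assumes trans: "C.sm (coord d)"
begin

abbreviation "J \<equiv> jacobian c d"

lemma in_coords_trans:
  "x \<in> coord c ` W \<Longrightarrow> in_coords c f x = in_coords d f (in_coords c (coord d) x)"
  using C.sub D.sub by (auto simp: C.in_coords_coord D.in_coords_coord subset_iff)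

lemma jacobian_nth: "p \<in> W \<Longrightarrow> J p $ a $ i = pd c i (coord d) p $ a"
  by (simp add: jacobian_def C.pd_nth C.sm_imp_df[OF trans])

lemma
  fixes f :: "'a \<Rightarrow> 'b::real_normed_vector"
  assumes p: "p \<in> W" and f: "D.df f p"
  shows df_trans: "C.df f p"
    and pd_trans: "pd c i f p = (\<Sum>a\<in>UNIV. J p $ a $ i *\<^sub>R pd d a f p)"
proof -
  let ?\<tau> = "in_coords c (coord d)"
  have pc: "p \<in> dom c" using p C.sub by auto
  have \<tau>: "?\<tau> (coord c p) = coord d p" by (rule C.in_coords_coord[OF pc])
  have "((\<lambda>x. in_coords d f (?\<tau> x)) has_derivative
      (\<lambda>v. frechet_derivative (in_coords d f) (at (coord d p)) (frechet_derivative ?\<tau> (at (coord c p)) v))) (at (coord c p))"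
    using has_derivative_compose[OF C.df_D[OF C.sm_imp_df[OF trans p]], of "in_coords d f"] D.df_D[OF f] \<tau> by simp
  then have D: "(in_coords c f has_derivative
      (\<lambda>v. frechet_derivative (in_coords d f) (at (coord d p)) (frechet_derivative ?\<tau> (at (coord c p)) v))) (at (coord c p))"
    by (rule has_derivative_transform_within_open[OF _ C.opn]) (use p in \<open>auto intro: in_coords_trans[symmetric]\<close>)
  then show "C.df f p" unfolding C.df_def differentiable_def by blast
  have "pd c i f p = frechet_derivative (in_coords d f) (at (coord d p)) (pd c i (coord d) p)"
    using C.pd_eqI[OF D] by (simp add: pd_def)
  also have "\<dots> = (\<Sum>a\<in>UNIV. J p $ a $ i *\<^sub>R pd d a f p)"
    using linear_sum_axis[OF has_derivative_linear[OF D.df_D[OF f]], of "pd c i (coord d) p"]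
    by (simp add: jacobian_nth[OF p] pd_def[of d])
  finally show "pd c i f p = (\<Sum>a\<in>UNIV. J p $ a $ i *\<^sub>R pd d a f p)" .
qed

lemma ck_trans:
  fixes f :: "'a \<Rightarrow> real"
  assumes "D.ck k f"
  shows "C.ck k f"
proof -
  have "diff_upto k (coord c ` W) (\<lambda>x. in_coords d f (in_coords c (coord d) x))"
  proof (rule diff_upto_compose[OF C.opn D.opn])
    show "diff_upto k (coord c ` W) (in_coords c (coord d))"
      using trans unfolding C.sm_iff_ck C.ck_def by blast
    have "in_coords c (coord d) (coord c q) = coord d q" if "q \<in> W" for q
      using C.sub that by (intro C.in_coords_coord) auto
    then show "in_coords c (coord d) ` coord c ` W \<subseteq> coord d ` W" by auto
    show "diff_upto k (coord d ` W) (in_coords d f)" using assms unfolding D.ck_def .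
  qed
  then show ?thesis unfolding C.ck_def
    by (rule diff_upto_cong[OF C.opn, rotated]) (rule in_coords_trans[symmetric])
qed

lemma sm_jacobian: "C.sm J"
  by (intro C.sm_vec) (auto simp: jacobian_def intro!: C.sm_pd C.sm_nth trans)

text \<open>These are second derivatives of the transition map. Their symmetry makes the Lie
  derivative tensorial although partial derivatives of components are not.\<close>

lemma pd_jacobian_sym:
  assumes "p \<in> W"
  shows "pd c i J p $ a $ k = pd c k J p $ a $ i"
proof -
  have "pd c i J p $ a $ k = pd c i (\<lambda>q. J q $ a $ k) p" for i k
    using C.sm_imp_df[OF sm_jacobian assms] by (simp add: C.pd_nth C.df_nth)
  then have "pd c i J p $ a $ k = pd c i (pd c k (\<lambda>q. coord d q $ a)) p" for i k
    by (simp add: jacobian_def)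
  moreover have "C.ck 2 (\<lambda>q. coord d q $ a)"
    using C.sm_nth[OF trans, of a] unfolding C.sm_iff_ck by blast
  ultimately show ?thesis
    using C.pd_commute[OF assms, of "\<lambda>q. coord d q $ a" i k] by simp
qed

text \<open>Differentiating the transformation laws of \<open>g\<close> and \<open>X\<close>
  produces \<open>Z\<close>, the derivative of the Jacobian along \<open>X\<close>. By
  \<open>pd_jacobian_sym\<close> the extra terms fit together as
  \<open>DXd ** J p = Z + J p ** DXc\<close>, and only tensorial terms remain.\<close>

lemma lie_derivative_metric_trans:
  fixes X :: "('a, 'n) vfield"
  assumes p: "p \<in> W"
    and gc: "C.sm (g c)" and gd: "D.sm (g d)" and Xc: "C.sm (X c)" and Xd: "D.sm (X d)"
    and g: "\<And>q. q \<in> W \<Longrightarrow> g c q = transpose (J q) ** g d q ** J q"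
    and X: "\<And>q. q \<in> W \<Longrightarrow> X d q = J q *v X c q"
  shows "lie_derivative_metric X g c p = transpose (J p) ** lie_derivative_metric X g d p ** J p"
proof -
  have pc: "p \<in> dom c" and pd: "p \<in> dom d" using p C.sub D.sub by auto
  have dgd: "D.df (g d) p" and dXd: "D.df (X d) p" by (intro D.sm_imp_df p gd Xd)+
  have dJ: "C.df J p" by (intro C.sm_imp_df p sm_jacobian)
  have dgc: "C.df (g c) p" and dXc: "C.df (X c) p" by (intro C.sm_imp_df p gc Xc)+
  define DXc where "DXc = (\<chi> k i. pd c i (X c) p $ k)"
  define DXd where "DXd = (\<chi> k i. pd d i (X d) p $ k)"
  define Z where "Z = (\<Sum>k\<in>UNIV. X c p $ k *\<^sub>R pd c k J p)"
  define E where "E = (\<Sum>a\<in>UNIV. X d p $ a *\<^sub>R pd d a (g d) p)"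
  have Lc: "lie_derivative_metric X g c p =
      (\<Sum>k\<in>UNIV. X c p $ k *\<^sub>R pd c k (g c) p) + transpose DXc ** g c p + g c p ** DXc"
    unfolding DXc_def by (rule lie_derivative_metric_matrix[where X=X and g=g, OF C.chart_patch_axioms dXc dgc])
  have Ld: "lie_derivative_metric X g d p = E + transpose DXd ** g d p + g d p ** DXd"
    unfolding DXd_def E_def by (rule lie_derivative_metric_matrix[where X=X and g=g, OF D.chart_patch_axioms dXd dgd])
  have dgk: "pd c k (g c) p = transpose (pd c k J p) ** g d p ** J p
      + transpose (J p) ** pd c k (g d) p ** J p + transpose (J p) ** g d p ** pd c k J p" for k
  proof -
    have "pd c k (g c) p = pd c k (\<lambda>q. transpose (J q) ** g d q ** J q) p"
      by (rule C.pd_cong[OF p]) (auto simp: g dgc)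
    then show ?thesis
      using df_trans[OF p dgd] dJ
      by (simp add: C.pd_matrix_mult[OF pc] C.df_matrix_mult C.df_transpose C.pd_transpose matrix_ring algebra_simps)
  qed
  have XJ: "(\<Sum>k\<in>UNIV. X c p $ k *\<^sub>R pd c k (g d) p) = E"
  proof -
    have "(\<Sum>k\<in>UNIV. X c p $ k *\<^sub>R pd c k (g d) p) =
        (\<Sum>k\<in>UNIV. \<Sum>a\<in>UNIV. (J p $ a $ k * X c p $ k) *\<^sub>R pd d a (g d) p)"
      by (simp add: pd_trans[OF p dgd] scaleR_sum_right mult.commute)
    also have "\<dots> = (\<Sum>a\<in>UNIV. \<Sum>k\<in>UNIV. (J p $ a $ k * X c p $ k) *\<^sub>R pd d a (g d) p)" by (rule sum.swap)
    also have "\<dots> = E" by (simp add: E_def X[OF p] matrix_vector_mult_nth scaleR_sum_left)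
    finally show ?thesis .
  qed
  have s1: "(\<Sum>k\<in>UNIV. X c p $ k *\<^sub>R pd c k (g c) p) =
      transpose Z ** g d p ** J p + transpose (J p) ** E ** J p + transpose (J p) ** g d p ** Z"
  proof -
    have t: "transpose Z = (\<Sum>k\<in>UNIV. X c p $ k *\<^sub>R transpose (pd c k J p))"
      by (simp add: Z_def vec_eq_iff transpose_nth)
    show ?thesis unfolding dgk t XJ[symmetric] unfolding Z_def
      by (simp add: scaleR_right_distrib sum.distrib matrix_mult.sum_left matrix_mult.sum_right
          matrix_mult.scaleR_left matrix_mult.scaleR_right)
  qed
  have DX: "DXd ** J p = Z + J p ** DXc"
  proof -
    have "(DXd ** J p) $ a $ i = (Z + J p ** DXc) $ a $ i" for a i
    proof -
      have "pd c i (X d) p = pd c i (\<lambda>q. J q *v X c q) p"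
        by (rule C.pd_cong[OF p]) (auto simp: X df_trans[OF p dXd])
      also have "\<dots> = J p *v pd c i (X c) p + pd c i J p *v X c p"
        by (rule C.pd_matrix_vector_mult[OF pc dJ dXc])
      finally have "(\<Sum>b\<in>UNIV. J p $ b $ i *\<^sub>R pd d b (X d) p) $ a = (J p *v pd c i (X c) p + pd c i J p *v X c p) $ a"
        using pd_trans[OF p dXd, of i] by simp
      then show ?thesis
        by (simp add: matrix_mult_nth matrix_vector_mult_nth DXd_def DXc_def Z_def pd_jacobian_sym[OF p, of i]
            mult.commute)
    qed
    then show ?thesis by (simp add: vec_eq_iff)
  qed
  have "lie_derivative_metric X g c p = transpose (Z + J p ** DXc) ** g d p ** J p + transpose (J p) ** E ** J p
      + transpose (J p) ** g d p ** (Z + J p ** DXc)"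
    unfolding Lc s1 g[OF p] by (simp add: matrix_ring algebra_simps)
  then show ?thesis unfolding DX[symmetric] Ld by (simp add: matrix_ring algebra_simps)
qed

lemma invertible_jacobian:
  assumes "g c p = transpose (J p) ** g d p ** J p" "invertible (g c p)"
  shows "invertible (J p)"
  using assms by (simp add: invertible_det_nz det_mul)

text \<open>The two sides agree after \<open>g d p\<close> and the transposed Jacobian are applied,
  and both matrices are invertible. \<open>L\<close> stands for any covariant 2-tensor.\<close>

lemma raised_lie_derivative_trans:
  fixes X :: "('a, 'n) vfield"
  assumes p: "p \<in> W"
    and g: "g c p = transpose (J p) ** g d p ** J p" "invertible (g c p)" "invertible (g d p)"
    and X: "X d p = J p *v X c p"
    and L: "L c p = transpose (J p) ** L d p ** J p"
  shows "matrix_inv (g d p) *v (L d p *v X d p) = J p *v (matrix_inv (g c p) *v (L c p *v X c p))"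
proof -
  let ?N = "matrix_inv (g c p) *v (L c p *v X c p)"
  have "transpose (J p) *v (g d p *v (J p *v ?N)) = g c p *v ?N"
    by (simp only: g(1) matrix_vector_mul_assoc matrix_mul_assoc)
  also have "\<dots> = L c p *v X c p"
    using matrix_inv_inverse[OF g(2)] by (simp add: matrix_vector_mul_assoc matrix_mul_assoc)
  also have "\<dots> = transpose (J p) *v (L d p *v X d p)"
    by (simp only: L X matrix_vector_mul_assoc matrix_mul_assoc)
  finally have "g d p *v (J p *v ?N) = L d p *v X d p"
    using inj_matrix_vector_mult[OF transpose_invertible[OF invertible_jacobian[where g=g, OF g(1,2)]]] by (meson injD)
  then have "matrix_inv (g d p) *v (g d p *v (J p *v ?N)) = matrix_inv (g d p) *v (L d p *v X d p)" by simp
  then show ?thesis using matrix_inv_inverse[OF g(3)] by (simp add: matrix_vector_mul_assoc matrix_mul_assoc)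
qed

end

section \<open>The divergence theorem\<close>

context chart_patch
begin

definition ext :: "('a \<Rightarrow> real) \<Rightarrow> real ^ 'n \<Rightarrow> real" where
  "ext u x = (if x \<in> coord c ` W then in_coords c u x else 0)"

text \<open>\<open>K\<close> only has to contain the support, so one \<open>K\<close> serves a
  function, its multiples by other functions and its derivatives.\<close>

definition supported :: "(real ^ 'n) set \<Rightarrow> ('a \<Rightarrow> real) \<Rightarrow> bool" where
  "supported K u \<longleftrightarrow> compact K \<and> K \<subseteq> coord c ` W \<and> (\<forall>q\<in>W. coord c q \<notin> K \<longrightarrow> u q = 0)"

lemma ext_coord: "q \<in> W \<Longrightarrow> ext u (coord c q) = u q"
  using sub by (auto simp: ext_def in_coords_coord)

lemma ext_outside: "supported K u \<Longrightarrow> x \<notin> K \<Longrightarrow> ext u x = 0"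
  using sub by (auto simp: ext_def supported_def in_coords_coord)

lemma ext_sum: "ext (\<lambda>q. \<Sum>i\<in>I. u i q) x = (\<Sum>i\<in>I. ext (u i) x)"
  by (simp add: ext_def in_coords_def)

text \<open>The coordinate image and the complement of \<open>K\<close> are open and cover the
  space; on the second the extension is zero.\<close>

lemma ext_continuous:
  assumes "supported K u" "ck k u"
  shows "continuous_on UNIV (ext u)"
proof -
  have K: "compact K" "K \<subseteq> coord c ` W" using assms by (auto simp: supported_def)
  have "continuous_on (coord c ` W) (ext u)"
    using ck_imp_continuous_on[OF assms(2)] by (rule continuous_on_eq) (simp add: ext_def)
  moreover have "continuous_on (- K) (ext u)"
    by (rule continuous_on_eq[OF continuous_on_const[of _ 0]]) (simp add: ext_outside[OF assms(1)])
  ultimately have "continuous_on (coord c ` W \<union> - K) (ext u)"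
    using opn K(1) by (intro continuous_on_open_Un) (auto intro: compact_imp_closed)
  moreover have "coord c ` W \<union> - K = UNIV" using K(2) by auto
  ultimately show ?thesis by simp
qed

lemma ext_integrable: "supported K u \<Longrightarrow> ck k u \<Longrightarrow> integrable lborel (ext u)"
  by (rule integrable_continuous_compact_support[of _ K]) 
     (auto intro: ext_continuous ext_outside simp: supported_def)

lemma integral_ext_sum:
  assumes "\<And>i. i \<in> I \<Longrightarrow> supported K (u i)" "\<And>i. i \<in> I \<Longrightarrow> ck k (u i)"
  shows "integral\<^sup>L lborel (ext (\<lambda>q. \<Sum>i\<in>I. u i q)) = (\<Sum>i\<in>I. integral\<^sup>L lborel (ext (u i)))"
proof -
  have "ext (\<lambda>q. \<Sum>i\<in>I. u i q) = (\<lambda>x. \<Sum>i\<in>I. ext (u i) x)" by (auto simp: ext_sum)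
  moreover have "integral\<^sup>L lborel (\<lambda>x. \<Sum>i\<in>I. ext (u i) x) = (\<Sum>i\<in>I. integral\<^sup>L lborel (ext (u i)))"
    by (rule Bochner_Integration.integral_sum) (rule ext_integrable[OF assms])
  ultimately show ?thesis by simp
qed

lemma integral_ext_add:
  assumes "supported K u" "ck k u" "supported K v" "ck k v"
  shows "integral\<^sup>L lborel (ext (\<lambda>q. u q + v q)) = integral\<^sup>L lborel (ext u) + integral\<^sup>L lborel (ext v)"
proof -
  have "ext (\<lambda>q. u q + v q) = (\<lambda>x. ext u x + ext v x)" by (auto simp: ext_def in_coords_def)
  moreover have "integral\<^sup>L lborel (\<lambda>x. ext u x + ext v x) = integral\<^sup>L lborel (ext u) + integral\<^sup>L lborel (ext v)"
    by (rule Bochner_Integration.integral_add) (rule ext_integrable[OF assms(1,2)] ext_integrable[OF assms(3,4)])+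
  ultimately show ?thesis by simp
qed

lemma ext_cong: "(\<And>q. q \<in> W \<Longrightarrow> u q = v q) \<Longrightarrow> ext u = ext v"
  using sub by (auto simp: fun_eq_iff ext_def in_coords_coord)

lemma supported_pd:
  assumes "supported K u"
  shows "supported K (pd c i u)"
proof -
  have K: "compact K" "K \<subseteq> coord c ` W" using assms by (auto simp: supported_def)
  have "pd c i u q = 0" if q: "q \<in> W" "coord c q \<notin> K" for q
  proof -
    have "(in_coords c u has_derivative (\<lambda>_. 0)) (at (coord c q))"
    proof (rule has_derivative_transform_within_open[of "\<lambda>_. 0" _ _ _ "coord c ` W - K"])
      show "open (coord c ` W - K)" using opn K(1) by (simp add: compact_imp_closed open_Diff)
      show "0 = in_coords c u x" if "x \<in> coord c ` W - K" for x
        using that assms sub by (auto simp: supported_def in_coords_coord)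
    qed (use q in auto)
    then show ?thesis using pd_eqI by fastforce
  qed
  then show ?thesis using K by (simp add: supported_def)
qed

lemma integral_ext_pd:
  assumes "supported K u" "ck 1 u"
  shows "integral\<^sup>L lborel (ext (pd c i u)) = 0"
proof -
  have K: "compact K" "K \<subseteq> coord c ` W" using assms by (auto simp: supported_def)
  have ck: "ck (Suc 0) u" using assms(2) by simp
  define D where "D x = (if x \<in> coord c ` W then frechet_derivative (in_coords c u) (at x) else (\<lambda>_. 0))" for x
  have D_eq: "(\<lambda>x. D x (axis i 1)) = ext (pd c i u)"
    using sub by (auto simp: fun_eq_iff D_def ext_def in_coords_coord pd_def)
  have "integral\<^sup>L lborel (\<lambda>x. D x (axis i 1)) = 0"
  proof (rule integral_derivative_compact_support[OF _ _ K(1)])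
    show "(ext u has_derivative D x) (at x)" for x
    proof (cases "x \<in> coord c ` W")
      case True
      have "(in_coords c u has_derivative D x) (at x)"
        using True diff_upto_SucD(1)[OF ck[unfolded ck_def]] by (simp add: D_def)
      then show ?thesis
        by (rule has_derivative_transform_within_open[OF _ opn True]) (simp add: ext_def)
    next
      case False
      have "((\<lambda>_. 0) has_derivative D x) (at x)" using False by (simp add: D_def)
      then show ?thesis
        by (rule has_derivative_transform_within_open[of _ _ _ _ "- K"])
           (use K False in \<open>auto simp: ext_outside[OF assms(1)] compact_imp_closed\<close>)
    qed
    show "continuous_on UNIV (\<lambda>x. D x (axis i 1))"
      unfolding D_eq by (rule ext_continuous[OF supported_pd[OF assms(1)] ck_pd[OF ck]])
  qed (rule ext_outside[OF assms(1)])
  then show ?thesis by (simp add: D_eq)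
qed

end

context chart_pair
begin

text \<open>The factor \<open>sqrt (det (g c q))\<close> absorbs the absolute Jacobian determinant
  of the transition map. Separate \<open>u\<close> and \<open>v\<close> allow integrands whose
  formula mentions the chart.\<close>

lemma integral_ext_trans:
  assumes mc: "\<And>q. q \<in> W \<Longrightarrow> g c q = transpose (J q) ** g d q ** J q"
    and Uc: "chart_patch c Uc" "W \<subseteq> Uc" and Ud: "chart_patch d Ud" "W \<subseteq> Ud"
    and c: "chart_patch.supported c Uc Kc (\<lambda>q. u q * sqrt (det (g c q)))" "chart_patch.ck c Uc 0 (\<lambda>q. u q * sqrt (det (g c q)))"
    and d: "chart_patch.supported d Ud Kd (\<lambda>q. v q * sqrt (det (g d q)))" "chart_patch.ck d Ud 0 (\<lambda>q. v q * sqrt (det (g d q)))"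
    and uv: "\<And>q. q \<in> W \<Longrightarrow> u q = v q" "\<And>q. q \<in> Uc - W \<Longrightarrow> u q = 0" "\<And>q. q \<in> Ud - W \<Longrightarrow> v q = 0"
  shows "integral\<^sup>L lborel (chart_patch.ext c Uc (\<lambda>q. u q * sqrt (det (g c q)))) =
    integral\<^sup>L lborel (chart_patch.ext d Ud (\<lambda>q. v q * sqrt (det (g d q))))"
proof -
  interpret Uc: chart_patch c Uc by (rule Uc(1))
  interpret Ud: chart_patch d Ud by (rule Ud(1))
  let ?\<tau> = "in_coords c (coord d)"
  have \<tau>: "?\<tau> (coord c q) = coord d q" if "q \<in> W" for q
    using that C.sub by (intro C.in_coords_coord) auto
  show ?thesis
  proof (rule change_of_variables[OF C.opn, where T="?\<tau>" and T'="\<lambda>x. frechet_derivative ?\<tau> (at x)"])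
    show "(?\<tau> has_derivative frechet_derivative ?\<tau> (at x)) (at x)" if "x \<in> coord c ` W" for x
      using that C.df_D[OF C.sm_imp_df[OF trans]] by auto
    show "inj_on ?\<tau> (coord c ` W)"
      using D.inj D.sub by (auto simp: inj_on_def \<tau> subset_iff)
    show "integrable lborel (Ud.ext (\<lambda>q. v q * sqrt (det (g d q))))"
      by (rule Ud.ext_integrable[OF d])
    show "Ud.ext (\<lambda>q. v q * sqrt (det (g d q))) y = 0" if "y \<notin> ?\<tau> ` coord c ` W" for y
    proof (cases "y \<in> coord d ` Ud")
      case True
      then obtain q where q: "q \<in> Ud" "y = coord d q" by auto
      then have "q \<notin> W" using that \<tau> by force
      then show ?thesis using q uv(3) by (simp add: Ud.ext_coord)
    qed (simp add: Ud.ext_def)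
    show "Uc.ext (\<lambda>q. u q * sqrt (det (g c q))) \<in> borel_measurable borel"
      by (rule borel_measurable_continuous_onI[OF Uc.ext_continuous[OF c]])
    show "Uc.ext (\<lambda>q. u q * sqrt (det (g c q))) x = 0" if "x \<notin> coord c ` W" for x
    proof (cases "x \<in> coord c ` Uc")
      case True
      then obtain q where q: "q \<in> Uc" "x = coord c q" by auto
      then have "q \<notin> W" using that by force
      then show ?thesis using q uv(2) by (simp add: Uc.ext_coord)
    qed (simp add: Uc.ext_def)
    show "Uc.ext (\<lambda>q. u q * sqrt (det (g c q))) x =
      \<bar>det (matrix (frechet_derivative ?\<tau> (at x)))\<bar> * Ud.ext (\<lambda>q. v q * sqrt (det (g d q))) (?\<tau> x)"
      if "x \<in> coord c ` W" for x
    proof -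
      obtain q where q: "q \<in> W" "x = coord c q" using \<open>x \<in> coord c ` W\<close> by blast
      have "matrix (frechet_derivative ?\<tau> (at x)) = J q"
        by (simp add: vec_eq_iff matrix_def jacobian_nth[OF q(1)] q(2) pd_def)
      moreover have "sqrt (det (g c q)) = \<bar>det (J q)\<bar> * sqrt (det (g d q))"
      proof -
        have "det (g c q) = (det (J q))\<^sup>2 * det (g d q)"
          by (simp add: mc[OF q(1)] det_mul det_transpose power2_eq_square)
        then show ?thesis by (simp add: real_sqrt_mult)
      qed
      ultimately show ?thesis
        using q uv(1) Uc(2) Ud(2) \<tau>[OF q(1)] by (auto simp: Uc.ext_coord Ud.ext_coord subset_iff)
    qed
  qed
qed

lemma directional_derivative_trans:
  fixes f :: "'a \<Rightarrow> real"
  assumes p: "p \<in> W" and f: "D.df f p" and X: "X d p = J p *v X c p"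
  shows "(\<Sum>i\<in>UNIV. X c p $ i * pd c i f p) = (\<Sum>i\<in>UNIV. X d p $ i * pd d i f p)"
proof -
  have "(\<Sum>i\<in>UNIV. X c p $ i * pd c i f p) = (\<Sum>i\<in>UNIV. \<Sum>a\<in>UNIV. J p $ a $ i * X c p $ i * pd d a f p)"
    by (simp add: pd_trans[OF p f] sum_distrib_left mult_ac)
  also have "\<dots> = (\<Sum>a\<in>UNIV. \<Sum>i\<in>UNIV. J p $ a $ i * X c p $ i * pd d a f p)" by (rule sum.swap)
  finally show ?thesis by (simp add: X matrix_vector_mult_nth sum_distrib_right)
qed

end

section \<open>Cutoff functions and finite covers\<close>

lemma chart_on_patch:
  assumes c: "chart_on T c" and W: "openin T W" "W \<subseteq> dom c"
  shows "chart_patch c W"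
proof
  have op: "openin T (dom c)" "open (coord c ` dom c)"
    and hom: "homeomorphic_map (subtopology T (dom c)) (top_of_set (coord c ` dom c)) (coord c)"
    using c by (auto simp: chart_on_def)
  have "topspace (subtopology T (dom c)) = dom c" using openin_subset[OF op(1)] by auto
  then show "inj_on (coord c) (dom c)" using homeomorphic_imp_injective_map[OF hom] by simp
  have "openin (subtopology T (dom c)) W" using W by (simp add: openin_open_subtopology op)
  then have "openin (top_of_set (coord c ` dom c)) (coord c ` W)"
    using homeomorphic_imp_open_map[OF hom] by (simp add: open_map_def)
  then show "open (coord c ` W)" using op(2) openin_open_eq by blast
qed (rule W(2))

text \<open>The inverse of the chart maps \<open>K\<close> to a compact set, which is closed in a
  Hausdorff space. Hence a function cut off in one chart vanishes near every point outside this set,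
  as seen from any chart.\<close>

lemma chart_on_compact_preimage:
  assumes c: "chart_on T c" and T: "Hausdorff_space T" and K: "compact K" "K \<subseteq> coord c ` dom c"
  shows "closedin T {q \<in> dom c. coord c q \<in> K}"
proof -
  have hom: "homeomorphic_map (subtopology T (dom c)) (top_of_set (coord c ` dom c)) (coord c)"
    and "openin T (dom c)" using c by (auto simp: chart_on_def)
  then have top: "topspace (subtopology T (dom c)) = dom c" using openin_subset by fastforce
  obtain h where h: "homeomorphic_maps (subtopology T (dom c)) (top_of_set (coord c ` dom c)) (coord c) h"
    using hom homeomorphic_map_maps by blast
  then have hc: "h (coord c q) = q" if "q \<in> dom c" for q
    using that top by (auto simp: homeomorphic_maps_def)
  have "compactin (top_of_set (coord c ` dom c)) K"
    using K by (simp add: compactin_subtopology)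
  then have "compactin (subtopology T (dom c)) (h ` K)"
    using h image_compactin unfolding homeomorphic_maps_def by blast
  then have "compactin T (h ` K)" by (simp add: compactin_subtopology)
  moreover have "h ` K = {q \<in> dom c. coord c q \<in> K}"
    using K(2) hc by force
  ultimately show ?thesis using T compactin_imp_closedin by metis
qed

lemma has_real_derivative_positive_part_square:
  "((\<lambda>t::real. (max 0 t)\<^sup>2) has_real_derivative 2 * max 0 t) (at t)"
proof -
  consider "t > 0" | "t < 0" | "t = 0" by linarith
  then show ?thesis
  proof cases
    case 1
    have "((\<lambda>t::real. t\<^sup>2) has_real_derivative 2 * max 0 t) (at t)"
      using 1 by (auto intro!: derivative_eq_intros)
    then show ?thesis
      by (rule has_field_derivative_transform_within_open[where S="{0<..}"]) (use 1 in auto)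
  next
    case 2
    have "((\<lambda>t::real. 0) has_real_derivative 2 * max 0 t) (at t)"
      using 2 by (auto intro!: derivative_eq_intros)
    then show ?thesis
      by (rule has_field_derivative_transform_within_open[where S="{..<0}"]) (use 2 in auto)
  next
    case 3
    have "((\<lambda>h::real. (max 0 h)\<^sup>2 / h) \<longlongrightarrow> 0) (at 0)"
    proof (rule Lim_null_comparison)
      show "\<forall>\<^sub>F h in at 0. norm ((max 0 h)\<^sup>2 / h) \<le> \<bar>h\<bar>"
        by (intro always_eventually allI) (auto simp: max_def power2_eq_square)
      show "((\<lambda>h::real. \<bar>h\<bar>) \<longlongrightarrow> 0) (at 0)" by (auto intro!: tendsto_eq_intros)
    qed
    then show ?thesis using 3 by (simp add: DERIV_def)
  qed
qed

text \<open>The squared positive part is C^1, and this much regularity is enough because only first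
  derivatives of a cutoff are integrated.\<close>

lemma diff_upto_bump:
  fixes x0 :: "'a::real_inner"
  shows "diff_upto (Suc 0) UNIV (\<lambda>x. (max 0 (r\<^sup>2 - (x - x0) \<bullet> (x - x0)))\<^sup>2)"
proof (rule diff_upto_SucI[where F="\<lambda>x v. 2 * max 0 (r\<^sup>2 - (x - x0) \<bullet> (x - x0)) * (- 2 * (v \<bullet> (x - x0)))"])
  show "((\<lambda>x. (max 0 (r\<^sup>2 - (x - x0) \<bullet> (x - x0)))\<^sup>2) has_derivative
      (\<lambda>v. 2 * max 0 (r\<^sup>2 - (x - x0) \<bullet> (x - x0)) * (- 2 * (v \<bullet> (x - x0))))) (at x)" for x
  proof -
    have "((\<lambda>x. r\<^sup>2 - (x - x0) \<bullet> (x - x0)) has_derivative (\<lambda>v. - 2 * (v \<bullet> (x - x0)))) (at x)"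
      by (auto intro!: derivative_eq_intros simp: inner_commute)
    from has_derivative_compose[OF this
        has_real_derivative_positive_part_square[unfolded has_field_derivative_def]]
    show ?thesis .
  qed
  show "diff_upto 0 UNIV (\<lambda>x. 2 * max 0 (r\<^sup>2 - (x - x0) \<bullet> (x - x0)) * (- 2 * (v \<bullet> (x - x0))))" for v
    by (auto intro!: continuous_intros)
qed simp

locale closed_riemannian_manifold =
  fixes T :: "'a topology" and A :: "('a, 'n::finite) chart set" and g :: "('a, 'n) tensor2"
  assumes man: "smooth_manifold T A" and met: "riemannian_metric A g" and comp: "compact_space T"
begin

lemma chart: "c \<in> A \<Longrightarrow> chart_on T c"
  using man by (simp add: smooth_manifold_def)

lemma dom_openin: "c \<in> A \<Longrightarrow> openin T (dom c)"
  using chart by (simp add: chart_on_def)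

lemma patch: "c \<in> A \<Longrightarrow> openin T W \<Longrightarrow> W \<subseteq> dom c \<Longrightarrow> chart_patch c W"
  using chart chart_on_patch by blast

lemma patch_dom: "c \<in> A \<Longrightarrow> chart_patch c (dom c)"
  using patch dom_openin by blast

lemma mchart: "c \<in> A \<Longrightarrow> metric_chart c g"
proof -
  assume c: "c \<in> A"
  interpret chart_patch c "dom c" by (rule patch_dom[OF c])
  show ?thesis
  proof
    show "sm (g c)" using met c unfolding riemannian_metric_def sm_def by blast
    show "transpose (g c p) = g c p" "v \<noteq> 0 \<Longrightarrow> v \<bullet> (g c p *v v) > 0" if "p \<in> dom c" for p v
      using met c that unfolding riemannian_metric_def by blast+
  qed
qed

lemma pair: "c \<in> A \<Longrightarrow> d \<in> A \<Longrightarrow> chart_pair c d (dom c \<inter> dom d)"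
proof -
  assume cd: "c \<in> A" "d \<in> A"
  interpret C: chart_patch c "dom c \<inter> dom d" using cd by (intro patch) (auto intro: dom_openin)
  interpret D: chart_patch d "dom c \<inter> dom d" using cd by (intro patch) (auto intro: dom_openin)
  show ?thesis using man cd
    by unfold_locales (auto simp: smooth_manifold_def smooth_compatible_def C.sm_def)
qed

lemma metric_trans:
  "c \<in> A \<Longrightarrow> d \<in> A \<Longrightarrow> p \<in> dom c \<Longrightarrow> p \<in> dom d \<Longrightarrow> g c p = transpose (jacobian c d p) ** g d p ** jacobian c d p"
  using met unfolding riemannian_metric_def by blast

definition C1 :: "('a \<Rightarrow> real) \<Rightarrow> bool" where
  "C1 u \<longleftrightarrow> (\<forall>c\<in>A. chart_patch.ck c (dom c) 1 u)"

text \<open>Unlike \<open>supported\<close>, this constrains all points and not only those of the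
  chart, so that other charts see where \<open>u\<close> vanishes.\<close>

definition chart_support :: "('a, 'n) chart \<Rightarrow> (real ^ 'n) set \<Rightarrow> ('a \<Rightarrow> real) \<Rightarrow> bool" where
  "chart_support c K u \<longleftrightarrow> compact K \<and> K \<subseteq> coord c ` dom c \<and> (\<forall>q. \<not> (q \<in> dom c \<and> coord c q \<in> K) \<longrightarrow> u q = 0)"

lemma bump:
  assumes c: "c \<in> A" and p: "p \<in> dom c"
  shows "\<exists>\<psi> K N. C1 \<psi> \<and> (\<forall>q. \<psi> q \<ge> 0) \<and> chart_support c K \<psi> \<and> openin T N \<and> p \<in> N \<and> (\<forall>q\<in>N. \<psi> q > 0)"
proof -
  interpret C: chart_patch c "dom c" by (rule patch_dom[OF c])
  define x0 where "x0 = coord c p"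
  obtain r where r: "r > 0" "cball x0 r \<subseteq> coord c ` dom c"
    using C.opn p open_contains_cball unfolding x0_def by blast
  define B where "B x = (max 0 (r\<^sup>2 - (x - x0) \<bullet> (x - x0)))\<^sup>2" for x
  have B_pos: "B x > 0" if "x \<in> ball x0 r" for x
  proof -
    have "(norm (x - x0))\<^sup>2 < r\<^sup>2" using that by (intro power_strict_mono) (auto simp: dist_norm norm_minus_commute)
    then show ?thesis by (simp add: B_def power2_norm_eq_inner max_def)
  qed
  have B_0: "B x = 0" if "x \<notin> cball x0 r" for x
  proof -
    have "r\<^sup>2 \<le> (norm (x - x0))\<^sup>2" using that r by (intro power_mono) (auto simp: dist_norm norm_minus_commute)
    then show ?thesis by (simp add: B_def power2_norm_eq_inner max_def)
  qed
  define \<psi> where "\<psi> q = (if q \<in> dom c then B (coord c q) else 0)" for q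
  let ?K = "cball x0 r"
  let ?Z = "{q \<in> dom c. coord c q \<in> ?K}"
  have Z: "closedin T ?Z"
    using man by (intro chart_on_compact_preimage chart c r) (auto simp: smooth_manifold_def)
  have sup: "chart_support c ?K \<psi>"
    unfolding chart_support_def using r(2) B_0 by (auto simp: \<psi>_def)
  have "C1 \<psi>"
    unfolding C1_def
  proof
    fix d assume d: "d \<in> A"
    interpret P: chart_pair d c "dom d \<inter> dom c" by (rule pair[OF d c])
    interpret Dd: chart_patch d "dom d" by (rule patch_dom[OF d])
    \<comment> \<open>The domain of \<open>d\<close> is covered by two open sets: the overlap, where
      the bump is a C^1 function of the coordinates of \<open>c\<close>, and the complement of the
      closed support, where it is zero.\<close>
    have op: "openin T (dom d - ?Z)" by (intro openin_diff dom_openin d Z)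
    interpret E: chart_patch d "dom d - ?Z" by (rule patch[OF d op]) auto
    have "P.D.ck 1 \<psi>"
    proof -
      have "diff_upto 1 (coord c ` (dom d \<inter> dom c)) B"
        using diff_upto_subset[OF diff_upto_bump[of r x0]] by (simp add: B_def[abs_def])
      then have "diff_upto 1 (coord c ` (dom d \<inter> dom c)) (in_coords c \<psi>)"
        by (rule diff_upto_cong[OF P.D.opn, rotated]) (auto simp: C.in_coords_coord \<psi>_def)
      then show ?thesis by (simp add: P.D.ck_def)
    qed
    then have "P.C.ck 1 \<psi>" by (rule P.ck_trans)
    moreover have "E.ck 1 \<psi>"
      by (rule E.ck_cong[OF _ E.ck_const[of _ 0]]) (auto simp: \<psi>_def B_0)
    ultimately have "diff_upto 1 (coord d ` (dom d \<inter> dom c) \<union> coord d ` (dom d - ?Z)) (in_coords d \<psi>)"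
      unfolding P.C.ck_def E.ck_def by (intro diff_upto_Un P.C.opn E.opn)
    moreover have "coord d ` (dom d \<inter> dom c) \<union> coord d ` (dom d - ?Z) = coord d ` dom d" by auto
    ultimately show "Dd.ck 1 \<psi>" by (simp add: Dd.ck_def)
  qed
  moreover have "\<psi> q \<ge> 0" for q by (simp add: \<psi>_def B_def)
  moreover have "openin T {q \<in> dom c. coord c q \<in> ball x0 r}"
  proof -
    have hom: "homeomorphic_map (subtopology T (dom c)) (top_of_set (coord c ` dom c)) (coord c)"
      using chart[OF c] by (simp add: chart_on_def)
    have "openin (subtopology T (dom c)) {q \<in> topspace (subtopology T (dom c)). coord c q \<in> coord c ` dom c \<inter> ball x0 r}"
      by (rule openin_continuous_map_preimage[OF homeomorphic_imp_continuous_map[OF hom]])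
         (auto simp: openin_open)
    moreover have "topspace (subtopology T (dom c)) = dom c"
      using openin_subset[OF dom_openin[OF c]] by auto
    moreover have "{q \<in> topspace (subtopology T (dom c)). coord c q \<in> coord c ` dom c \<inter> ball x0 r} =
        {q \<in> dom c. coord c q \<in> ball x0 r}" unfolding \<open>topspace _ = dom c\<close> by auto
    ultimately have "openin (subtopology T (dom c)) {q \<in> dom c. coord c q \<in> ball x0 r}" by (simp only:)
    then show ?thesis using openin_trans_full dom_openin[OF c] by blast
  qed
  moreover have "\<psi> q > 0" if "q \<in> dom c" "coord c q \<in> ball x0 r" for q
    using that B_pos by (simp add: \<psi>_def)
  ultimately show ?thesis
    using sup p r(1)
    by (intro exI[of _ \<psi>] exI[of _ ?K] exI[of _ "{q \<in> dom c. coord c q \<in> ball x0 r}"])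
       (auto simp: x0_def)
qed

lemma pd_outside_support:
  assumes c: "c \<in> A" and d: "d \<in> A" and sup: "chart_support c K u"
    and q: "q \<in> dom d" "\<not> (q \<in> dom c \<and> coord c q \<in> K)"
  shows "pd d i u q = 0"
proof -
  let ?Z = "{q \<in> dom c. coord c q \<in> K}"
  have "closedin T ?Z"
    using man sup by (intro chart_on_compact_preimage chart c) (auto simp: smooth_manifold_def chart_support_def)
  then have op: "openin T (dom d - ?Z)" by (intro openin_diff dom_openin d)
  interpret E: chart_patch d "dom d - ?Z" by (rule patch[OF d op]) auto
  have "pd d i (\<lambda>q. 0 :: real) q = pd d i u q"
    by (rule E.pd_cong) (use q sup in \<open>auto simp: chart_support_def intro: E.df_const\<close>)
  then show ?thesis by (simp add: E.pd_const)
qed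

end

context closed_riemannian_manifold
begin

lemma dom_subset: "c \<in> A \<Longrightarrow> dom c \<subseteq> topspace T"
  using dom_openin openin_subset by blast

text \<open>The bumps are indexed by points. \<open>p0\<close> is put into the index set with the
  prescribed chart \<open>c0\<close>, so that a conclusion can be read off at this point in this
  chart.\<close>

lemma finite_bump_cover:
  assumes c0: "c0 \<in> A" "p0 \<in> dom c0"
  shows "\<exists>F C \<psi> K. finite F \<and> p0 \<in> F \<and> C p0 = c0 \<and>
    (\<forall>a\<in>F. C a \<in> A \<and> C1 (\<psi> a) \<and> (\<forall>q. \<psi> a q \<ge> 0) \<and> chart_support (C a) (K a) (\<psi> a)) \<and>
    (\<forall>q\<in>topspace T. (\<Sum>a\<in>F. \<psi> a q) > 0) \<and> \<psi> p0 p0 > (0::real)"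
proof -
  have p0: "p0 \<in> topspace T" using dom_subset c0 by blast
  have "\<forall>p\<in>topspace T. \<exists>c. c \<in> A \<and> p \<in> dom c" using man by (auto simp: smooth_manifold_def)
  then obtain C' where C': "\<And>p. p \<in> topspace T \<Longrightarrow> C' p \<in> A \<and> p \<in> dom (C' p)" by metis
  define C where "C p = (if p = p0 then c0 else C' p)" for p
  have C: "C p \<in> A" "p \<in> dom (C p)" if "p \<in> topspace T" for p
    using C'[OF that] c0 by (auto simp: C_def)
  have "\<forall>p\<in>topspace T. \<exists>\<psi> K N. C1 \<psi> \<and> (\<forall>q. \<psi> q \<ge> 0) \<and> chart_support (C p) K \<psi> \<and> openin T N \<and> p \<in> N \<and> (\<forall>q\<in>N. \<psi> q > 0)"
    using bump C by blast
  then obtain \<psi> K N where B: "\<And>p. p \<in> topspace T \<Longrightarrow> C1 (\<psi> p) \<and> (\<forall>q. \<psi> p q \<ge> 0) \<and>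
      chart_support (C p) (K p) (\<psi> p) \<and> openin T (N p) \<and> p \<in> N p \<and> (\<forall>q\<in>N p. \<psi> p q > 0)"
    by metis
  have "\<Union>(N ` topspace T) = topspace T" using B openin_subset by fastforce
  then have "\<exists>\<F>. finite \<F> \<and> \<F> \<subseteq> N ` topspace T \<and> \<Union>\<F> = topspace T"
    using comp B unfolding compact_space by (metis (no_types, lifting) imageE)
  then obtain F0 where F0: "finite F0" "F0 \<subseteq> topspace T" "\<Union>(N ` F0) = topspace T"
    using finite_subset_image by metis
  define F where "F = insert p0 F0"
  have F: "finite F" "p0 \<in> F" "F \<subseteq> topspace T" using F0 p0 by (auto simp: F_def)
  have "(\<Sum>a\<in>F. \<psi> a q) > 0" if "q \<in> topspace T" for q
  proof -
    obtain a where a: "a \<in> F0" "q \<in> N a" using F0(3) \<open>q \<in> topspace T\<close> by blast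
    then have "\<psi> a q > 0" using B F0(2) by blast
    moreover have "a \<in> F" using a by (simp add: F_def)
    ultimately show ?thesis using B F by (intro sum_pos2[of F a]) auto
  qed
  moreover have "\<forall>a\<in>F. C a \<in> A \<and> C1 (\<psi> a) \<and> (\<forall>q. \<psi> a q \<ge> 0) \<and> chart_support (C a) (K a) (\<psi> a)"
    using B C F(3) by blast
  moreover have "C p0 = c0" "\<psi> p0 p0 > 0" using B[OF p0] by (auto simp: C_def)
  ultimately show ?thesis using F by blast
qed

text \<open>With a partition of unity \<open>\<phi>\<close> subordinate to charts, \<open>\<integral> \<phi>\<^sub>a div V = - \<integral> V(\<phi>\<^sub>a)\<close>; inserting \<open>\<Sum>\<^sub>b \<phi>\<^sub>b = 1\<close>
  and moving the terms \<open>\<phi>\<^sub>b V(\<phi>\<^sub>a)\<close> to the chart of \<open>b\<close>, the sum over \<open>a\<close> becomes \<open>V(1) = 0\<close>.\<close>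

theorem divergence_nonneg_imp_zero:
  assumes V: "smooth_vector_field A V"
    and nonneg: "\<And>c p. c \<in> A \<Longrightarrow> p \<in> dom c \<Longrightarrow> divergence g V c p \<ge> 0"
    and c0: "c0 \<in> A" "p0 \<in> dom c0"
  shows "divergence g V c0 p0 = 0"
proof -
  obtain F C \<psi> K where fin: "finite F" and p0: "p0 \<in> F" "C p0 = c0" "\<psi> p0 p0 > (0::real)"
    and F: "\<And>a. a \<in> F \<Longrightarrow> C a \<in> A" "\<And>a. a \<in> F \<Longrightarrow> C1 (\<psi> a)" "\<And>a q. a \<in> F \<Longrightarrow> \<psi> a q \<ge> 0"
      "\<And>a. a \<in> F \<Longrightarrow> chart_support (C a) (K a) (\<psi> a)"
    and S_pos: "\<And>q. q \<in> topspace T \<Longrightarrow> (\<Sum>a\<in>F. \<psi> a q) > 0"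
    using finite_bump_cover[OF c0] by metis
  define S where "S q = (\<Sum>a\<in>F. \<psi> a q)" for q
  \<comment> \<open>Normalization to a partition of unity; \<open>S\<close> is positive on every
    chart domain, so the quotient stays C^1.\<close>
  define \<phi> where "\<phi> a q = \<psi> a q / S q" for a q
  define w where "w c q = sqrt (det (g c q))" for c q
  define DV where "DV c f q = (\<Sum>i\<in>UNIV. V c q $ i * pd c i f q)" for c and f :: "'a \<Rightarrow> real" and q
  define E where "E c u = integral\<^sup>L lborel (chart_patch.ext c (dom c) u)" for c :: "('a, 'n) chart" and u
  have S: "S q > 0" if "q \<in> dom c" "c \<in> A" for q c
    using S_pos dom_subset that by (auto simp: S_def)
  have phi_C1: "chart_patch.ck c (dom c) 1 (\<phi> a)" if "a \<in> F" "c \<in> A" for a c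
  proof -
    interpret P: chart_patch c "dom c" by (rule patch_dom[OF that(2)])
    have psi: "P.ck 1 (\<psi> b)" if "b \<in> F" for b
      using F(2)[OF that] \<open>c \<in> A\<close> by (simp add: C1_def)
    have "P.ck 1 S" unfolding S_def[abs_def] by (intro P.ck_sum psi)
    then show ?thesis unfolding \<phi>_def[abs_def]
      using S[OF _ \<open>c \<in> A\<close>] by (intro P.ck_divide psi \<open>a \<in> F\<close>) (auto simp: less_imp_neq[symmetric])
  qed
  have phi_sup: "chart_support (C a) (K a) (\<phi> a)" if "a \<in> F" for a
    using F(4)[OF that] by (simp add: chart_support_def \<phi>_def)
  have phi_sum: "(\<Sum>a\<in>F. \<phi> a q) = 1" if "q \<in> dom c" "c \<in> A" for q c
    using S[OF that] by (simp add: \<phi>_def S_def sum_divide_distrib[symmetric])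
  have smV: "chart_patch.sm c (dom c) (V c)" if "c \<in> A" for c
  proof -
    interpret P: chart_patch c "dom c" by (rule patch_dom[OF that])
    show ?thesis using V that unfolding smooth_vector_field_def P.sm_def by blast
  qed
  have DV_ck: "chart_patch.ck c (dom c) 0 (DV c (\<phi> a))" if "a \<in> F" "c \<in> A" for a c
  proof -
    interpret P: chart_patch c "dom c" by (rule patch_dom[OF that(2)])
    have "P.ck 0 (pd c i (\<phi> a))" for i using P.ck_pd[of 0 "\<phi> a" i] phi_C1[OF that] by simp
    moreover have "P.ck 0 (\<lambda>q. V c q $ i)" for i
      using P.sm_nth[OF smV[OF that(2)], of i] unfolding P.sm_iff_ck by blast
    ultimately show ?thesis unfolding DV_def by (intro P.ck_sum P.ck_mult)
  qed
  have w_sm: "chart_patch.sm c (dom c) (w c)" if "c \<in> A" for c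
  proof -
    interpret M: metric_chart c g by (rule mchart[OF that])
    show ?thesis using M.sm_dens by (simp add: w_def[abs_def] M.dens_def[abs_def])
  qed
  have w_ck: "chart_patch.ck c (dom c) k (w c)" if "c \<in> A" for c k
  proof -
    interpret P: chart_patch c "dom c" by (rule patch_dom[OF that])
    show ?thesis using w_sm[OF that] unfolding P.sm_iff_ck by blast
  qed
  have w_pos: "w c q > 0" if "c \<in> A" "q \<in> dom c" for c q
  proof -
    interpret M: metric_chart c g by (rule mchart[OF that(1)])
    show ?thesis using M.dens_pos[OF that(2)] by (simp add: w_def M.dens_def)
  qed
  have DV_out: "DV c (\<phi> a) q = 0" if "a \<in> F" "c \<in> A" "q \<in> dom c" "\<not> (q \<in> dom (C a) \<and> coord (C a) q \<in> K a)" for a c q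
    using pd_outside_support[OF F(1)[OF that(1)] that(2) phi_sup[OF that(1)] that(3,4)] by (simp add: DV_def)
  define I where "I a = E (C a) (\<lambda>q. \<phi> a q * divergence g V (C a) q * w (C a) q)" for a
  have div_sm: "chart_patch.sm c (dom c) (divergence g V c)" if "c \<in> A" for c
  proof -
    interpret M: metric_chart c g by (rule mchart[OF that])
    have "M.sm (\<lambda>q. \<Sum>i\<in>UNIV. M.Dv (V c) i q $ i)" by (intro M.sm_sum M.sm_nth M.sm_Dv smV that)
    then show ?thesis
      by (rule M.sm_cong[rotated]) (simp add: M.divergence_eq_Dv[where Y=V] smV that)
  qed
  have I_ck: "chart_patch.ck (C a) (dom (C a)) 0 (\<lambda>q. \<phi> a q * divergence g V (C a) q * w (C a) q)"
    and I_sup: "chart_patch.supported (C a) (dom (C a)) (K a) (\<lambda>q. \<phi> a q * divergence g V (C a) q * w (C a) q)"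
    if a: "a \<in> F" for a
  proof -
    interpret P: chart_patch "C a" "dom (C a)" by (rule patch_dom[OF F(1)[OF a]])
    have "P.ck 0 (divergence g V (C a))" using div_sm[OF F(1)[OF a]] unfolding P.sm_iff_ck by blast
    moreover have "P.ck 0 (\<phi> a)" using P.ck_le[OF phi_C1[OF a F(1)[OF a]]] by simp
    ultimately show "P.ck 0 (\<lambda>q. \<phi> a q * divergence g V (C a) q * w (C a) q)"
      by (intro P.ck_mult w_ck F a)
    show "P.supported (K a) (\<lambda>q. \<phi> a q * divergence g V (C a) q * w (C a) q)"
      using phi_sup[OF a] by (auto simp: P.supported_def chart_support_def)
  qed
  \<comment> \<open>The integral of a compactly supported coordinate derivative is zero; by
    \<open>dens_divergence\<close> its integrand splits into the divergence term and the derivative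
    of \<open>\<phi> a\<close> along \<open>V\<close>.\<close>
  have parts: "I a = - E (C a) (\<lambda>q. DV (C a) (\<phi> a) q * w (C a) q)" if a: "a \<in> F" for a
  proof -
    let ?c = "C a"
    interpret M: metric_chart ?c g by (rule mchart[OF F(1)[OF a]])
    have dens: "M.dens = w ?c" by (simp add: fun_eq_iff M.dens_def w_def)
    define u where "u i q = \<phi> a q * (w ?c q * V ?c q $ i)" for i q
    have u_sup: "M.supported (K a) (u i)" for i
      using phi_sup[OF a] by (auto simp: M.supported_def chart_support_def u_def)
    have u_ck: "M.ck 1 (u i)" for i
    proof -
      have "M.ck 1 (\<lambda>q. V ?c q $ i)" using M.sm_nth[OF smV[OF F(1)[OF a]], of i] unfolding M.sm_iff_ck by blast
      then show ?thesis unfolding u_def[abs_def] by (intro M.ck_mult phi_C1 w_ck F a)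
    qed
    have pu_ck: "M.ck 0 (pd ?c i (u i))" for i using M.ck_pd[of 0 "u i" i] u_ck by simp
    have "0 = (\<Sum>i\<in>UNIV. E ?c (pd ?c i (u i)))"
      by (simp add: E_def M.integral_ext_pd[OF u_sup u_ck])
    also have "\<dots> = E ?c (\<lambda>q. \<Sum>i\<in>UNIV. pd ?c i (u i) q)"
      unfolding E_def by (rule M.integral_ext_sum[OF M.supported_pd[OF u_sup] pu_ck, symmetric])
    also have "\<dots> = E ?c (\<lambda>q. \<phi> a q * divergence g V ?c q * w ?c q + DV ?c (\<phi> a) q * w ?c q)"
      unfolding E_def
    proof (rule arg_cong[of _ _ "integral\<^sup>L lborel"], rule M.ext_cong)
      fix q assume q: "q \<in> dom ?c"
      have "M.df (\<phi> a) q" using M.ck_imp_df[of 0 "\<phi> a" q] phi_C1[OF a F(1)[OF a]] q by simp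
      from M.dens_divergence[where V=V, OF q smV[OF F(1)[OF a]] this]
      show "(\<Sum>i\<in>UNIV. pd ?c i (u i) q) = \<phi> a q * divergence g V ?c q * w ?c q + DV ?c (\<phi> a) q * w ?c q"
        by (simp add: u_def[abs_def] dens DV_def mult.commute)
    qed
    also have "\<dots> = I a + E ?c (\<lambda>q. DV ?c (\<phi> a) q * w ?c q)"
      unfolding E_def I_def
    proof (rule M.integral_ext_add[OF I_sup[OF a] I_ck[OF a]])
      show "M.supported (K a) (\<lambda>q. DV ?c (\<phi> a) q * w ?c q)"
        using phi_sup[OF a] DV_out[OF a F(1)[OF a]] by (auto simp: M.supported_def chart_support_def)
      show "M.ck 0 (\<lambda>q. DV ?c (\<phi> a) q * w ?c q)" by (intro M.ck_mult DV_ck w_ck F a)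
    qed
    finally show ?thesis by simp
  qed
  have term_ck: "chart_patch.ck c (dom c) 0 (\<lambda>q. \<phi> b q * DV c (\<phi> a) q * w c q)"
    if "a \<in> F" "b \<in> F" "c \<in> A" for a b c
  proof -
    interpret P: chart_patch c "dom c" by (rule patch_dom[OF that(3)])
    have "P.ck 0 (\<phi> b)" using P.ck_le[OF phi_C1[OF that(2,3)]] by simp
    then show ?thesis by (intro P.ck_mult DV_ck w_ck that)
  qed
  have sup_a: "chart_patch.supported (C a) (dom (C a)) (K a) (\<lambda>q. \<phi> b q * DV (C a) (\<phi> a) q * w (C a) q)"
    and sup_b: "chart_patch.supported (C b) (dom (C b)) (K b) (\<lambda>q. \<phi> b q * DV (C b) (\<phi> a) q * w (C b) q)"
    if ab: "a \<in> F" "b \<in> F" for a b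
  proof -
    interpret P: chart_patch "C a" "dom (C a)" by (rule patch_dom[OF F(1)[OF ab(1)]])
    interpret Q: chart_patch "C b" "dom (C b)" by (rule patch_dom[OF F(1)[OF ab(2)]])
    show "P.supported (K a) (\<lambda>q. \<phi> b q * DV (C a) (\<phi> a) q * w (C a) q)"
      using phi_sup[OF ab(1)] DV_out[OF ab(1) F(1)[OF ab(1)]] by (auto simp: P.supported_def chart_support_def)
    show "Q.supported (K b) (\<lambda>q. \<phi> b q * DV (C b) (\<phi> a) q * w (C b) q)"
      using phi_sup[OF ab(2)] by (auto simp: Q.supported_def chart_support_def)
  qed
  \<comment> \<open>\<open>\<phi> b\<close> confines the integrand to the chart of \<open>b\<close>,
    and the derivative of \<open>\<phi> a\<close> confines it to the chart of \<open>a\<close>; it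
    lives on the overlap, where both charts give the same integral.\<close>
  have move: "E (C a) (\<lambda>q. \<phi> b q * DV (C a) (\<phi> a) q * w (C a) q) = E (C b) (\<lambda>q. \<phi> b q * DV (C b) (\<phi> a) q * w (C b) q)"
    if ab: "a \<in> F" "b \<in> F" for a b
  proof -
    let ?c = "C a" and ?d = "C b"
    have cd: "?c \<in> A" "?d \<in> A" using F(1) ab by auto
    interpret P: chart_pair ?c ?d "dom ?c \<inter> dom ?d" by (rule pair[OF cd])
    interpret D: chart_patch ?d "dom ?d" by (rule patch_dom[OF cd(2)])
    show ?thesis
      unfolding E_def w_def
    proof (rule P.integral_ext_trans[OF _ patch_dom[OF cd(1)] Int_lower1 patch_dom[OF cd(2)] Int_lower2
          sup_a[OF ab, unfolded w_def] term_ck[OF ab cd(1), unfolded w_def]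
          sup_b[OF ab, unfolded w_def] term_ck[OF ab cd(2), unfolded w_def]])
      show "g ?c q = transpose (jacobian ?c ?d q) ** g ?d q ** jacobian ?c ?d q" if "q \<in> dom ?c \<inter> dom ?d" for q
        using metric_trans[OF cd] that by blast
      show "\<phi> b q * DV ?c (\<phi> a) q = \<phi> b q * DV ?d (\<phi> a) q" if "q \<in> dom ?c \<inter> dom ?d" for q
      proof -
        have "P.D.df (\<phi> a) q"
          using D.ck_imp_df[of 0 "\<phi> a" q] phi_C1[OF ab(1) cd(2)] that by simp
        moreover have "V ?d q = jacobian ?c ?d q *v V ?c q"
          using V cd that unfolding smooth_vector_field_def by blast
        ultimately show ?thesis
          using P.directional_derivative_trans[where X=V, OF that] by (simp add: DV_def)
      qed
      show "\<phi> b q * DV ?c (\<phi> a) q = 0" if "q \<in> dom ?c - dom ?c \<inter> dom ?d" for q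
        using phi_sup[OF ab(2)] that by (auto simp: chart_support_def)
      show "\<phi> b q * DV ?d (\<phi> a) q = 0" if "q \<in> dom ?d - dom ?c \<inter> dom ?d" for q
        using DV_out[OF ab(1) cd(2), of q] that by auto
    qed
  qed
  have expand: "E (C a) (\<lambda>q. DV (C a) (\<phi> a) q * w (C a) q) =
      (\<Sum>b\<in>F. E (C a) (\<lambda>q. \<phi> b q * DV (C a) (\<phi> a) q * w (C a) q))" if a: "a \<in> F" for a
  proof -
    interpret P: chart_patch "C a" "dom (C a)" by (rule patch_dom[OF F(1)[OF a]])
    have "E (C a) (\<lambda>q. DV (C a) (\<phi> a) q * w (C a) q) = E (C a) (\<lambda>q. \<Sum>b\<in>F. \<phi> b q * DV (C a) (\<phi> a) q * w (C a) q)"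
      unfolding E_def
      by (rule arg_cong[of _ _ "integral\<^sup>L lborel"], rule P.ext_cong)
         (simp add: sum_distrib_right[symmetric] phi_sum[OF _ F(1)[OF a]])
    then show ?thesis
      unfolding E_def using P.integral_ext_sum[OF sup_a[OF a] term_ck[OF a _ F(1)[OF a]], of F "\<lambda>b. b"] by simp
  qed
  have collapse: "(\<Sum>a\<in>F. E (C b) (\<lambda>q. \<phi> b q * DV (C b) (\<phi> a) q * w (C b) q)) = 0" if b: "b \<in> F" for b
  proof -
    interpret P: chart_patch "C b" "dom (C b)" by (rule patch_dom[OF F(1)[OF b]])
    have "(\<Sum>a\<in>F. E (C b) (\<lambda>q. \<phi> b q * DV (C b) (\<phi> a) q * w (C b) q)) =
        E (C b) (\<lambda>q. \<Sum>a\<in>F. \<phi> b q * DV (C b) (\<phi> a) q * w (C b) q)"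
      unfolding E_def using P.integral_ext_sum[OF sup_b[OF _ b] term_ck[OF _ b F(1)[OF b]], of F "\<lambda>a. a"] by simp
    also have "\<dots> = E (C b) (\<lambda>q. 0)"
      unfolding E_def
    proof (rule arg_cong[of _ _ "integral\<^sup>L lborel"], rule P.ext_cong)
      fix q assume q: "q \<in> dom (C b)"
      have df: "P.df (\<phi> a) q" if "a \<in> F" for a
        using P.ck_imp_df[of 0 "\<phi> a" q] phi_C1[OF that F(1)[OF b]] q by simp
      have "(\<Sum>a\<in>F. pd (C b) i (\<phi> a) q) = 0" for i
      proof -
        have "(\<Sum>a\<in>F. pd (C b) i (\<phi> a) q) = pd (C b) i (\<lambda>q. \<Sum>a\<in>F. \<phi> a q) q"
          by (rule P.pd_sum[symmetric]) (rule df)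
        also have "\<dots> = pd (C b) i (\<lambda>q. 1 :: real) q"
          by (rule P.pd_cong[OF q]) (auto simp: phi_sum[OF _ F(1)[OF b]] intro: P.df_sum df)
        finally show ?thesis by (simp add: P.pd_const)
      qed
      then have "(\<Sum>a\<in>F. DV (C b) (\<phi> a) q) = 0"
        unfolding DV_def by (subst sum.swap) (simp add: sum_distrib_left[symmetric])
      then show "(\<Sum>a\<in>F. \<phi> b q * DV (C b) (\<phi> a) q * w (C b) q) = 0"
        by (simp add: sum_distrib_left[symmetric] sum_distrib_right[symmetric])
    qed
    also have "\<dots> = 0"
    proof -
      have "P.ext (\<lambda>q. 0) = (\<lambda>x. 0)" by (simp add: fun_eq_iff P.ext_def in_coords_def)
      then show ?thesis by (simp add: E_def)
    qed
    finally show ?thesis .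
  qed
  have "(\<Sum>a\<in>F. I a) = - (\<Sum>a\<in>F. \<Sum>b\<in>F. E (C b) (\<lambda>q. \<phi> b q * DV (C b) (\<phi> a) q * w (C b) q))"
    by (simp add: parts expand sum_negf) (intro sum.cong refl move)
  also have "\<dots> = - (\<Sum>b\<in>F. \<Sum>a\<in>F. E (C b) (\<lambda>q. \<phi> b q * DV (C b) (\<phi> a) q * w (C b) q))"
    by (subst sum.swap) simp
  also have "\<dots> = 0" by (simp add: collapse)
  finally have I0: "(\<Sum>a\<in>F. I a) = 0" .
  have ext_nonneg: "chart_patch.ext (C a) (dom (C a)) (\<lambda>q. \<phi> a q * divergence g V (C a) q * w (C a) q) x \<ge> 0"
    if a: "a \<in> F" for a x
  proof -
    interpret P: chart_patch "C a" "dom (C a)" by (rule patch_dom[OF F(1)[OF a]])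
    have "\<phi> a q * divergence g V (C a) q * w (C a) q \<ge> 0" if q: "q \<in> dom (C a)" for q
      using F(3)[OF a, of q] S[OF q F(1)[OF a]] nonneg[OF F(1)[OF a] q] w_pos[OF F(1)[OF a] q]
      by (simp add: \<phi>_def)
    then show ?thesis by (cases "x \<in> coord (C a) ` dom (C a)") (auto simp: P.ext_def P.in_coords_coord)
  qed
  have "I a \<ge> 0" if "a \<in> F" for a
    unfolding I_def E_def using ext_nonneg[OF that] by (intro Bochner_Integration.integral_nonneg)
  \<comment> \<open>A vanishing sum of nonnegative terms. The integrand is continuous, so it
    vanishes pointwise, and at \<open>p0\<close> the weights \<open>\<phi> p0\<close> and
    \<open>w c0\<close> are positive.\<close>
  then have "I p0 = 0" using I0 fin p0(1) by (simp add: sum_nonneg_eq_0_iff)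
  interpret P: chart_patch "C p0" "dom (C p0)" by (rule patch_dom[OF F(1)[OF p0(1)]])
  have "P.ext (\<lambda>q. \<phi> p0 q * divergence g V (C p0) q * w (C p0) q) (coord (C p0) p0) = 0"
    using P.ext_continuous[OF I_sup[OF p0(1)] I_ck[OF p0(1)]] P.ext_integrable[OF I_sup[OF p0(1)] I_ck[OF p0(1)]]
      ext_nonneg[OF p0(1)] \<open>I p0 = 0\<close>[unfolded I_def E_def]
    by (rule continuous_nonneg_integral_0_imp_0)
  then have "\<phi> p0 p0 * divergence g V c0 p0 * w c0 p0 = 0"
    using p0(2) c0(2) P.ext_coord by simp
  moreover have "\<phi> p0 p0 \<noteq> 0" using p0(3) S[OF c0(2,1)] by (simp add: \<phi>_def)
  ultimately show ?thesis using w_pos[OF c0] by simp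
qed

end

section \<open>Almost Ricci solitons on compact manifolds\<close>

context metric_chart
begin

lemma sm_lie_derivative_metric:
  assumes "sm (X c)"
  shows "sm (lie_derivative_metric X g c)"
proof (intro sm_vec)
  fix i j
  have "sm (\<lambda>p. \<Sum>k\<in>UNIV. X c p $ k * pd c k (\<lambda>q. g c q $ i $ j) p
      + g c p $ k $ j * pd c i (\<lambda>q. X c q $ k) p + g c p $ i $ k * pd c j (\<lambda>q. X c q $ k) p)"
    by (intro sm_sum sm_add sm_mult sm_pd sm_nth assms sm_metric)
  then show "sm (\<lambda>q. lie_derivative_metric X g c q $ i $ j)"
    by (simp add: lie_derivative_metric_def)
qed

end

lemma smooth_on_subset: "smooth_on S f \<Longrightarrow> U \<subseteq> S \<Longrightarrow> smooth_on U f"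
  unfolding smooth_on_def using diff_upto_subset by blast

section \<open>Global vector fields and the two vanishing arguments\<close>

context closed_riemannian_manifold
begin

lemma vector_field_sm:
  assumes "smooth_vector_field A Z" "c \<in> A"
  shows "chart_patch.sm c (dom c) (Z c)"
proof -
  interpret P: chart_patch c "dom c" by (rule patch_dom[OF assms(2)])
  show ?thesis using assms unfolding smooth_vector_field_def P.sm_def by blast
qed

lemma function_sm:
  assumes "smooth_function A f" "c \<in> A"
  shows "chart_patch.sm c (dom c) f"
proof -
  interpret P: chart_patch c "dom c" by (rule patch_dom[OF assms(2)])
  show ?thesis using assms unfolding smooth_function_def P.sm_def by blast
qed

lemma lie_derivative_metric_transforms:
  assumes Z: "smooth_vector_field A Z" and cd: "c \<in> A" "d \<in> A" and p: "p \<in> dom c" "p \<in> dom d"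
  shows "lie_derivative_metric Z g c p = transpose (jacobian c d p) ** lie_derivative_metric Z g d p ** jacobian c d p"
proof -
  interpret P: chart_pair c d "dom c \<inter> dom d" by (rule pair[OF cd])
  have sub: "coord c ` (dom c \<inter> dom d) \<subseteq> coord c ` dom c" "coord d ` (dom c \<inter> dom d) \<subseteq> coord d ` dom d" by auto
  have g: "smooth_on (coord c ` dom c) (in_coords c (g c))" if "c \<in> A" for c
    using met that unfolding riemannian_metric_def by blast
  have Zs: "smooth_on (coord c ` dom c) (in_coords c (Z c))" if "c \<in> A" for c
    using Z that unfolding smooth_vector_field_def by blast
  show ?thesis
  proof (rule P.lie_derivative_metric_trans)
    show "p \<in> dom c \<inter> dom d" using p by simp
    show "P.C.sm (g c)" "P.D.sm (g d)" "P.C.sm (Z c)" "P.D.sm (Z d)"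
      unfolding P.C.sm_def P.D.sm_def using g Zs cd sub smooth_on_subset by metis+
    show "g c q = transpose (jacobian c d q) ** g d q ** jacobian c d q" if "q \<in> dom c \<inter> dom d" for q
      using metric_trans[OF cd] that by blast
    show "Z d q = jacobian c d q *v Z c q" if "q \<in> dom c \<inter> dom d" for q
      using Z cd that unfolding smooth_vector_field_def by blast
  qed
qed

text \<open>Supplies the fields to which the divergence theorem is applied; \<open>L\<close> will be
  the traceless Ricci tensor or half the Lie derivative of the metric.\<close>

lemma smooth_vector_field_raise:
  assumes Z: "smooth_vector_field A Z" and L: "\<And>c. c \<in> A \<Longrightarrow> chart_patch.sm c (dom c) (L c)"
    and tr: "\<And>c d p. c \<in> A \<Longrightarrow> d \<in> A \<Longrightarrow> p \<in> dom c \<Longrightarrow> p \<in> dom d \<Longrightarrow>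
      L c p = transpose (jacobian c d p) ** L d p ** jacobian c d p"
  shows "smooth_vector_field A (\<lambda>c p. matrix_inv (g c p) *v (L c p *v Z c p))"
  unfolding smooth_vector_field_def
proof (intro conjI ballI)
  fix c assume c: "c \<in> A"
  interpret M: metric_chart c g by (rule mchart[OF c])
  have "M.sm (\<lambda>p. matrix_inv (g c p) *v (L c p *v Z c p))"
    by (intro M.sm_matrix_vector_mult M.sm_inverse_metric L c vector_field_sm Z)
  then show "smooth_on (coord c ` dom c) (in_coords c (\<lambda>p. matrix_inv (g c p) *v (L c p *v Z c p)))"
    by (simp add: M.sm_def)
next
  fix c d p assume cd: "c \<in> A" "d \<in> A" and p: "p \<in> dom c \<inter> dom d"
  interpret P: chart_pair c d "dom c \<inter> dom d" by (rule pair[OF cd])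
  have inv: "invertible (g c p)" if "c \<in> A" "p \<in> dom c" for c
    using positive_definite_invertible[OF metric_chart.metric_pos[OF mchart[OF that(1)] that(2)]] .
  have "Z d p = jacobian c d p *v Z c p"
    using Z cd p unfolding smooth_vector_field_def by blast
  with p cd show "matrix_inv (g d p) *v (L d p *v Z d p) = jacobian c d p *v (matrix_inv (g c p) *v (L c p *v Z c p))"
    by (intro P.raised_lie_derivative_trans[where X=Z and L=L and g=g] metric_trans tr inv) auto
qed

lemma smooth_vector_field_add_scaleR:
  assumes Y: "smooth_vector_field A Y" and Z: "smooth_vector_field A Z" and f: "smooth_function A f" and h: "smooth_function A h"
  shows "smooth_vector_field A (\<lambda>c p. h p *\<^sub>R Y c p + f p *\<^sub>R Z c p)"
  unfolding smooth_vector_field_def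
proof (intro conjI ballI)
  fix c assume c: "c \<in> A"
  interpret P: chart_patch c "dom c" by (rule patch_dom[OF c])
  have "P.sm (\<lambda>p. h p *\<^sub>R Y c p + f p *\<^sub>R Z c p)"
    by (intro P.sm_add P.sm_scaleR vector_field_sm function_sm assms c)
  then show "smooth_on (coord c ` dom c) (in_coords c (\<lambda>p. h p *\<^sub>R Y c p + f p *\<^sub>R Z c p))"
    by (simp add: P.sm_def)
next
  fix c d p assume "c \<in> A" "d \<in> A" "p \<in> dom c \<inter> dom d"
  then have "Y d p = jacobian c d p *v Y c p" "Z d p = jacobian c d p *v Z c p"
    using Y Z unfolding smooth_vector_field_def by blast+
  then show "h p *\<^sub>R Y d p + f p *\<^sub>R Z d p = jacobian c d p *v (h p *\<^sub>R Y c p + f p *\<^sub>R Z c p)"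
    by (simp add: matrix_vector_mult.add_right matrix_vector_mult.scaleR_right)
qed

lemma smooth_function_const: "smooth_function A (\<lambda>q. a)"
  unfolding smooth_function_def
proof
  fix c assume "c \<in> A"
  interpret P: chart_patch c "dom c" by (rule patch_dom[OF \<open>c \<in> A\<close>])
  show "smooth_on (coord c ` dom c) (in_coords c (\<lambda>q. a :: real))" using P.sm_const by (simp add: P.sm_def)
qed

lemma constant_scalar_curvature_imp_einstein:
  assumes X: "smooth_vector_field A X"
    and sol: "\<And>c q. c \<in> A \<Longrightarrow> q \<in> dom c \<Longrightarrow>
      ricci g c q + (1/2) *\<^sub>R lie_derivative_metric X g c q = lam q *\<^sub>R g c q"
    and r: "\<And>c q. c \<in> A \<Longrightarrow> q \<in> dom c \<Longrightarrow> scalar_curvature g c q = r"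
    and c: "c \<in> A" and p: "p \<in> dom c"
  shows "ricci g c p = (r / real CARD('n)) *\<^sub>R g c p"
proof -
  define k where "k = r / real CARD('n)"
  define L where "L c q = ricci g c q - k *\<^sub>R g c q" for c q
  define N where "N c q = matrix_inv (g c q) *v (L c q *v X c q)" for c q
  have L_tr: "L c p = transpose (jacobian c d p) ** L d p ** jacobian c d p"
    if "c \<in> A" "d \<in> A" "p \<in> dom c" "p \<in> dom d" for c d p
  proof -
    have L_eq: "L c p = (lam p - k) *\<^sub>R g c p - (1/2) *\<^sub>R lie_derivative_metric X g c p"
      if "c \<in> A" "p \<in> dom c" for c
      using sol[OF that] by (simp add: L_def algebra_simps)
    show ?thesis
      unfolding L_eq[OF that(1,3)] L_eq[OF that(2,4)]
      unfolding metric_trans[OF that] lie_derivative_metric_transforms[OF X that]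
      by (simp add: matrix_mult.diff_left matrix_mult.diff_right matrix_mult.scaleR_left matrix_mult.scaleR_right)
  qed
  have L_sm: "chart_patch.sm c (dom c) (L c)" if "c \<in> A" for c
  proof -
    interpret M: metric_chart c g by (rule mchart[OF that])
    show ?thesis unfolding L_def[abs_def] by (intro M.sm_diff M.sm_scaleR M.sm_const M.sm_ricci M.sm_metric)
  qed
  have N_vf: "smooth_vector_field A N"
    unfolding N_def[abs_def] by (rule smooth_vector_field_raise[OF X L_sm L_tr])
  \<comment> \<open>The sign makes the divergence nonnegative; the summand with coefficient 0 only
    fits the shape of \<open>smooth_vector_field_add_scaleR\<close>.\<close>
  define V where "V c q = 0 *\<^sub>R N c q + (- 1) *\<^sub>R N c q" for c q
  have V_vf: "smooth_vector_field A V"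
    unfolding V_def[abs_def] by (intro smooth_vector_field_add_scaleR N_vf smooth_function_const)
  have key: "divergence g V c q = trace ((matrix_inv (g c q) ** L c q) ** (matrix_inv (g c q) ** L c q))"
      "transpose (L c q) = L c q"
    if c: "c \<in> A" and q: "q \<in> dom c" for c q
  proof -
    interpret M: metric_chart c g by (rule mchart[OF c])
    have smX: "M.sm (X c)" and smV: "M.sm (V c)" and smN: "M.sm (N c)"
      using vector_field_sm X V_vf N_vf c by blast+
    note D = M.divergence_traceless_ricci[where X=X and lam=lam, OF q smX sol[OF c] r[OF c], folded k_def]
    have "V c = (\<lambda>q. (- 1) *\<^sub>R N c q)" by (simp add: V_def fun_eq_iff)
    then have "divergence g V c q = - (\<Sum>i\<in>UNIV. M.Dv (N c) i q $ i)"
      using M.divergence_eq_Dv[where Y=V, OF q smV] M.trace_Dv_scaleR[OF q M.sm_const smN, of "- 1"]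
      by (simp add: M.pd_const)
    also have "N c = (\<lambda>q. (matrix_inv (g c q) ** (ricci g c q - k *\<^sub>R g c q)) *v X c q)"
      by (simp add: fun_eq_iff N_def L_def matrix_vector_mul_assoc)
    finally show "divergence g V c q = trace ((matrix_inv (g c q) ** L c q) ** (matrix_inv (g c q) ** L c q))"
      using D(1) by (simp add: L_def)
    show "transpose (L c q) = L c q" using D(2) by (simp add: L_def)
  qed
  have nonneg: "divergence g V c q \<ge> 0" if c: "c \<in> A" and q: "q \<in> dom c" for c q
  proof -
    interpret M: metric_chart c g by (rule mchart[OF c])
    show ?thesis unfolding key(1)[OF c q]
      by (rule trace_form_nonneg[OF M.inverse_metric_sym[OF q] M.inverse_metric_pos[OF q] key(2)[OF c q]])
  qed
  interpret M: metric_chart c g by (rule mchart[OF c])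
  have "divergence g V c p = 0" by (rule divergence_nonneg_imp_zero[OF V_vf nonneg c p])
  then have "L c p = 0" unfolding key(1)[OF c p]
    by (rule trace_form_eq_0[OF M.inverse_metric_sym[OF p] _ key(2)[OF c p], rotated])
       (rule M.inverse_metric_pos[OF p])
  then show ?thesis by (simp add: L_def k_def)
qed

lemma einstein_soliton_killing_part:
  assumes X: "smooth_vector_field A X" and Y: "smooth_vector_field A Y"
    and h: "smooth_function A h" and lam: "smooth_function A lam" and mu: "smooth_function A mu"
    and sol: "\<And>c q. c \<in> A \<Longrightarrow> q \<in> dom c \<Longrightarrow>
      ricci g c q + (1/2) *\<^sub>R lie_derivative_metric X g c q = lam q *\<^sub>R g c q"
    and ein: "\<And>c q. c \<in> A \<Longrightarrow> q \<in> dom c \<Longrightarrow> ricci g c q = mu q *\<^sub>R g c q"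
    and dmu: "\<And>c q m. c \<in> A \<Longrightarrow> q \<in> dom c \<Longrightarrow> pd c m mu q = 0"
    and dec: "\<And>c q. c \<in> A \<Longrightarrow> q \<in> dom c \<Longrightarrow> X c q = gradient g h c q + Y c q"
    and divY: "\<And>c q. c \<in> A \<Longrightarrow> q \<in> dom c \<Longrightarrow> divergence g Y c q = 0"
    and c: "c \<in> A" and p: "p \<in> dom c"
  shows "lie_derivative_metric Y g c p = 0"
proof -
  define L where "L c q = (1/2) *\<^sub>R lie_derivative_metric Y g c q" for c q
  define N where "N c q = matrix_inv (g c q) *v (L c q *v Y c q)" for c q
  define f where "f q = real (CARD('n) - 1) * (lam q - mu q) + mu q * h q" for q
  have N_vf: "smooth_vector_field A N"
    unfolding N_def[abs_def]
  proof (rule smooth_vector_field_raise[OF Y])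
    show "chart_patch.sm c (dom c) (L c)" if "c \<in> A" for c
    proof -
      interpret M: metric_chart c g by (rule mchart[OF that])
      show ?thesis unfolding L_def[abs_def]
        by (intro M.sm_scaleR M.sm_const M.sm_lie_derivative_metric vector_field_sm Y that)
    qed
    show "L c p = transpose (jacobian c d p) ** L d p ** jacobian c d p"
      if "c \<in> A" "d \<in> A" "p \<in> dom c" "p \<in> dom d" for c d p
      unfolding L_def lie_derivative_metric_transforms[OF Y that]
      by (simp add: matrix_mult.scaleR_left matrix_mult.scaleR_right)
  qed
  have f_sm: "smooth_function A f"
    unfolding smooth_function_def
  proof
    fix c assume c: "c \<in> A"
    interpret P: chart_patch c "dom c" by (rule patch_dom[OF c])
    have "P.sm f" unfolding f_def[abs_def]
      by (intro P.sm_add P.sm_mult P.sm_diff P.sm_const function_sm lam mu h c)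
    then show "smooth_on (coord c ` dom c) (in_coords c f)" by (simp add: P.sm_def)
  qed
  define V where "V c q = 1 *\<^sub>R N c q + f q *\<^sub>R Y c q" for c q
  have V_vf: "smooth_vector_field A V"
    unfolding V_def[abs_def] by (intro smooth_vector_field_add_scaleR N_vf Y f_sm smooth_function_const)
  have key: "divergence g V c q = trace ((matrix_inv (g c q) ** L c q) ** (matrix_inv (g c q) ** L c q))"
      "transpose (L c q) = L c q"
    if c: "c \<in> A" and q: "q \<in> dom c" for c q
  proof -
    interpret M: metric_chart c g by (rule mchart[OF c])
    have sm: "M.sm (X c)" "M.sm (Y c)" "M.sm (V c)" "M.sm h" "M.sm lam" "M.sm mu"
      using vector_field_sm function_sm X Y V_vf h lam mu c by blast+
    note D = M.divergence_einstein_soliton[where X=X and Y=Y and h=h and lam=lam and mu=mu,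
        OF q sm(1,2,4,5,6) sol[OF c] ein[OF c] dmu[OF c q] dec[OF c] divY[OF c]]
    have "V c = (\<lambda>q. (matrix_inv (g c q) ** ((1/2) *\<^sub>R lie_derivative_metric Y g c q)) *v Y c q
        + (real (CARD('n) - 1) * (lam q - mu q) + mu q * h q) *\<^sub>R Y c q)"
      by (simp add: fun_eq_iff V_def N_def L_def f_def matrix_vector_mul_assoc)
    then show "divergence g V c q = trace ((matrix_inv (g c q) ** L c q) ** (matrix_inv (g c q) ** L c q))"
      using D M.divergence_eq_Dv[where Y=V, OF q sm(3)] by (simp add: L_def)
    show "transpose (L c q) = L c q"
      using M.lie_sym[where X=Y, OF q sm(2)] by (simp add: L_def transpose_scalar)
  qed
  have nonneg: "divergence g V c q \<ge> 0" if c: "c \<in> A" and q: "q \<in> dom c" for c q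
  proof -
    interpret M: metric_chart c g by (rule mchart[OF c])
    show ?thesis unfolding key(1)[OF c q]
      by (rule trace_form_nonneg[OF M.inverse_metric_sym[OF q] M.inverse_metric_pos[OF q] key(2)[OF c q]])
  qed
  interpret M: metric_chart c g by (rule mchart[OF c])
  have "divergence g V c p = 0" by (rule divergence_nonneg_imp_zero[OF V_vf nonneg c p])
  then have "L c p = 0" unfolding key(1)[OF c p]
    by (rule trace_form_eq_0[OF M.inverse_metric_sym[OF p] _ key(2)[OF c p], rotated])
       (rule M.inverse_metric_pos[OF p])
  then show ?thesis by (simp add: L_def)
qed

end

theorem corollary3:
  fixes T :: "'a topology"
    and A Or :: "('a, 'n::finite) chart set"
    and g :: "('a, 'n) tensor2"
    and X Y :: "('a, 'n) vfield"
    and lam h :: "'a \<Rightarrow> real"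
  assumes "CARD('n) \<ge> 3"
    and "almost_ricci_soliton T A g X lam"
    and "\<not> trivial_soliton A g X"
    and "compact_space T"
    and "orientation T A Or"
    and "hodge_de_rham_decomposition A g X h Y"
    and "conformal_field A g X \<or> constant_scalar_curvature A g"
  shows "killing_field A g Y"
proof -
  interpret closed_riemannian_manifold T A g
    using assms(2,4) by unfold_locales (auto simp: almost_ricci_soliton_def)
  have X: "smooth_vector_field A X" and lam: "smooth_function A lam"
    and sol: "\<And>c q. c \<in> A \<Longrightarrow> q \<in> dom c \<Longrightarrow>
      ricci g c q + (1/2) *\<^sub>R lie_derivative_metric X g c q = lam q *\<^sub>R g c q"
    using assms(2) unfolding almost_ricci_soliton_def by blast+
  have Y: "smooth_vector_field A Y" and h: "smooth_function A h"
    and divY: "\<And>c q. c \<in> A \<Longrightarrow> q \<in> dom c \<Longrightarrow> divergence g Y c q = 0"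
    and dec: "\<And>c q. c \<in> A \<Longrightarrow> q \<in> dom c \<Longrightarrow> X c q = gradient g h c q + Y c q"
    using assms(6) unfolding hodge_de_rham_decomposition_def by blast+
  \<comment> \<open>The interface to the Einstein argument asks for a vanishing differential of
    \<open>mu\<close> in place of global constancy, as the manifold may have several
    components.\<close>
  have "\<exists>mu. smooth_function A mu \<and> (\<forall>c\<in>A. \<forall>q\<in>dom c. ricci g c q = mu q *\<^sub>R g c q) \<and>
      (\<forall>c\<in>A. \<forall>q\<in>dom c. \<forall>m. pd c m mu q = 0)"
    using assms(7)
  proof
    assume "conformal_field A g X"
    then obtain rho where rho: "smooth_function A rho"
      and conf: "\<And>c q. c \<in> A \<Longrightarrow> q \<in> dom c \<Longrightarrow> lie_derivative_metric X g c q = (2 * rho q) *\<^sub>R g c q"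
      unfolding conformal_field_def by blast
    \<comment> \<open>Half the Lie derivative is \<open>rho\<close> times the metric; subtracting it
      in the soliton equation leaves this factor.\<close>
    define mu where "mu q = lam q - rho q" for q
    have smmu: "chart_patch.sm c (dom c) mu" if "c \<in> A" for c
    proof -
      interpret P: chart_patch c "dom c" by (rule patch_dom[OF that])
      show ?thesis unfolding mu_def[abs_def] by (intro P.sm_diff function_sm lam rho that)
    qed
    have mu: "smooth_function A mu"
      unfolding smooth_function_def
    proof
      fix c assume c: "c \<in> A"
      interpret P: chart_patch c "dom c" by (rule patch_dom[OF c])
      show "smooth_on (coord c ` dom c) (in_coords c mu)" using smmu[OF c] by (simp add: P.sm_def)
    qed
    have ein: "ricci g c q = mu q *\<^sub>R g c q" if "c \<in> A" "q \<in> dom c" for c q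
      using sol[OF that] conf[OF that] by (simp add: mu_def algebra_simps)
    have "pd c m mu q = 0" if "c \<in> A" "q \<in> dom c" for c q m
      using metric_chart.schur[OF mchart[OF that(1)] that(2) assms(1) smmu[OF that(1)] ein[OF that(1)]] .
    with mu ein show ?thesis by blast
  next
    assume "constant_scalar_curvature A g"
    then obtain r where r: "\<And>c q. c \<in> A \<Longrightarrow> q \<in> dom c \<Longrightarrow> scalar_curvature g c q = r"
      unfolding constant_scalar_curvature_def by blast
    have "ricci g c q = (r / real CARD('n)) *\<^sub>R g c q" if "c \<in> A" "q \<in> dom c" for c q
      by (rule constant_scalar_curvature_imp_einstein[OF X sol r that])
    moreover have "pd c m (\<lambda>q. r / real CARD('n)) q = 0" if "c \<in> A" for c q m
      by (rule chart_patch.pd_const[OF patch_dom[OF that]])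
    ultimately show ?thesis
      using smooth_function_const by (intro exI[of _ "\<lambda>q. r / real CARD('n)"]) blast
  qed
  then obtain mu where mu: "smooth_function A mu"
    and ein: "\<And>c q. c \<in> A \<Longrightarrow> q \<in> dom c \<Longrightarrow> ricci g c q = mu q *\<^sub>R g c q"
    and dmu: "\<And>c q m. c \<in> A \<Longrightarrow> q \<in> dom c \<Longrightarrow> pd c m mu q = 0" by blast
  have "lie_derivative_metric Y g c p = 0" if "c \<in> A" "p \<in> dom c" for c p
    by (rule einstein_soliton_killing_part[OF X Y h lam mu sol ein dmu dec divY that])
  then show ?thesis using Y by (simp add: killing_field_def)
qed

end
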